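(* Let $K>0$, $\theta>0$, $0<\beta<1$, $0<\gamma<1$. Let $X(t)$, $t\ge 0$, be a critical continuous-time Markov branching process started from one particle, with exponential life-times of parameter $K$ and branching mechanism (offspring) p.g.f. $h(s)=s+\frac{(1-s)^{1+\beta}}{1+\beta}$, so that the solution $F(t,s)=\mathbb{E}[s^{X(t)}]$ of the Kolmogorov equation is given by $$1-F(t,s)=(1-s)\left\{1+\frac{K\beta(1-s)^\beta t}{1+\beta}\right\}^{-1/\beta}.$$ If the flow of immigration is defined by the discrete-stable process with p.g.f. $G(t,s)=\exp\{-\theta t(1-s)^\gamma\}$, $|s|\le 1$, then the number $Y(t)$ of particles alive at time $t>0$ in the resulting branching process with immigration has the following p.g.f. $\Phi(t,s)=\mathbb{E}[s^{Y(t)}]$. (i) If $\beta=\gamma$, then $$\Phi(t,s)=\left(\frac{1}{1+\frac{t(1-s)^\beta}{A}}\right)^{\theta A}:=\left(\frac{1}{B(t,s)}\right)^{\theta A},$$ where $$A=\frac{1+\beta}{K\beta},\qquad B(t,s)=1+\frac{t(1-s)^\beta}{A},\qquad B:=B(t,s).$$ (ii) If $\beta\neq\gamma$, then $$\Phi(t,s)=\exp\left\{\frac{-\theta A(1-s)^\gamma}{(1-s)^\beta}\left(\frac{B^{1-\delta}-1}{1-\delta}\right)\right\},\qquad \delta=\frac{\gamma}{\beta}>0,$$ or, in series expansion, $$\Phi(t,s)=\exp\left\{-\theta t(1-s)^\gamma\left(1+\sum_{j=2}^\infty\left(\frac{(1-s)^\beta t}{A}\right)^{j-1}\frac{[-\delta]_{(j-1)\downarrow}}{j!}\right)\right\},$$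 where the relation between the increasing and decreasing factorials is $$[1-\delta]_{j\downarrow}=(1-\delta)[-\delta]_{(j-1)\downarrow}=-(\delta-1)(-1)^{j-1}[\delta]_{(j-1)\uparrow}.$$ For any fixed time $t<\infty$, $\lim_{s\to 1}\Phi(t,s)=1$.
   Context: The p.g.f. (probability generating function) of a nonnegative-integer-valued random variable $N$ is $s\mapsto\mathbb{E}[s^N]$, $|s|\le 1$. Powers of complex numbers are taken with the principal branch. Falling and rising factorials: $[a]_{k\downarrow}=a(a-1)\cdots(a-k+1)$ and $[a]_{k\uparrow}=a(a+1)\cdots(a+k-1)$, with $[a]_{0\downarrow}=[a]_{0\uparrow}=1$. Branching process without immigration: $X(t)$, $t\ge 0$, is the continuous-time Markov branching process with $X(0)=1$ in which each particle lives independently an exponential time of parameter $K$ and at death is replaced by a random number of particles with p.g.f. $h$. Its infinitesimal generating function is $f(s)=K(h(s)-s)=K\frac{(1-s)^{1+\beta}}{1+\beta}$, and $F(t,s)=\mathbb{E}[s^{X(t)}]$ solves the backward Kolmogorov equation $\frac{d}{dt}F(t,s)=\frac{K}{1+\beta}(1-F(t,s))^{1+\beta}$, $F(0,s)=s$, whose explicit solution is the one displayed in the claim. Immigration: immigrants arrive in groups at the jump times $0<\tau_1<\tau_2<\cdots$ of a homogeneous Poisson process $N(t)$ of rate $\theta$, i.e. $\mathbb{E}[s^{N(t)}]=\exp\{-\theta t(1-s)\}$. The group sizes $I_1,I_2,\dots$ are i.i.d. with Sibuya p.g.f. $g(s)=\mathbb{E}[s^{I_n}]=1-(1-s)^\gamma$,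 that is, $P(I_n=k)=(-1)^{k-1}\frac{[\gamma]_{k\downarrow}}{k!}$, $k=1,2,\dots$. Thus the immigration flow is the compound Poisson process with p.g.f. $G(t,s)=\exp\{-\theta t(1-g(s))\}=\exp\{-\theta t(1-s)^\gamma\}$. Branching process with immigration: $$Y(t)=\sum_{i=1}^{N(t)}\sum_{j=1}^{I_i}X_{i,j}(t-\tau_i),\qquad t\ge 0,$$ where the $X_{i,j}$ are independent copies of the process $X$; the Poisson process, the group sizes and the processes $X_{i,j}$ are mutually independent.
   Formalization: The series expansion in (ii) diverges when |(1-s)^β t/A| > 1, so it is claimed only where the series converges, and convergence is asserted whenever |(1-s)^β t/A| < 1; at s = 1 the quotient 0/0 in the closed form of (ii) is read as 0. *)

theory Defs
  imports "HOL-Probability.Probability"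
begin

definition pgf :: "'a measure \<Rightarrow> ('a \<Rightarrow> nat) \<Rightarrow> complex \<Rightarrow> complex" where
  "pgf M V s = (LINT \<omega>|M. s ^ V \<omega>)"

definition has_pgf :: "'a measure \<Rightarrow> ('a \<Rightarrow> nat) \<Rightarrow> (complex \<Rightarrow> complex) \<Rightarrow> bool" where
  "has_pgf M V g \<longleftrightarrow>
     V \<in> measurable M (count_space UNIV) \<and> (\<forall>s. cmod s \<le> 1 \<longrightarrow> pgf M V s = g s)"

definition falling_factorial :: "'a::comm_ring_1 \<Rightarrow> nat \<Rightarrow> 'a" where
  "falling_factorial a k = (\<Prod>i<k. a - of_nat i)"

text \<open>
  Particles carry Ulam--Harris labels: the root is \<open>[]\<close>, and the children of \<open>u\<close> are
  \<open>u @ [k]\<close> for \<open>k < Z u\<close>, where \<open>Z u\<close> is the number of offspring left by \<open>u\<close> at its death;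
  \<open>L u\<close> is its life-time.
\<close>

type_synonym label = "nat list"

definition birth_time :: "(label \<Rightarrow> 'a \<Rightarrow> real) \<Rightarrow> label \<Rightarrow> 'a \<Rightarrow> real" where
  "birth_time L u \<omega> = (\<Sum>k<length u. L (take k u) \<omega>)"

definition alive ::
  "(label \<Rightarrow> 'a \<Rightarrow> real) \<Rightarrow> (label \<Rightarrow> 'a \<Rightarrow> nat) \<Rightarrow> real \<Rightarrow> 'a \<Rightarrow> label set" where
  "alive L Z t \<omega> =
     {u. (\<forall>k<length u. u ! k < Z (take k u) \<omega>) \<and>
         birth_time L u \<omega> \<le> t \<and> t < birth_time L u \<omega> + L u \<omega>}"

text \<open>
  Branching process started from one particle, with life-time parameter \<open>K\<close> and offspring
  p.g.f. \<open>h\<close>.  All life-times and all offspring numbers are mutually independent; offspring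
  numbers are cast to \<open>real\<close> only so that one family can hold both.
\<close>

definition markov_branching_process ::
  "'a measure \<Rightarrow> real \<Rightarrow> (complex \<Rightarrow> complex) \<Rightarrow> (real \<Rightarrow> 'a \<Rightarrow> nat) \<Rightarrow> bool" where
  "markov_branching_process M K h X \<longleftrightarrow>
     (\<exists>L Z.
        prob_space.indep_vars M (\<lambda>_. borel)
          (case_sum L (\<lambda>u \<omega>. real (Z u \<omega>))) (UNIV :: (label + label) set) \<and>
        (\<forall>u. distributed M lborel (L u) (exponential_density K)) \<and>
        (\<forall>u. has_pgf M (Z u) h) \<and>
        (\<forall>t\<ge>0. \<forall>\<omega>\<in>space M. X t \<omega> = card (alive L Z t \<omega>)))"

definition poisson_process :: "'a measure \<Rightarrow> real \<Rightarrow> (real \<Rightarrow> 'a \<Rightarrow> nat) \<Rightarrow> bool" where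
  "poisson_process M \<theta> N \<longleftrightarrow>
     (\<forall>t\<ge>0. N t \<in> measurable M (count_space UNIV)) \<and>
     (\<forall>\<omega>\<in>space M. N 0 \<omega> = 0 \<and> mono_on {0..} (\<lambda>t. N t \<omega>) \<and>
        (\<forall>t\<ge>0. continuous (at_right t) (\<lambda>t. N t \<omega>))) \<and>
     (\<forall>r t. 0 \<le> r \<and> r < t \<longrightarrow>
        distr M (count_space UNIV) (\<lambda>\<omega>. N t \<omega> - N r \<omega>) =
          measure_pmf (poisson_pmf (\<theta> * (t - r)))) \<and>
     (\<forall>n (r :: nat \<Rightarrow> real). 0 \<le> r 0 \<and> mono r \<longrightarrow>
        prob_space.indep_vars M (\<lambda>_. count_space UNIV)
          (\<lambda>k \<omega>. N (r (Suc k)) \<omega> - N (r k) \<omega>) {..<n})"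

text \<open>
  Groups are numbered from 0: group \<open>i\<close> arrives at the \<open>(i + 1)\<close>-st jump, which takes place
  by time \<open>t\<close> exactly if \<open>i < N t \<omega>\<close>.
\<close>

definition arrival_time :: "(real \<Rightarrow> 'a \<Rightarrow> nat) \<Rightarrow> nat \<Rightarrow> 'a \<Rightarrow> real" where
  "arrival_time N i \<omega> = Inf {t. 0 \<le> t \<and> i < N t \<omega>}"

definition immigration_process ::
  "(real \<Rightarrow> 'a \<Rightarrow> nat) \<Rightarrow> (nat \<Rightarrow> 'a \<Rightarrow> nat) \<Rightarrow> (nat \<Rightarrow> nat \<Rightarrow> real \<Rightarrow> 'a \<Rightarrow> nat)
     \<Rightarrow> real \<Rightarrow> 'a \<Rightarrow> nat" where
  "immigration_process N I X t \<omega> =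
     (\<Sum>i<N t \<omega>. \<Sum>j<I i \<omega>. X i j (t - arrival_time N i \<omega>) \<omega>)"

definition process_events :: "'a measure \<Rightarrow> (real \<Rightarrow> 'a \<Rightarrow> nat) \<Rightarrow> 'a set set" where
  "process_events M V = sigma_sets (space M) {V t -` S \<inter> space M | t S. 0 \<le> t}"

datatype source = Arrivals | Group nat | Family nat nat

fun source_events ::
  "'a measure \<Rightarrow> (real \<Rightarrow> 'a \<Rightarrow> nat) \<Rightarrow> (nat \<Rightarrow> 'a \<Rightarrow> nat) \<Rightarrow> (nat \<Rightarrow> nat \<Rightarrow> real \<Rightarrow> 'a \<Rightarrow> nat)
     \<Rightarrow> source \<Rightarrow> 'a set set" where
  "source_events M N I X Arrivals = process_events M N"
| "source_events M N I X (Group i) = {I i -` S \<inter> space M | S. True}"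
| "source_events M N I X (Family i j) = process_events M (X i j)"

end

theory Submission
  imports Defs
begin

text \<open>
  The groups arriving up to time \<open>t\<close> contribute independently to \<open>Y(t)\<close>, so its generating function
  follows from the Poisson law of the arrivals and from the generating function of a single family.

  \<^bold>\<open>A single family.\<close>  The life \<open>l\<close> of the root is split off: either \<open>l > t\<close>, and one particle is
  alive, or the root has \<open>Z\<close> children at time \<open>l\<close>, each starting an independent copy of the tree.
  Hence the generating function \<open>F\<close> satisfies a renewal equation, whose differentiated form is
  \<open>F' = K (h(F) - F)\<close>.  Three points need care.  The tree may be infinite, so the renewal step is
  made for the population of the first \<open>n\<close> generations, which is always finite (\<open>pgf_pop\<close>, by
  induction over all trees at once, which makes the law of a subtree irrelevant), and \<open>n\<close> then tends
  to infinity.  This limit is legitimate because almost surely only finitely many particles are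
  born before any given time (\<open>AE_non_explosive\<close>): as the mean number of children is at most \<open>1\<close> and
  \<open>E[exp (- K l)] = 1/2\<close>, the sum of \<open>exp (- K b)\<close> over all birth times \<open>b\<close> has expectation at most \<open>2\<close>.
  Finally, all powers are principal ones.  The integral equation gives \<open>Re F < 1\<close> whenever \<open>s \<noteq> 1\<close>,
  so \<open>1 - F\<close> never leaves the right half plane; there \<open>(1 - F) powr (- \<beta>)\<close> has the constant
  derivative \<open>K \<beta> / (1 + \<beta>)\<close>, and the linear function so found can be inverted without crossing a
  branch cut (\<open>log_solution_of_kolmogorov\<close>).

  \<^bold>\<open>Immigration.\<close>  The target is \<open>\<Phi>(t,s) = exp (- \<theta> \<integral>\<^sub>0\<^sup>t (1 - g(F(v,s))) dv)\<close> (\<open>pgf_immigration\<close>).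
  Divide \<open>[0,t]\<close> into \<open>m\<close> equal intervals and let every group start at the left end of the
  interval in which it arrives.  For the discretised sum, conditioning on the countably many values
  of the Poisson counts at the grid points and using independence over groups and over increments
  gives \<open>exp (\<theta> (t/m) \<Sum>\<^sub>k (g(F(t - k t/m,s)) - 1))\<close> (\<open>pgf_discretised\<close>).  For \<open>m \<longlonglongrightarrow> \<infinity>\<close> the exponent is
  a Riemann sum, and the discretised sums are eventually equal to \<open>Y(t)\<close>, because the populations
  are right-continuous step functions and left end points approach arrival times from below
  (\<open>discretised_eventually_eq\<close>).

  \<^bold>\<open>Evaluation.\<close>  With \<open>B = 1 + v (1 - s)\<^sup>\<beta> / A\<close> the integrand is \<open>(1 - s)\<^sup>\<gamma> B powr (- \<delta>)\<close>, whose primitive is a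
  logarithm if \<open>\<delta> = 1\<close> and a power of \<open>B\<close> otherwise.  The series is the binomial series of
  \<open>B powr (1 - \<delta>)\<close> without its constant term, divided by its linear term.  It never terminates and has radius of convergence \<open>1\<close>;
  at points of the unit circle where it converges, Abel's limit theorem identifies the sum
  (\<open>binomial_series_right_half_plane\<close>).
\<close>

section \<open>Generating functions and independence\<close>

text \<open>
  Singleton blocks turn a subfamily into a grouping, for which independence is available.
\<close>

lemma (in prob_space) indep_vars_reindex:
  assumes "indep_vars M' X UNIV" and f: "inj f"
  shows "indep_vars (\<lambda>j. M' (f j)) (\<lambda>j. X (f j)) UNIV"
proof -
  have "indep_vars (\<lambda>j. PiM {f j} M') (\<lambda>j \<omega>. restrict (\<lambda>i. X i \<omega>) {f j}) UNIV"
    using f by (intro indep_vars_restrict[OF assms(1)]) (auto simp: disjoint_family_on_def inj_def)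
  then have "indep_vars (\<lambda>j. M' (f j)) (\<lambda>j \<omega>. (restrict (\<lambda>i. X i \<omega>) {f j}) (f j)) UNIV"
    by (rule indep_vars_compose2) simp
  then show ?thesis by simp
qed

lemma (in prob_space) integrable_bounded:
  fixes f :: "'a \<Rightarrow> complex"
  assumes "f \<in> borel_measurable M" "\<And>\<omega>. norm (f \<omega>) \<le> 1"
  shows "integrable M f"
  using assms by (intro integrable_const_bound[where B=1]) auto

lemma (in prob_space) norm_expectation_le_1:
  fixes f :: "'a \<Rightarrow> complex"
  assumes "f \<in> borel_measurable M" "\<And>\<omega>. norm (f \<omega>) \<le> 1"
  shows "norm (expectation f) \<le> 1"
proof -
  have "norm (expectation f) \<le> expectation (\<lambda>\<omega>. norm (f \<omega>))"
    by (rule integral_norm_bound)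
  also have "\<dots> \<le> expectation (\<lambda>_. 1)"
    using assms by (intro integral_mono integrable_bounded integrable_norm) auto
  finally show ?thesis by (simp add: prob_space)
qed

lemma measurable_nat_power [measurable]:
  fixes s :: complex
  assumes "V \<in> measurable M (count_space UNIV)"
  shows "(\<lambda>\<omega>. s ^ V \<omega>) \<in> borel_measurable M"
  using measurable_compose[OF assms, of "\<lambda>n. s ^ n" borel] by simp

lemma norm_nat_power_le_1: "norm s \<le> 1 \<Longrightarrow> norm ((s::complex) ^ n) \<le> 1"
  by (simp add: norm_power power_le_one)

lemma (in prob_space) norm_pgf_le_1:
  assumes "V \<in> measurable M (count_space UNIV)" "norm s \<le> 1"
  shows "norm (pgf M V s) \<le> 1"
  unfolding pgf_def using assms by (intro norm_expectation_le_1 norm_nat_power_le_1) auto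

lemma (in prob_space) pgf_1: "pgf M V 1 = 1"
  by (simp add: pgf_def prob_space)

lemma (in prob_space) continuous_on_pgf:
  assumes [measurable]: "V \<in> measurable M (count_space UNIV)"
  shows "continuous_on (cball 0 1) (pgf M V)"
  unfolding continuous_on_sequentially pgf_def comp_def
proof safe
  fix x :: "nat \<Rightarrow> complex" and s :: complex
  assume x: "\<forall>n. x n \<in> cball 0 1" "x \<longlonglongrightarrow> s" and s: "s \<in> cball 0 1"
  show "(\<lambda>n. LINT \<omega>|M. x n ^ V \<omega>) \<longlonglongrightarrow> (LINT \<omega>|M. s ^ V \<omega>)"
  proof (rule integral_dominated_convergence[where w="\<lambda>_. 1"])
    show "AE \<omega> in M. (\<lambda>n. x n ^ V \<omega>) \<longlonglongrightarrow> s ^ V \<omega>"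
      using x(2) by (auto intro!: AE_I2 tendsto_power)
    show "AE \<omega> in M. norm (x n ^ V \<omega>) \<le> 1" for n
      using x(1) by (auto intro!: norm_nat_power_le_1)
  qed auto
qed

text \<open>
  Conditioning on a discrete variable: on \<open>{j(X) = c}\<close> the integrand is \<open>\<phi> c (Y)\<close>, which is
  independent of that event, so \<open>c\<close> may be frozen inside the inner expectation.  Both variables are
  given as functions of \<open>X\<close> and \<open>Y\<close> with a common range type because independence of a pair is
  only defined in that case.
\<close>

lemma (in prob_space) expectation_random_index:
  fixes j :: "'b \<Rightarrow> 'c::countable" and \<phi> :: "'c \<Rightarrow> 'b \<Rightarrow> complex"
  assumes ind: "indep_var S X T Y"
    and j[measurable]: "j \<in> measurable S (count_space UNIV)"
    and \<phi>[measurable]: "\<And>c. \<phi> c \<in> borel_measurable T"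
    and bound': "\<And>c y. norm (\<phi> c y) \<le> 1"
  shows "expectation (\<lambda>\<omega>. \<phi> (j (X \<omega>)) (Y \<omega>)) =
    expectation (\<lambda>\<omega>. expectation (\<lambda>\<omega>'. \<phi> (j (X \<omega>)) (Y \<omega>')))"
proof -
  have [measurable]: "X \<in> measurable M S" "Y \<in> measurable M T"
    using indep_var_rv1[OF ind] indep_var_rv2[OF ind] by auto
  define J where "J \<omega> = j (X \<omega>)" for \<omega>
  define \<Phi> where "\<Phi> c \<omega> = \<phi> c (Y \<omega>)" for c \<omega>
  have [measurable]: "J \<in> measurable M (count_space UNIV)"
    unfolding J_def[abs_def] by measurable
  have [measurable]: "\<Phi> c \<in> borel_measurable M" for c
    unfolding \<Phi>_def[abs_def] by measurable
  have bound: "norm (\<Phi> c \<omega>) \<le> 1" for c \<omega>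
    by (simp add: \<Phi>_def bound')
  \<comment> \<open>the indicator of the event that \<open>J\<close> takes its \<open>n\<close>-th value\<close>
  define R where "R n \<omega> = (if to_nat (J \<omega>) = n then 1 else 0 :: complex)" for n \<omega>
  have [measurable]: "R n \<in> borel_measurable M" for n unfolding R_def by measurable
  have Rb: "norm (R n \<omega>) \<le> 1" for n \<omega> by (simp add: R_def)
  have split: "expectation (\<lambda>\<omega>. \<Psi> (J \<omega>) \<omega>) = (\<Sum>n. expectation (\<lambda>\<omega>. R n \<omega> * \<Psi> (from_nat n) \<omega>))"
    if [measurable]: "\<And>c. \<Psi> c \<in> borel_measurable M" and b: "\<And>c \<omega>. norm (\<Psi> c \<omega>) \<le> 1"
    for \<Psi> :: "'c \<Rightarrow> 'a \<Rightarrow> complex"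
  proof -
    have b': "norm (R n \<omega> * \<Psi> (from_nat n) \<omega>) \<le> 1" for n \<omega>
      using b by (simp add: R_def)
    have *: "\<Psi> (J \<omega>) \<omega> = (\<Sum>n. R n \<omega> * \<Psi> (from_nat n) \<omega>)" for \<omega>
      by (subst suminf_finite[of "{to_nat (J \<omega>)}"]) (auto simp: R_def)
    have "(\<lambda>n. prob {\<omega>\<in>space M. to_nat (J \<omega>) = n}) sums prob (\<Union>n. {\<omega>\<in>space M. to_nat (J \<omega>) = n})"
      by (intro finite_measure_UNION) (auto simp: disjoint_family_on_def)
    then have sm: "summable (\<lambda>n. prob {\<omega>\<in>space M. to_nat (J \<omega>) = n})"
      by (rule sums_summable)
    show ?thesis
      unfolding *
    proof (rule integral_suminf)
      show "integrable M (\<lambda>\<omega>. R n \<omega> * \<Psi> (from_nat n) \<omega>)" for n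
        by (intro integrable_bounded b') auto
      show "AE \<omega> in M. summable (\<lambda>n. norm (R n \<omega> * \<Psi> (from_nat n) \<omega>))"
        by (intro AE_I2 summable_finite[of "{to_nat (J _)}"]) (auto simp: R_def)
      show "summable (\<lambda>n. expectation (\<lambda>\<omega>. norm (R n \<omega> * \<Psi> (from_nat n) \<omega>)))"
      proof (rule summable_comparison_test'[OF sm])
        fix n
        have "expectation (\<lambda>\<omega>. norm (R n \<omega> * \<Psi> (from_nat n) \<omega>)) \<le>
            expectation (indicator {\<omega>\<in>space M. to_nat (J \<omega>) = n})"
        proof (rule integral_mono)
          show "integrable M (\<lambda>\<omega>. norm (R n \<omega> * \<Psi> (from_nat n) \<omega>))"
            by (intro integrable_norm integrable_bounded b') auto
          show "integrable M (indicator {\<omega>\<in>space M. to_nat (J \<omega>) = n} :: 'a \<Rightarrow> real)"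
            by (intro integrable_real_indicator) (auto simp: less_top[symmetric])
        qed (use b in \<open>auto simp: R_def\<close>)
        then show "norm (expectation (\<lambda>\<omega>. norm (R n \<omega> * \<Psi> (from_nat n) \<omega>))) \<le> prob {\<omega>\<in>space M. to_nat (J \<omega>) = n}"
          by simp
      qed
    qed
  qed
  have "expectation (\<lambda>\<omega>. \<Phi> (J \<omega>) \<omega>) = (\<Sum>n. expectation (\<lambda>\<omega>. R n \<omega> * \<Phi> (from_nat n) \<omega>))"
    by (rule split) (auto intro: bound)
  also have "\<dots> = (\<Sum>n. expectation (\<lambda>\<omega>. R n \<omega> * expectation (\<Phi> (from_nat n))))"
  proof (intro suminf_cong)
    fix n
    have "indep_var borel ((\<lambda>x. if to_nat (j x) = n then 1 else 0 :: complex) \<circ> X) borel (\<phi> (from_nat n) \<circ> Y)"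
      by (rule indep_var_compose[OF ind]) measurable
    then have "indep_var borel (R n) borel (\<Phi> (from_nat n))"
      by (simp add: comp_def R_def[abs_def] J_def \<Phi>_def[abs_def])
    then have "expectation (\<lambda>\<omega>. R n \<omega> * \<Phi> (from_nat n) \<omega>) = expectation (R n) * expectation (\<Phi> (from_nat n))"
      by (rule indep_var_lebesgue_integral) (auto intro!: integrable_bounded bound Rb)
    then show "expectation (\<lambda>\<omega>. R n \<omega> * \<Phi> (from_nat n) \<omega>) = expectation (\<lambda>\<omega>. R n \<omega> * expectation (\<Phi> (from_nat n)))"
      by simp
  qed
  also have "\<dots> = expectation (\<lambda>\<omega>. expectation (\<Phi> (J \<omega>)))"
    by (rule split[symmetric]) (auto intro!: norm_expectation_le_1 bound)
  finally show ?thesis by (simp add: J_def \<Phi>_def[abs_def])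
qed

text \<open>
  The generating function of a random sum is the composition of the two generating functions.  It is
  used for the children of a particle, for the immigrants in a group and for the groups themselves.
\<close>

lemma (in prob_space) pgf_random_sum:
  assumes ind: "indep_vars (\<lambda>_. count_space UNIV) (case_nat J V) UNIV"
    and V: "\<And>k. pgf M (V k) s = p" and s: "norm s \<le> 1"
  shows "pgf M (\<lambda>\<omega>. \<Sum>k<J \<omega>. V k \<omega>) s = pgf M J p"
proof -
  have [measurable]: "J \<in> measurable M (count_space UNIV)" "V k \<in> measurable M (count_space UNIV)" for k
    using ind unfolding indep_vars_def by (auto dest: spec[of _ 0] spec[of _ "Suc k"])
  have V': "indep_vars (\<lambda>_. count_space UNIV) V UNIV"
    using indep_vars_reindex[OF ind, of Suc] by simp
  define \<Phi> where "\<Phi> n \<omega> = s ^ (\<Sum>k<n. V k \<omega>)" for n \<omega>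
  have E: "expectation (\<Phi> n) = p ^ n" for n
  proof -
    have "expectation (\<Phi> n) = expectation (\<lambda>\<omega>. \<Prod>k<n. s ^ V k \<omega>)"
      by (simp add: \<Phi>_def[abs_def] power_sum)
    also have "\<dots> = (\<Prod>k<n. expectation (\<lambda>\<omega>. s ^ V k \<omega>))"
    proof (rule indep_vars_lebesgue_integral)
      show "indep_vars (\<lambda>_. borel) (\<lambda>k \<omega>. s ^ V k \<omega>) {..<n}"
        by (rule indep_vars_compose2[OF indep_vars_subset[OF V']]) auto
    qed (auto intro!: integrable_bounded norm_nat_power_le_1 s)
    also have "\<dots> = p ^ n"
      using V by (simp add: pgf_def)
    finally show ?thesis .
  qed
  let ?A = "\<lambda>\<omega>. restrict (\<lambda>i. case_nat J V i \<omega>) {0}" and ?B = "\<lambda>\<omega>. restrict (\<lambda>i. case_nat J V i \<omega>) {1..}"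
  have "indep_var (PiM {0} (\<lambda>_. count_space UNIV)) ?A (PiM {1..} (\<lambda>_. count_space UNIV)) ?B"
    by (rule indep_var_restrict[OF ind]) auto
  from expectation_random_index[OF this, of "\<lambda>w. w 0" "\<lambda>n w. s ^ (\<Sum>k<n. w (Suc k))"]
  have "expectation (\<lambda>\<omega>. \<Phi> (J \<omega>) \<omega>) = expectation (\<lambda>\<omega>. expectation (\<Phi> (J \<omega>)))"
    by (simp add: \<Phi>_def[abs_def] norm_nat_power_le_1 s)
  then show ?thesis by (simp add: E pgf_def) (simp add: \<Phi>_def)
qed

text \<open>
  Fubini's theorem, with one of the two independent parts passed through the map \<open>j\<close> first; below, \<open>j\<close>
  picks the life-time of the root.
\<close>

lemma (in prob_space) expectation_indep_pair:
  fixes f :: "'c \<times> 'b \<Rightarrow> complex"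
  assumes ind: "indep_var S X T Y" and j[measurable]: "j \<in> measurable S S'"
    and f[measurable]: "f \<in> borel_measurable (S' \<Otimes>\<^sub>M T)"
    and bound: "\<And>p. norm (f p) \<le> 1"
  shows "expectation (\<lambda>\<omega>. f (j (X \<omega>), Y \<omega>)) =
      (\<integral>x. expectation (\<lambda>\<omega>. f (x, Y \<omega>)) \<partial>distr M S' (\<lambda>\<omega>. j (X \<omega>)))" (is ?eq)
    and "(\<lambda>x. expectation (\<lambda>\<omega>. f (x, Y \<omega>))) \<in> borel_measurable S'" (is ?meas)
proof -
  have [measurable]: "X \<in> measurable M S" "Y \<in> measurable M T"
    using indep_var_rv1[OF ind] indep_var_rv2[OF ind] by auto
  interpret X: prob_space "distr M S X" by (rule prob_space_distr) simp
  interpret Y: prob_space "distr M T Y" by (rule prob_space_distr) simp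
  interpret XY: pair_prob_space "distr M S X" "distr M T Y" ..
  show meas: ?meas by measurable
  have "distr M S X \<Otimes>\<^sub>M distr M T Y = distr M (S \<Otimes>\<^sub>M T) (\<lambda>x. (X x, Y x))"
    using ind by (simp add: indep_var_distribution_eq)
  then have "expectation (\<lambda>\<omega>. f (j (X \<omega>), Y \<omega>)) =
      (\<integral>p. f (j (fst p), snd p) \<partial>(distr M S X \<Otimes>\<^sub>M distr M T Y))"
    by (simp add: integral_distr)
  also have "\<dots> = (\<integral>x. \<integral>y. f (j x, y) \<partial>distr M T Y \<partial>distr M S X)"
    by (subst XY.integral_fst'[symmetric]) (auto intro!: XY.integrable_bounded bound)
  also have "\<dots> = (\<integral>x. expectation (\<lambda>\<omega>. f (j x, Y \<omega>)) \<partial>distr M S X)"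
    by (intro Bochner_Integration.integral_cong refl integral_distr) auto
  also have "\<dots> = expectation (\<lambda>\<omega>'. expectation (\<lambda>\<omega>. f (j (X \<omega>'), Y \<omega>)))"
    using meas by (intro integral_distr) auto
  also have "\<dots> = (\<integral>x. expectation (\<lambda>\<omega>. f (x, Y \<omega>)) \<partial>distr M S' (\<lambda>\<omega>. j (X \<omega>)))"
    using meas by (intro integral_distr[symmetric]) auto
  finally show ?eq .
qed

section \<open>Family trees and their first branching\<close>

text \<open>
  The number of particles alive at time \<open>t\<close> in the first \<open>n\<close> generations of a realised tree with
  life-times \<open>l\<close> and offspring numbers \<open>z\<close>.  Recursion through the children of the root makes it
  measurable in all arguments jointly and exposes the branching property; being a finite sum, it
  is meaningful even if the tree explodes.
\<close>

primrec pop :: "nat \<Rightarrow> (label \<Rightarrow> real) \<Rightarrow> (label \<Rightarrow> nat) \<Rightarrow> real \<Rightarrow> nat" where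
  "pop 0 l z t = 0"
| "pop (Suc n) l z t = (if 0 \<le> t \<and> t < l [] then 1 else 0) +
     (\<Sum>k<z []. pop n (\<lambda>u. l (k # u)) (\<lambda>u. z (k # u)) (t - l []))"

lemma pop_measurable:
  assumes "\<And>u. l u \<in> borel_measurable Q" "\<And>u. z u \<in> measurable Q (count_space UNIV)"
    "\<tau> \<in> borel_measurable Q"
  shows "(\<lambda>q. pop n (\<lambda>u. l u q) (\<lambda>u. z u q) (\<tau> q)) \<in> measurable Q (count_space UNIV)"
  using assms
proof (induction n arbitrary: l z \<tau>)
  case (Suc n)
  note [measurable] = Suc.prems
  have [measurable]: "(\<lambda>q. pop n (\<lambda>u. l (k # u) q) (\<lambda>u. z (k # u) q) (\<tau> q - l [] q)) \<in> measurable Q (count_space UNIV)" for k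
    by (rule Suc.IH) measurable
  have "(\<lambda>q. \<Sum>k<z [] q. pop n (\<lambda>u. l (k # u) q) (\<lambda>u. z (k # u) q) (\<tau> q - l [] q)) \<in> measurable Q (count_space UNIV)"
    by (rule measurable_compose_countable[where f="\<lambda>j q. \<Sum>k<j. pop n (\<lambda>u. l (k # u) q) (\<lambda>u. z (k # u) q) (\<tau> q - l [] q)"]) measurable
  then show ?case
    by simp
qed simp

lemma pop_neg:
  assumes "\<And>u. 0 \<le> l u" "t < 0"
  shows "pop n l z t = 0"
  using assms
proof (induction n arbitrary: l z t)
  case (Suc n)
  have "t - l [] < 0" using Suc.prems(1)[of "[]"] Suc.prems(2) by linarith
  with Suc show ?case by simp
qed simp

lemma birth_time_Cons:
  "birth_time L (k # u) \<omega> = L [] \<omega> + birth_time (\<lambda>u. L (k # u)) u \<omega>"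
  by (simp add: birth_time_def sum.lessThan_Suc_shift del: sum.lessThan_Suc)

lemma birth_time_Nil [simp]: "birth_time L [] \<omega> = 0"
  by (simp add: birth_time_def)

lemma Cons_alive:
  "k # u \<in> alive L Z t \<omega> \<longleftrightarrow>
     k < Z [] \<omega> \<and> u \<in> alive (\<lambda>u. L (k # u)) (\<lambda>u. Z (k # u)) (t - L [] \<omega>) \<omega>"
proof -
  have "(\<forall>i<length (k # u). (k # u) ! i < Z (take i (k # u)) \<omega>) \<longleftrightarrow>
      k < Z [] \<omega> \<and> (\<forall>i<length u. u ! i < Z (k # take i u) \<omega>)"
    by (auto simp: less_Suc_eq_0_disj)
  then show ?thesis
    unfolding alive_def by (auto simp: birth_time_Cons)
qed

text \<open>
  A label \<open>k # u\<close> is alive at time \<open>t\<close> exactly if the root has more than \<open>k\<close> children and \<open>u\<close> is alive,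
  in the subtree of child \<open>k\<close>, at time \<open>t\<close> minus the life-time of the root.
\<close>

lemma pop_eq_card:
  "finite {u \<in> alive L Z t \<omega>. length u < n} \<and>
   pop n (\<lambda>u. L u \<omega>) (\<lambda>u. Z u \<omega>) t = card {u \<in> alive L Z t \<omega>. length u < n}"
proof (induction n arbitrary: L Z t)
  case (Suc n)
  define S where "S k = {u \<in> alive (\<lambda>u. L (k # u)) (\<lambda>u. Z (k # u)) (t - L [] \<omega>) \<omega>. length u < n}" for k
  define R :: "label set" where "R = (if 0 \<le> t \<and> t < L [] \<omega> then {[]} else {})"
  have eq: "{u \<in> alive L Z t \<omega>. length u < Suc n} = R \<union> (\<Union>k<Z [] \<omega>. Cons k ` S k)"
  proof (rule set_eqI)
    fix u show "u \<in> {u \<in> alive L Z t \<omega>. length u < Suc n} \<longleftrightarrow> u \<in> R \<union> (\<Union>k<Z [] \<omega>. Cons k ` S k)"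
    proof (cases u)
      case Nil
      then show ?thesis by (auto simp: alive_def R_def)
    next
      case (Cons k v)
      then show ?thesis by (auto simp: Cons_alive R_def S_def)
    qed
  qed
  have S: "finite (S k)" "pop n (\<lambda>u. L (k # u) \<omega>) (\<lambda>u. Z (k # u) \<omega>) (t - L [] \<omega>) = card (S k)" for k
    using Suc.IH[of "\<lambda>u. L (k # u)" "\<lambda>u. Z (k # u)" "t - L [] \<omega>"] by (auto simp: S_def)
  have "card (R \<union> (\<Union>k<Z [] \<omega>. Cons k ` S k)) = card R + card (\<Union>k<Z [] \<omega>. Cons k ` S k)"
    using S by (intro card_Un_disjoint) (auto simp: R_def)
  also have "card (\<Union>k<Z [] \<omega>. Cons k ` S k) = (\<Sum>k<Z [] \<omega>. card (Cons k ` S k))"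
    using S by (intro card_UN_disjoint) auto
  also have "\<dots> = (\<Sum>k<Z [] \<omega>. card (S k))"
    by (intro sum.cong refl card_image) (auto simp: inj_on_def)
  finally show ?case
    unfolding eq using S by (auto simp: R_def)
qed simp

text \<open>
  The bound on the mean offspring excludes explosion; the critical offspring law attains it.
\<close>

locale branching_tree = prob_space M for M :: "'a measure" +
  fixes K :: real and h :: "complex \<Rightarrow> complex"
    and L :: "label \<Rightarrow> 'a \<Rightarrow> real" and Z :: "label \<Rightarrow> 'a \<Rightarrow> nat"
  assumes K: "K > 0"
    and indep: "indep_vars (\<lambda>_. borel) (case_sum L (\<lambda>u \<omega>. real (Z u \<omega>))) (UNIV :: (label + label) set)"
    and life: "\<And>u. distributed M lborel (L u) (exponential_density K)"
    and offspring: "\<And>u. has_pgf M (Z u) h"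
    and mean_offspring: "\<And>u. (\<integral>\<^sup>+\<omega>. of_nat (Z u \<omega>) \<partial>M) \<le> 1"
begin

lemma L_measurable [measurable]: "L u \<in> borel_measurable M"
  using distributed_measurable[OF life] by simp

lemma Z_measurable [measurable]: "Z u \<in> measurable M (count_space UNIV)"
  using offspring by (simp add: has_pgf_def)

lemma pgf_offspring: "cmod s \<le> 1 \<Longrightarrow> pgf M (Z u) s = h s"
  using offspring by (simp add: has_pgf_def)

lemma norm_h_le_1: "cmod s \<le> 1 \<Longrightarrow> cmod (h s) \<le> 1"
  using norm_pgf_le_1[of "Z []" s] by (simp add: pgf_offspring)

lemma continuous_on_h: "continuous_on (cball 0 1) h"
  by (rule continuous_on_eq[OF continuous_on_pgf[of "Z []"]]) (auto simp: pgf_offspring)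

lemma AE_life_pos: "AE \<omega> in M. \<forall>u. 0 < L u \<omega>"
  unfolding AE_all_countable
proof
  fix u
  have "prob {\<omega> \<in> space M. 0 < L u \<omega>} = 1"
    using exponential_distributedD_gt[OF life, of 0 u] K by simp
  from AE_prob_1[OF this] show "AE \<omega> in M. 0 < L u \<omega>"
    by simp
qed

lemma subtree: "branching_tree M K h (\<lambda>u. L (k # u)) (\<lambda>u. Z (k # u))"
proof unfold_locales
  have "indep_vars (\<lambda>_. borel) (\<lambda>x. case_sum L (\<lambda>u \<omega>. real (Z u \<omega>)) (map_sum (Cons k) (Cons k) x))
     (UNIV :: (label + label) set)"
    by (rule indep_vars_reindex[OF indep]) (auto intro!: sum.inj_map)
  also have "(\<lambda>x. case_sum L (\<lambda>u \<omega>. real (Z u \<omega>)) (map_sum (Cons k) (Cons k) x)) =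
      case_sum (\<lambda>u. L (k # u)) (\<lambda>u \<omega>. real (Z (k # u) \<omega>))"
    by (auto simp: fun_eq_iff split: sum.split)
  finally show "indep_vars (\<lambda>_. borel) (case_sum (\<lambda>u. L (k # u)) (\<lambda>u \<omega>. real (Z (k # u) \<omega>)))
     (UNIV :: (label + label) set)" .
qed (use K life offspring mean_offspring in auto)

end

text \<open>
  The renewal recursion for the generating functions of the first \<open>n\<close> generations.  Its definition does
  not mention a tree, which is why it is common to a tree and its subtrees.
\<close>

primrec approx_pgf :: "real \<Rightarrow> (complex \<Rightarrow> complex) \<Rightarrow> complex \<Rightarrow> nat \<Rightarrow> real \<Rightarrow> complex" where
  "approx_pgf K h s 0 t = 1"
| "approx_pgf K h s (Suc n) t =
     (LINT l|lborel. exponential_density K l *\<^sub>R (if t < l then s else h (approx_pgf K h s n (t - l))))"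

text \<open>
  The subtrees of the children are independent of each other and of the number of children.
\<close>

lemma (in branching_tree) pgf_children:
  assumes pgf: "\<And>k. pgf M (\<lambda>\<omega>. pop n (\<lambda>u. L (k # u) \<omega>) (\<lambda>u. Z (k # u) \<omega>) t) s = p"
    and s: "cmod s \<le> 1"
  shows "pgf M (\<lambda>\<omega>. \<Sum>k<Z [] \<omega>. pop n (\<lambda>u. L (k # u) \<omega>) (\<lambda>u. Z (k # u) \<omega>) t) s = h p"
proof -
  define W where "W = case_sum L (\<lambda>u \<omega>. real (Z u \<omega>))"
  \<comment> \<open>block \<open>0\<close> holds the number of children, block \<open>Suc k\<close> the whole subtree of child \<open>k\<close>\<close>
  define G :: "nat \<Rightarrow> (label + label) set" where
    "G = case_nat {Inr []} (\<lambda>k. range (map_sum (Cons k) (Cons k)))"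
  define Y :: "nat \<Rightarrow> (label + label \<Rightarrow> real) \<Rightarrow> nat" where
    "Y = case_nat (\<lambda>w. nat \<lfloor>w (Inr [])\<rfloor>) (\<lambda>k w. pop n (\<lambda>u. w (Inl (k # u))) (\<lambda>u. nat \<lfloor>w (Inr (k # u))\<rfloor>) t)"
  define V where "V = case_nat (Z []) (\<lambda>k \<omega>. pop n (\<lambda>u. L (k # u) \<omega>) (\<lambda>u. Z (k # u) \<omega>) t)"
  have inG: "Inr [] \<in> G 0" "Inl (k # u) \<in> G (Suc k)" "Inr (k # u) \<in> G (Suc k)" for k u
    unfolding G_def by (auto simp: image_iff intro: exI[of _ "Inl u"] exI[of _ "Inr u"])
  have dis: "disjoint_family_on G UNIV"
    unfolding disjoint_family_on_def
  proof (intro ballI impI)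
    fix i j :: nat assume ij: "i \<noteq> j"
    have *: "map_sum (Cons k) (Cons k) x \<noteq> Inr []" for k and x :: "label + label"
      by (cases x) auto
    have **: "map_sum (Cons k) (Cons k) x \<noteq> map_sum (Cons k') (Cons k') y" if "k \<noteq> k'" for k k' and x y :: "label + label"
      using that by (cases x; cases y) auto
    show "G i \<inter> G j = {}"
      using ij * ** unfolding G_def by (auto split: nat.splits) metis+
  qed
  have "indep_vars (\<lambda>j. PiM (G j) (\<lambda>_. borel)) (\<lambda>j \<omega>. restrict (\<lambda>i. W i \<omega>) (G j)) UNIV"
    by (rule indep_vars_restrict[OF indep[folded W_def]]) (auto intro: dis)
  then have "indep_vars (\<lambda>_. count_space UNIV) (\<lambda>j \<omega>. Y j (restrict (\<lambda>i. W i \<omega>) (G j))) UNIV"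
  proof (rule indep_vars_compose2)
    fix j show "Y j \<in> measurable (PiM (G j) (\<lambda>_. borel)) (count_space UNIV)"
    proof (cases j)
      case 0
      have [measurable]: "(\<lambda>w. w (Inr [])) \<in> borel_measurable (PiM (G 0) (\<lambda>_. borel :: real measure))"
        using inG(1) by (rule measurable_component_singleton)
      show ?thesis unfolding 0 Y_def by simp
    next
      case (Suc k)
      have [measurable]: "(\<lambda>w. w (Inl (k # u))) \<in> borel_measurable (PiM (G (Suc k)) (\<lambda>_. borel :: real measure))" for u
        using inG(2) by (rule measurable_component_singleton)
      have [measurable]: "(\<lambda>w. w (Inr (k # u))) \<in> borel_measurable (PiM (G (Suc k)) (\<lambda>_. borel :: real measure))" for u
        using inG(3) by (rule measurable_component_singleton)
      show ?thesis unfolding Suc Y_def by (simp, rule pop_measurable) auto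
    qed
  qed
  also have "(\<lambda>j \<omega>. Y j (restrict (\<lambda>i. W i \<omega>) (G j))) = V"
    using inG by (auto simp: fun_eq_iff Y_def V_def W_def split: nat.split)
  finally have "pgf M (\<lambda>\<omega>. \<Sum>k<Z [] \<omega>. pop n (\<lambda>u. L (k # u) \<omega>) (\<lambda>u. Z (k # u) \<omega>) t) s = pgf M (Z []) p"
    unfolding V_def by (rule pgf_random_sum) (auto intro: pgf s)
  also have "cmod p \<le> 1"
    unfolding pgf[of 0, symmetric] by (intro norm_pgf_le_1 s pop_measurable) auto
  then have "pgf M (Z []) p = h p" by (rule pgf_offspring)
  finally show ?thesis .
qed

text \<open>
  Conditioning on the life-time \<open>l\<close> of the root.  If \<open>t < l\<close>, the children contribute nothing since
  their subtrees are observed at a negative time.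
\<close>

lemma (in branching_tree) first_branching:
  assumes s: "cmod s \<le> 1" and t: "0 \<le> t"
    and \<phi>: "\<And>k v. 0 \<le> v \<Longrightarrow> pgf M (\<lambda>\<omega>. pop n (\<lambda>u. L (k # u) \<omega>) (\<lambda>u. Z (k # u) \<omega>) v) s = \<phi> v"
  defines "G \<equiv> \<lambda>l. exponential_density K l *\<^sub>R (if t < l then s else h (\<phi> (t - l)))"
  shows "pgf M (\<lambda>\<omega>. pop (Suc n) (\<lambda>u. L u \<omega>) (\<lambda>u. Z u \<omega>) t) s = (LINT l|lborel. G l)"
    and "G \<in> borel_measurable lborel"
proof -
  define W where "W = case_sum L (\<lambda>u \<omega>. real (Z u \<omega>))"
  define B :: "(label + label) set" where "B = - {Inl []}"
  define f :: "real \<times> (label + label \<Rightarrow> real) \<Rightarrow> complex" where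
    "f = (\<lambda>(l, w). s ^ ((if 0 \<le> t \<and> t < l then 1 else 0) +
       (\<Sum>k<nat \<lfloor>w (Inr [])\<rfloor>. pop n (\<lambda>u. w (Inl (k # u))) (\<lambda>u. nat \<lfloor>w (Inr (k # u))\<rfloor>) (t - l))))"
  define Y where "Y \<omega> = restrict (\<lambda>i. W i \<omega>) B" for \<omega>
  have fY: "f (l, Y \<omega>) = s ^ ((if 0 \<le> t \<and> t < l then 1 else 0) +
       (\<Sum>k<Z [] \<omega>. pop n (\<lambda>u. L (k # u) \<omega>) (\<lambda>u. Z (k # u) \<omega>) (t - l)))" for l \<omega>
    by (simp add: f_def Y_def B_def W_def)
  have bound: "norm (f p) \<le> 1" for p
    by (cases p) (simp only: f_def split norm_nat_power_le_1[OF s])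
  have ind: "indep_var (PiM {Inl []} (\<lambda>_. borel)) (\<lambda>\<omega>. restrict (\<lambda>i. W i \<omega>) {Inl []}) (PiM B (\<lambda>_. borel)) Y"
    unfolding Y_def by (rule indep_var_restrict[OF indep[folded W_def]]) (auto simp: B_def)
  have fm: "f \<in> borel_measurable (borel \<Otimes>\<^sub>M PiM B (\<lambda>_. borel))"
  proof -
    let ?Q = "borel \<Otimes>\<^sub>M PiM B (\<lambda>_. borel) :: (real \<times> (label + label \<Rightarrow> real)) measure"
    have w[measurable]: "(\<lambda>q. snd q x) \<in> borel_measurable ?Q" if "x \<in> B" for x
      by (rule measurable_compose[OF measurable_snd measurable_component_singleton[OF that]])
    have [measurable]: "(\<lambda>q. snd q (Inr [])) \<in> borel_measurable ?Q"
      by (rule w) (simp add: B_def)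
    have pm: "(\<lambda>q. pop n (\<lambda>u. snd q (Inl (k # u))) (\<lambda>u. nat \<lfloor>snd q (Inr (k # u))\<rfloor>) (t - fst q)) \<in> measurable ?Q (count_space UNIV)" for k
    proof (rule pop_measurable)
      show "(\<lambda>q. snd q (Inl (k # u))) \<in> borel_measurable ?Q" for u by (rule w) (simp add: B_def)
      have [measurable]: "(\<lambda>q. snd q (Inr (k # u))) \<in> borel_measurable ?Q" for u by (rule w) (simp add: B_def)
      show "(\<lambda>q. nat \<lfloor>snd q (Inr (k # u))\<rfloor>) \<in> measurable ?Q (count_space UNIV)" for u by measurable
    qed measurable
    have "(\<lambda>q. \<Sum>k<nat \<lfloor>snd q (Inr [])\<rfloor>. pop n (\<lambda>u. snd q (Inl (k # u))) (\<lambda>u. nat \<lfloor>snd q (Inr (k # u))\<rfloor>) (t - fst q))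
        \<in> measurable ?Q (count_space UNIV)"
      by (rule measurable_compose_countable[where f="\<lambda>j q. \<Sum>k<j. pop n (\<lambda>u. snd q (Inl (k # u))) (\<lambda>u. nat \<lfloor>snd q (Inr (k # u))\<rfloor>) (t - fst q)"])
        (use pm in measurable)
    then have "(\<lambda>q. (if 0 \<le> t \<and> t < fst q then 1 else 0) + (\<Sum>k<nat \<lfloor>snd q (Inr [])\<rfloor>. pop n (\<lambda>u. snd q (Inl (k # u))) (\<lambda>u. nat \<lfloor>snd q (Inr (k # u))\<rfloor>) (t - fst q)))
        \<in> measurable ?Q (count_space UNIV)"
      by measurable
    from measurable_nat_power[OF this, of s] show ?thesis
      unfolding f_def case_prod_unfold .
  qed
  have eq: "exponential_density K l *\<^sub>R expectation (\<lambda>\<omega>. f (l, Y \<omega>)) = G l" for l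
  proof (cases "l < 0")
    case True
    then show ?thesis by (simp add: G_def exponential_density_def)
  next
    case False
    show ?thesis
    proof (cases "t < l")
      case True
      have "expectation (\<lambda>\<omega>. f (l, Y \<omega>)) = expectation (\<lambda>_. s)"
      proof (rule integral_cong_AE)
        have "(\<lambda>\<omega>. f (l, Y \<omega>)) \<in> borel_measurable M"
          using fm indep_var_rv2[OF ind] by measurable
        then show "(\<lambda>\<omega>. f (l, Y \<omega>)) \<in> borel_measurable M" .
        show "AE \<omega> in M. f (l, Y \<omega>) = s"
          using AE_life_pos
        proof eventually_elim
          case (elim \<omega>)
          have "pop n (\<lambda>u. L (k # u) \<omega>) (\<lambda>u. Z (k # u) \<omega>) (t - l) = 0" for k
            using elim True by (intro pop_neg) (auto intro: less_imp_le)
          then show ?case using t True by (simp add: fY)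
        qed
      qed simp
      then show ?thesis using True by (simp add: G_def prob_space)
    next
      case False
      have "expectation (\<lambda>\<omega>. f (l, Y \<omega>)) =
          pgf M (\<lambda>\<omega>. \<Sum>k<Z [] \<omega>. pop n (\<lambda>u. L (k # u) \<omega>) (\<lambda>u. Z (k # u) \<omega>) (t - l)) s"
        using False by (simp add: pgf_def fY)
      also have "\<dots> = h (\<phi> (t - l))"
        using False by (intro pgf_children \<phi> s) auto
      finally show ?thesis using False by (simp add: G_def)
    qed
  qed
  have jm: "(\<lambda>w. w (Inl [])) \<in> measurable (PiM {Inl []} (\<lambda>_. borel)) borel"
    by measurable
  note pair = expectation_indep_pair[OF ind jm fm bound]
  have [measurable]: "(\<lambda>x. expectation (\<lambda>\<omega>. f (x, Y \<omega>))) \<in> borel_measurable lborel"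
    using pair(2) by simp
  have "pgf M (\<lambda>\<omega>. pop (Suc n) (\<lambda>u. L u \<omega>) (\<lambda>u. Z u \<omega>) t) s = expectation (\<lambda>\<omega>. f (L [] \<omega>, Y \<omega>))"
    by (simp add: pgf_def fY)
  also have "\<dots> = (\<integral>l. expectation (\<lambda>\<omega>. f (l, Y \<omega>)) \<partial>distr M borel (L []))"
    using pair(1) by (simp add: W_def)
  also have "distr M borel (L []) = distr M lborel (L [])"
    by (rule distr_cong) auto
  also have "\<dots> = density lborel (exponential_density K)"
    by (rule distributed_distr_eq_density[OF life])
  also have "(\<integral>l. expectation (\<lambda>\<omega>. f (l, Y \<omega>)) \<partial>density lborel (exponential_density K)) =
      (LINT l|lborel. exponential_density K l *\<^sub>R expectation (\<lambda>\<omega>. f (l, Y \<omega>)))"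
    using K by (subst integral_density) (auto simp: exponential_density_nonneg)
  also have "\<dots> = (LINT l|lborel. G l)"
    unfolding eq ..
  finally show "pgf M (\<lambda>\<omega>. pop (Suc n) (\<lambda>u. L u \<omega>) (\<lambda>u. Z u \<omega>) t) s = (LINT l|lborel. G l)" .
  have "(\<lambda>l. exponential_density K l *\<^sub>R expectation (\<lambda>\<omega>. f (l, Y \<omega>))) \<in> borel_measurable lborel"
    by measurable
  then show "G \<in> borel_measurable lborel"
    unfolding eq by (simp add: eta_contract_eq)
qed

text \<open>
  The induction ranges over all trees on \<open>M\<close>, so that its hypothesis applies to the subtrees.
\<close>

lemma pgf_pop:
  assumes s: "cmod s \<le> 1" and "branching_tree M K h L Z" and "0 \<le> t"
  shows "pgf M (\<lambda>\<omega>. pop n (\<lambda>u. L u \<omega>) (\<lambda>u. Z u \<omega>) t) s = approx_pgf K h s n t"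
  using assms(2,3)
proof (induction n arbitrary: L Z t)
  case 0
  then interpret branching_tree M K h L Z by simp
  show ?case by (simp add: pgf_def prob_space)
next
  case (Suc n)
  interpret branching_tree M K h L Z by fact
  show ?case
    unfolding approx_pgf.simps
    by (rule first_branching(1)[OF s Suc.prems(2)]) (rule Suc.IH[OF subtree])
qed

section \<open>Non-explosion\<close>

definition realised :: "(label \<Rightarrow> 'a \<Rightarrow> nat) \<Rightarrow> label \<Rightarrow> 'a \<Rightarrow> bool" where
  "realised Z u \<omega> \<longleftrightarrow> (\<forall>k<length u. u ! k < Z (take k u) \<omega>)"

text \<open>
  The time horizon is quantified inside, since a family is later observed at random times.
\<close>

definition non_explosive :: "(label \<Rightarrow> 'a \<Rightarrow> real) \<Rightarrow> (label \<Rightarrow> 'a \<Rightarrow> nat) \<Rightarrow> 'a \<Rightarrow> bool" where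
  "non_explosive L Z \<omega> \<longleftrightarrow> (\<forall>t. finite {u. realised Z u \<omega> \<and> birth_time L u \<omega> \<le> t})"

lemma alive_iff:
  "u \<in> alive L Z t \<omega> \<longleftrightarrow> realised Z u \<omega> \<and> birth_time L u \<omega> \<le> t \<and> t < birth_time L u \<omega> + L u \<omega>"
  by (simp add: alive_def realised_def)

lemma finite_alive: "non_explosive L Z \<omega> \<Longrightarrow> finite (alive L Z t \<omega>)"
  unfolding non_explosive_def
  by (erule allE[of _ t], erule rev_finite_subset) (auto simp: alive_iff)

lemma pop_eventually_eq:
  assumes "non_explosive L Z \<omega>"
  shows "\<forall>\<^sub>F n in sequentially. pop n (\<lambda>u. L u \<omega>) (\<lambda>u. Z u \<omega>) t = card (alive L Z t \<omega>)"
proof -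
  obtain m where m: "\<forall>u\<in>alive L Z t \<omega>. length u < m"
    using finite_imp_nat_seg_image_inj_on[OF finite_alive[OF assms]]
    by (metis finite_alive[OF assms] finite_imageI finite_nat_set_iff_bounded imageI)
  show ?thesis
    using eventually_ge_at_top[of m]
  proof eventually_elim
    case (elim n)
    with m have "{u \<in> alive L Z t \<omega>. length u < n} = alive L Z t \<omega>" by force
    then show ?case using pop_eq_card[of L Z t \<omega> n] by simp
  qed
qed

text \<open>
  Up to time \<open>t + 1\<close> only finitely many particles matter, and for each of them being alive is a
  condition \<open>b \<le> t \<and> t < d\<close>, which is right-continuous in \<open>t\<close>.
\<close>

lemma alive_right_continuous:
  assumes "non_explosive L Z \<omega>"
  shows "\<forall>\<^sub>F t' in at_right t. alive L Z t' \<omega> = alive L Z t \<omega>"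
proof -
  define S where "S = {u. realised Z u \<omega> \<and> birth_time L u \<omega> \<le> t + 1}"
  have fin: "finite S" using assms by (simp add: S_def non_explosive_def)
  have *: "\<forall>\<^sub>F t' in at_right t. b \<le> t' \<longleftrightarrow> b \<le> t" for b :: real
  proof (cases "b \<le> t")
    case True
    then show ?thesis
      using eventually_at_right_less[of t] by (auto elim: eventually_mono)
  next
    case False
    then have "\<forall>\<^sub>F t' in at_right t. t' < b"
      by (intro eventually_at_right_field[THEN iffD2] exI[of _ b]) auto
    then show ?thesis using False by (auto elim: eventually_mono)
  qed
  have "\<forall>\<^sub>F t' in at_right t. \<forall>u\<in>S. u \<in> alive L Z t' \<omega> \<longleftrightarrow> u \<in> alive L Z t \<omega>"
  proof (rule eventually_ball_finite[OF fin], rule ballI)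
    fix u
    show "\<forall>\<^sub>F t' in at_right t. u \<in> alive L Z t' \<omega> \<longleftrightarrow> u \<in> alive L Z t \<omega>"
      using *[of "birth_time L u \<omega>"] *[of "birth_time L u \<omega> + L u \<omega>"]
      by eventually_elim (auto simp: alive_iff)
  qed
  moreover have "\<forall>\<^sub>F t' in at_right t. t < t' \<and> t' < t + 1"
    by (intro eventually_at_right_field[THEN iffD2] exI[of _ "t + 1"]) auto
  ultimately show ?thesis
  proof eventually_elim
    case (elim t')
    have "alive L Z t' \<omega> \<subseteq> S" "alive L Z t \<omega> \<subseteq> S"
      using elim by (auto simp: alive_iff S_def)
    with elim show ?case by blast
  qed
qed

text \<open>
  Elements are encoded as natural numbers by \<open>to_nat\<close>.  As an infinite set has cardinality \<open>0\<close>, the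
  event of explosion is no obstacle to measurability.
\<close>

lemma card_measurable:
  fixes S :: "'a \<Rightarrow> 'b::countable set"
  assumes "\<And>u. {x\<in>space M. u \<in> S x} \<in> sets M"
  shows "(\<lambda>x. card (S x)) \<in> measurable M (count_space UNIV)"
proof -
  have "(\<lambda>x. card (to_nat ` S x)) \<in> measurable M (count_space UNIV)"
  proof (rule measurable_card)
    fix i
    show "{x\<in>space M. i \<in> to_nat ` S x} \<in> sets M"
    proof (cases "i \<in> range (to_nat :: 'b \<Rightarrow> nat)")
      case True
      then obtain u :: 'b where u: "i = to_nat u" by auto
      then show ?thesis using assms[of u] by (simp add: inj_image_mem_iff)
    next
      case False
      then have "{x\<in>space M. i \<in> to_nat ` S x} = {}" by auto
      then show ?thesis by (simp only: sets.empty_sets)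
    qed
  qed
  moreover have "card (to_nat ` S x) = card (S x)" for x
    by (rule card_image) simp
  ultimately show ?thesis by simp
qed

context branching_tree
begin

lemma birth_time_measurable [measurable]: "birth_time L u \<in> borel_measurable M"
  unfolding birth_time_def[abs_def] by measurable

lemma realised_measurable [measurable]: "Measurable.pred M (realised Z u)"
  unfolding realised_def[abs_def] by measurable

lemma population_measurable:
  assumes [measurable]: "\<tau> \<in> borel_measurable M"
  shows "(\<lambda>\<omega>. card (alive L Z (\<tau> \<omega>) \<omega>)) \<in> measurable M (count_space UNIV)"
  by (rule card_measurable) (simp add: alive_iff)

lemma laplace_life: "(\<integral>\<^sup>+\<omega>. ennreal (exp (- (K * L u \<omega>))) \<partial>M) = ennreal (1 / 2)"
proof -
  interpret E2: prob_space "density lborel (exponential_density (2 * K))"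
    using K by (intro prob_space_exponential_density) simp
  have one: "(\<integral>\<^sup>+x. ennreal (exponential_density (2 * K) x) \<partial>lborel) = 1"
    using E2.emeasure_space_1 by (simp add: emeasure_density)
  have "(\<integral>\<^sup>+\<omega>. ennreal (exp (- (K * L u \<omega>))) \<partial>M) =
      (\<integral>\<^sup>+x. ennreal (exponential_density K x) * ennreal (exp (- (K * x))) \<partial>lborel)"
    by (rule distributed_nn_integral[OF life, symmetric]) measurable
  also have "\<dots> = (\<integral>\<^sup>+x. ennreal (1 / 2) * ennreal (exponential_density (2 * K) x) \<partial>lborel)"
  proof (intro nn_integral_cong)
    fix x
    have "exponential_density K x * exp (- (K * x)) = 1 / 2 * exponential_density (2 * K) x"
      by (auto simp: exponential_density_def exp_add[symmetric] mult_exp_exp field_simps)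
    then show "ennreal (exponential_density K x) * ennreal (exp (- (K * x))) =
        ennreal (1 / 2) * ennreal (exponential_density (2 * K) x)"
      using K by (simp add: ennreal_mult''[symmetric] exponential_density_nonneg del: ennreal_half)
  qed
  also have "\<dots> = ennreal (1 / 2)"
    by (subst nn_integral_cmult) (auto simp: one)
  finally show ?thesis .
qed

definition tail :: "label \<Rightarrow> nat \<Rightarrow> ennreal" where
  "tail u j = emeasure M {\<omega> \<in> space M. j < Z u \<omega>}"

lemma suminf_tail: "(\<integral>\<^sup>+j. tail u j \<partial>count_space UNIV) \<le> 1"
proof -
  have "(\<integral>\<^sup>+j. tail u j \<partial>count_space UNIV) = (\<Sum>j. \<integral>\<^sup>+\<omega>. indicator {\<omega> \<in> space M. j < Z u \<omega>} \<omega> \<partial>M)"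
    by (simp add: nn_integral_count_space_nat tail_def)
  also have "\<dots> = (\<integral>\<^sup>+\<omega>. (\<Sum>j. indicator {\<omega> \<in> space M. j < Z u \<omega>} \<omega>) \<partial>M)"
    by (rule nn_integral_suminf[symmetric]) measurable
  also have "\<dots> = (\<integral>\<^sup>+\<omega>. of_nat (Z u \<omega>) \<partial>M)"
  proof (intro nn_integral_cong)
    fix \<omega> assume "\<omega> \<in> space M"
    then show "(\<Sum>j. indicator {\<omega> \<in> space M. j < Z u \<omega>} \<omega> :: ennreal) = of_nat (Z u \<omega>)"
      by (subst suminf_finite[of "{..<Z u \<omega>}"]) auto
  qed
  finally show ?thesis using mean_offspring by simp
qed

text \<open>
  The discount at rate \<open>K\<close> makes the expected total over all realised labels finite, while every birth
  before \<open>t\<close> contributes at least \<open>exp (- K t)\<close>.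
\<close>

definition discounted :: "label \<Rightarrow> 'a \<Rightarrow> ennreal" where
  "discounted u \<omega> = (if realised Z u \<omega> then ennreal (exp (- (K * birth_time L u \<omega>))) else 0)"

lemma discounted_measurable [measurable]: "discounted u \<in> borel_measurable M"
  unfolding discounted_def[abs_def] by measurable

text \<open>
  The expectation of \<open>discounted u\<close>: along the line of ancestors of \<open>u\<close> every life-time contributes the
  factor \<open>1/2\<close> and every offspring number a tail probability.
\<close>

definition weight :: "label \<Rightarrow> ennreal" where
  "weight u = (\<Prod>k<length u. ennreal (1 / 2) * tail (take k u) (u ! k))"

lemma nn_integral_discounted: "(\<integral>\<^sup>+\<omega>. discounted u \<omega> \<partial>M) = weight u"
proof -
  define W where "W = case_sum L (\<lambda>u \<omega>. real (Z u \<omega>))"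
  define T where "T = (\<lambda>k. take k u) ` {..<length u}"
  \<comment> \<open>one factor per life-time and per offspring number on the line of ancestors; all are independent\<close>
  define Y :: "label + label \<Rightarrow> real \<Rightarrow> ennreal" where
    "Y = case_sum (\<lambda>v x. ennreal (exp (- (K * x)))) (\<lambda>v x. if real (u ! length v) < x then 1 else 0)"
  have inj: "inj_on (\<lambda>k. take k u) {..<length u}"
    by (rule inj_onI) (metis length_take lessThan_iff min.absorb4)
  have fin: "finite T" by (simp add: T_def)
  have Ym: "Y x \<in> borel_measurable borel" for x
    unfolding Y_def by (cases x) auto
  have "discounted u \<omega> = (\<Prod>x\<in>T <+> T. Y x (W x \<omega>))" for \<omega>
  proof -
    have "(\<Prod>x\<in>T <+> T. Y x (W x \<omega>)) =
        (\<Prod>k<length u. ennreal (exp (- (K * L (take k u) \<omega>)))) *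
        (\<Prod>k<length u. if u ! k < Z (take k u) \<omega> then 1 else 0)"
      using fin inj by (auto simp: prod.Plus comp_def T_def prod.reindex Y_def W_def intro!: arg_cong2[where f="(*)"] prod.cong)
    also have "(\<Prod>k<length u. ennreal (exp (- (K * L (take k u) \<omega>)))) = ennreal (exp (- (K * birth_time L u \<omega>)))"
      by (simp add: prod_ennreal birth_time_def exp_sum[symmetric] sum_negf sum_distrib_left)
    also have "(\<Prod>k<length u. if u ! k < Z (take k u) \<omega> then 1 else 0 :: ennreal) = (if realised Z u \<omega> then 1 else 0)"
      unfolding realised_def by (auto intro!: prod.neutral prod_zero)
    finally show ?thesis by (simp add: discounted_def)
  qed
  then have "(\<integral>\<^sup>+\<omega>. discounted u \<omega> \<partial>M) = (\<integral>\<^sup>+\<omega>. (\<Prod>x\<in>T <+> T. Y x (W x \<omega>)) \<partial>M)"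
    by simp
  also have "\<dots> = (\<Prod>x\<in>T <+> T. \<integral>\<^sup>+\<omega>. Y x (W x \<omega>) \<partial>M)"
  proof (rule indep_vars_nn_integral)
    show "indep_vars (\<lambda>_. borel) (\<lambda>x \<omega>. Y x (W x \<omega>)) (T <+> T)"
      by (rule indep_vars_compose2[OF indep_vars_subset[OF indep[folded W_def]]]) (auto simp: Ym)
  qed (use fin in auto)
  also have "\<dots> = (\<Prod>k<length u. (\<integral>\<^sup>+\<omega>. Y (Inl (take k u)) (L (take k u) \<omega>) \<partial>M) * (\<integral>\<^sup>+\<omega>. Y (Inr (take k u)) (real (Z (take k u) \<omega>)) \<partial>M))"
    using fin inj by (simp add: prod.Plus comp_def T_def prod.reindex W_def prod.distrib)
  also have "\<dots> = weight u"
    unfolding weight_def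
  proof (intro prod.cong refl arg_cong2[where f="(*)"])
    fix k assume k: "k \<in> {..<length u}"
    show "(\<integral>\<^sup>+\<omega>. Y (Inl (take k u)) (L (take k u) \<omega>) \<partial>M) = ennreal (1 / 2)"
      unfolding Y_def using laplace_life by simp
    have "(\<integral>\<^sup>+\<omega>. Y (Inr (take k u)) (real (Z (take k u) \<omega>)) \<partial>M) =
        (\<integral>\<^sup>+\<omega>. indicator {\<omega> \<in> space M. u ! k < Z (take k u) \<omega>} \<omega> \<partial>M)"
      using k by (intro nn_integral_cong) (auto simp: Y_def indicator_def)
    then show "(\<integral>\<^sup>+\<omega>. Y (Inr (take k u)) (real (Z (take k u) \<omega>)) \<partial>M) = tail (take k u) (u ! k)"
      by (simp add: tail_def)
  qed
  finally show ?thesis .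
qed

lemma weight_snoc: "weight (u @ [j]) = weight u * (ennreal (1 / 2) * tail u j)"
  by (simp add: weight_def nth_append mult.assoc)

text \<open>
  Summing over the last entry of the labels replaces a tail probability by the mean offspring, which is
  at most \<open>1\<close>; what remains is a factor \<open>1/2\<close> per generation.
\<close>

lemma weight_generation:
  "(\<integral>\<^sup>+u. weight u * indicator {u. length u = n} u \<partial>count_space UNIV) \<le> ennreal ((1 / 2) ^ n)"
proof (induction n)
  case 0
  have "(\<integral>\<^sup>+u. weight u * indicator {u. length u = 0} u \<partial>count_space UNIV) =
      (\<integral>\<^sup>+u. weight [] * indicator {[]} (u :: label) \<partial>count_space UNIV)"
    by (intro nn_integral_cong) (auto simp: indicator_def)
  also have "\<dots> = 1"
    by (simp add: nn_integral_cmult_indicator weight_def)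
  finally show ?case by simp
next
  case (Suc n)
  define f where "f u = weight u * indicator {u. length u = Suc n} u" for u
  have bij: "bij_betw (\<lambda>(u, j). u @ [j]) (UNIV :: (label \<times> nat) set) {u. u \<noteq> []}"
    by (rule bij_betwI[where g="\<lambda>u. (butlast u, last u)"]) auto
  have "(\<integral>\<^sup>+u. f u \<partial>count_space UNIV) = (\<integral>\<^sup>+u. f u \<partial>count_space {u. u \<noteq> []})"
    by (subst nn_integral_count_space_indicator) (auto simp: f_def indicator_def intro!: nn_integral_cong)
  also have "\<dots> = (\<integral>\<^sup>+p. f ((\<lambda>(u, j). u @ [j]) p) \<partial>count_space UNIV)"
    by (rule nn_integral_bij_count_space[OF bij, symmetric])
  also have "\<dots> = (\<integral>\<^sup>+u. \<integral>\<^sup>+j. f (u @ [j]) \<partial>count_space UNIV \<partial>count_space UNIV)"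
    by (subst nn_integral_fst_count_space[symmetric]) simp
  also have "\<dots> = (\<integral>\<^sup>+u. \<integral>\<^sup>+j. (weight u * indicator {u. length u = n} u * ennreal (1 / 2)) * tail u j \<partial>count_space UNIV \<partial>count_space UNIV)"
    by (intro nn_integral_cong) (auto simp: f_def weight_snoc indicator_def mult_ac)
  also have "\<dots> \<le> (\<integral>\<^sup>+u. (weight u * indicator {u. length u = n} u * ennreal (1 / 2)) * 1 \<partial>count_space UNIV)"
  proof (rule nn_integral_mono)
    fix u :: label
    let ?c = "weight u * indicator {u. length u = n} u * ennreal (1 / 2)"
    have "(\<integral>\<^sup>+j. ?c * tail u j \<partial>count_space UNIV) = ?c * (\<integral>\<^sup>+j. tail u j \<partial>count_space UNIV)"
      by (rule nn_integral_cmult) simp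
    also have "\<dots> \<le> ?c * 1"
      by (intro mult_left_mono suminf_tail) simp
    finally show "(\<integral>\<^sup>+j. ?c * tail u j \<partial>count_space UNIV) \<le> ?c * 1" .
  qed
  also have "\<dots> = (\<integral>\<^sup>+u. weight u * indicator {u. length u = n} u \<partial>count_space UNIV) * ennreal (1 / 2)"
    by (simp only: mult_1_right) (rule nn_integral_multc, simp)
  also have "\<dots> \<le> ennreal ((1 / 2) ^ n) * ennreal (1 / 2)"
    by (intro mult_right_mono Suc.IH) simp
  also have "\<dots> = ennreal ((1 / 2) ^ Suc n)"
    by (subst ennreal_mult[symmetric]) (simp_all add: mult.commute)
  finally show ?case by (simp add: f_def)
qed

text \<open>
  The discounted number of births has finite expectation, hence is almost surely finite.
\<close>

lemma AE_non_explosive: "AE \<omega> in M. non_explosive L Z \<omega>"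
proof -
  have "(\<integral>\<^sup>+\<omega>. (\<integral>\<^sup>+u. discounted u \<omega> \<partial>count_space UNIV) \<partial>M) = (\<integral>\<^sup>+u. \<integral>\<^sup>+\<omega>. discounted u \<omega> \<partial>M \<partial>count_space UNIV)"
    by (rule nn_integral_count_space_nn_integral) auto
  also have "\<dots> = (\<integral>\<^sup>+u. (\<Sum>n. weight u * indicator {u. length u = n} u) \<partial>count_space UNIV)"
  proof (intro nn_integral_cong)
    fix u :: label
    show "(\<integral>\<^sup>+\<omega>. discounted u \<omega> \<partial>M) = (\<Sum>n. weight u * indicator {u. length u = n} u)"
      by (subst suminf_finite[of "{length u}"]) (auto simp: nn_integral_discounted)
  qed
  also have "\<dots> = (\<Sum>n. \<integral>\<^sup>+u. weight u * indicator {u. length u = n} u \<partial>count_space UNIV)"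
    by (rule nn_integral_suminf) simp
  also have "\<dots> \<le> (\<Sum>n. ennreal ((1 / 2) ^ n))"
    by (intro suminf_le weight_generation) auto
  also have "\<dots> = ennreal (1 / (1 - 1 / 2))"
    using geometric_sums[of "1 / 2 :: real"] by (intro suminf_ennreal_eq) auto
  also have "\<dots> < \<infinity>" by simp
  finally have "(\<integral>\<^sup>+\<omega>. (\<integral>\<^sup>+u. discounted u \<omega> \<partial>count_space UNIV) \<partial>M) \<noteq> \<infinity>" by simp
  moreover have "(\<lambda>\<omega>. \<integral>\<^sup>+u. discounted u \<omega> \<partial>count_space UNIV) \<in> borel_measurable M"
  proof -
    interpret S: sigma_finite_measure "count_space (UNIV :: label set)"
      by (rule sigma_finite_measure_count_space_countable) simp
    have "(\<lambda>p. discounted (snd p) (fst p)) \<in> borel_measurable (M \<Otimes>\<^sub>M count_space UNIV)"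
      by (rule measurable_compose_countable[where f="\<lambda>u p. discounted u (fst p)" and g=snd]) measurable
    then show ?thesis
      by (intro S.borel_measurable_nn_integral) (simp add: case_prod_unfold)
  qed
  ultimately have "AE \<omega> in M. (\<integral>\<^sup>+u. discounted u \<omega> \<partial>count_space UNIV) \<noteq> \<infinity>"
    by (intro nn_integral_PInf_AE)
  then show ?thesis
  proof eventually_elim
    case (elim \<omega>)
    show ?case
      unfolding non_explosive_def
    proof (rule allI, rule ccontr)
      fix t
      define B where "B = {u. realised Z u \<omega> \<and> birth_time L u \<omega> \<le> t}"
      assume "infinite {u. realised Z u \<omega> \<and> birth_time L u \<omega> \<le> t}"
      then have "infinite B" by (simp add: B_def)
      then have "\<infinity> = ennreal (exp (- (K * t))) * emeasure (count_space UNIV) B"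
        by (simp add: ennreal_mult_top)
      also have "\<dots> = (\<integral>\<^sup>+u. ennreal (exp (- (K * t))) * indicator B u \<partial>count_space UNIV)"
        by (rule nn_integral_cmult_indicator[symmetric]) simp
      also have "\<dots> \<le> (\<integral>\<^sup>+u. discounted u \<omega> \<partial>count_space UNIV)"
        using K by (intro nn_integral_mono) (auto simp: B_def indicator_def discounted_def intro!: ennreal_leI)
      finally show False using elim by (simp add: top_unique)
    qed
  qed
qed

end

section \<open>The Kolmogorov equation\<close>

context branching_tree
begin

abbreviation population :: "real \<Rightarrow> 'a \<Rightarrow> nat" where
  "population t \<omega> \<equiv> card (alive L Z t \<omega>)"

lemma population_measurable_at [measurable]: "population t \<in> measurable M (count_space UNIV)"
  using population_measurable[of "\<lambda>_. t"] by simp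

lemma approx_pgf_tendsto:
  assumes s: "cmod s \<le> 1" and t: "0 \<le> t"
  shows "(\<lambda>n. approx_pgf K h s n t) \<longlonglongrightarrow> pgf M (population t) s"
proof -
  have [measurable]: "(\<lambda>\<omega>. pop n (\<lambda>u. L u \<omega>) (\<lambda>u. Z u \<omega>) t) \<in> measurable M (count_space UNIV)" for n
    by (rule pop_measurable) auto
  have "(\<lambda>n. pgf M (\<lambda>\<omega>. pop n (\<lambda>u. L u \<omega>) (\<lambda>u. Z u \<omega>) t) s) \<longlonglongrightarrow> pgf M (population t) s"
    unfolding pgf_def
  proof (rule integral_dominated_convergence[where w="\<lambda>_. 1"])
    show "AE \<omega> in M. (\<lambda>n. s ^ pop n (\<lambda>u. L u \<omega>) (\<lambda>u. Z u \<omega>) t) \<longlonglongrightarrow> s ^ population t \<omega>"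
      using AE_non_explosive
    proof eventually_elim
      case (elim \<omega>)
      from pop_eventually_eq[OF this, of t] show ?case
        by (intro tendsto_eventually) (auto elim: eventually_mono)
    qed
    show "AE \<omega> in M. norm (s ^ pop n (\<lambda>u. L u \<omega>) (\<lambda>u. Z u \<omega>) t) \<le> 1" for n
      by (intro AE_I2 norm_nat_power_le_1 s)
  qed auto
  then show ?thesis
    using pgf_pop[OF s branching_tree_axioms t] by simp
qed

lemma integral_exponential_density:
  "integrable lborel (exponential_density K)" "(LINT l|lborel. exponential_density K l) = 1"
proof -
  interpret E: prob_space "density lborel (exponential_density K)"
    using K by (rule prob_space_exponential_density)
  have one: "(\<integral>\<^sup>+x. ennreal (exponential_density K x) \<partial>lborel) = 1"
    using E.emeasure_space_1 by (simp add: emeasure_density)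
  have nn: "0 \<le> exponential_density K x" for x
    using K by (rule exponential_density_nonneg)
  show "integrable lborel (exponential_density K)"
    by (rule integrableI_nonneg) (auto simp: one nn)
  show "(LINT l|lborel. exponential_density K l) = 1"
    by (subst integral_eq_nn_integral) (auto simp: one nn)
qed

text \<open>
  The limit of the recursion for the first \<open>n\<close> generations, dominated by the density of the life-time.
\<close>

lemma population_renewal_equation:
  assumes s: "cmod s \<le> 1" and t: "0 \<le> t"
  defines "F \<equiv> \<lambda>t. pgf M (population t) s"
  defines "G \<equiv> \<lambda>l. exponential_density K l *\<^sub>R (if t < l then s else h (F (t - l)))"
  shows "F t = (LINT l|lborel. G l)" "integrable lborel G"
proof -
  define g where "g n l = exponential_density K l *\<^sub>R (if t < l then s else h (approx_pgf K h s n (t - l)))" for n l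
  have nn: "0 \<le> exponential_density K x" for x
    using K by (rule exponential_density_nonneg)
  have gm: "g n \<in> borel_measurable lborel" for n
    unfolding g_def[abs_def]
    by (rule first_branching(2)[OF s t, of n]) (rule pgf_pop[OF s subtree])
  have approx_le: "cmod (approx_pgf K h s n v) \<le> 1" if "0 \<le> v" for n v
    unfolding pgf_pop[OF s branching_tree_axioms that, of n, symmetric]
    by (intro norm_pgf_le_1 pop_measurable s) auto
  have F_le: "cmod (F v) \<le> 1" for v
    unfolding F_def by (intro norm_pgf_le_1 s) auto
  have lim: "(\<lambda>n. g n l) \<longlonglongrightarrow> G l" for l
  proof (cases "t < l")
    case True
    then show ?thesis by (simp add: g_def G_def)
  next
    case False
    have "(\<lambda>n. h (approx_pgf K h s n (t - l))) \<longlonglongrightarrow> h (F (t - l))"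
      unfolding F_def
      by (rule continuous_on_tendsto_compose[OF continuous_on_h approx_pgf_tendsto[OF s]])
        (use False approx_le F_le in \<open>auto simp: F_def\<close>)
    then show ?thesis
      using False by (auto simp: g_def G_def intro!: tendsto_scaleR)
  qed
  have Gm: "G \<in> borel_measurable lborel"
    by (rule borel_measurable_LIMSEQ_metric[OF gm lim])
  have bound: "norm (g n l) \<le> exponential_density K l" for n l
    using nn[of l] norm_h_le_1[OF approx_le[of "t - l" n]] s
    by (auto simp: g_def intro!: mult_right_le_one_le)
  note dom = integral_dominated_convergence[OF Gm gm integral_exponential_density(1)]
  have "(\<lambda>n. LINT l|lborel. g n l) \<longlonglongrightarrow> (LINT l|lborel. G l)"
    by (rule dom) (auto intro: lim bound)
  then have "(\<lambda>n. approx_pgf K h s (Suc n) t) \<longlonglongrightarrow> (LINT l|lborel. G l)"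
    by (simp add: g_def)
  moreover have "(\<lambda>n. approx_pgf K h s (Suc n) t) \<longlonglongrightarrow> F t"
    unfolding F_def by (rule LIMSEQ_Suc[OF approx_pgf_tendsto[OF s t]])
  ultimately show "F t = (LINT l|lborel. G l)"
    by (intro LIMSEQ_unique)
  show "integrable lborel G"
    by (rule integrable_dominated_convergence[OF Gm gm integral_exponential_density(1)]) (auto intro: lim bound)
qed

text \<open>
  The substitution \<open>v = t - l\<close> in the renewal equation; the part \<open>v < 0\<close> of the integral is the event
  that the root outlives \<open>t\<close>; it contributes \<open>s\<close> once multiplied by \<open>exp (K t)\<close>.
\<close>

lemma population_integral_equation:
  assumes s: "cmod s \<le> 1" and t: "0 \<le> t"
  defines "F \<equiv> \<lambda>t. pgf M (population t) s"
  defines "w \<equiv> \<lambda>v. (K * exp (K * v)) *\<^sub>R h (F v)"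
  shows "w integrable_on {0..t}" "exp (K * t) *\<^sub>R F t = s + integral {0..t} w"
proof -
  \<comment> \<open>\<open>w\<close> continued to negative times by the value \<open>s\<close> of a family whose root is still alive\<close>
  define H where "H v = (K * exp (K * v)) *\<^sub>R (if v < 0 then s else h (F v))" for v
  have F: "pgf M (population v) s = F v" for v
    by (simp add: F_def)
  note renewal = population_renewal_equation[OF s, unfolded F]
  have subst: "set_integrable lborel {..r} H" "exp (K * r) *\<^sub>R F r = (LINT v:{..r}|lborel. H v)" if r: "0 \<le> r" for r
  proof -
    define G where "G l = exponential_density K l *\<^sub>R (if r < l then s else h (F (r - l)))" for l
    have *: "G (r + (-1) * v) = exp (- (K * r)) *\<^sub>R (indicator {..r} v *\<^sub>R H v)" for v
      by (auto simp: G_def H_def exponential_density_def indicator_def mult_exp_exp algebra_simps)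
    have cancel: "exp (K * r) *\<^sub>R (exp (- (K * r)) *\<^sub>R z) = z" for z :: complex
      by (simp add: exp_minus_inverse)
    have "integrable lborel (\<lambda>v. G (r + (-1) * v))"
      using renewal(2)[OF r] by (intro lborel_integrable_real_affine) (simp_all add: G_def[abs_def])
    then have "integrable lborel (\<lambda>v. exp (K * r) *\<^sub>R G (r + (-1) * v))"
      by (rule integrable_scaleR_right)
    then show "set_integrable lborel {..r} H"
      unfolding * set_integrable_def cancel .
    have "F r = (LINT v|lborel. G (r + (-1) * v))"
      using renewal(1)[OF r] lborel_integral_real_affine[of "-1" G r]
      by (simp add: G_def[abs_def])
    also have "\<dots> = exp (- (K * r)) *\<^sub>R (LINT v:{..r}|lborel. H v)"
      unfolding * set_lebesgue_integral_def by (rule integral_scaleR_right)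
    finally show "exp (K * r) *\<^sub>R F r = (LINT v:{..r}|lborel. H v)"
      by (simp add: exp_add[symmetric])
  qed
  have F0: "F 0 = s"
  proof -
    define G where "G l = exponential_density K l *\<^sub>R (if 0 < l then s else h (F (0 - l)))" for l
    have "F 0 = (LINT l|lborel. G l)" "integrable lborel G"
      using renewal[of 0] by (simp_all add: G_def[abs_def])
    note this(1)
    also have "(LINT l|lborel. G l) = (LINT l|lborel. exponential_density K l *\<^sub>R s)"
    proof (rule integral_cong_AE)
      show "AE l in lborel. G l = exponential_density K l *\<^sub>R s"
        using AE_lborel_singleton[of "0::real"]
        by eventually_elim (auto simp: G_def exponential_density_def)
    qed (use \<open>integrable lborel G\<close> in auto)
    also have "\<dots> = s"
      using integral_exponential_density by (subst integral_scaleR_left) auto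
    finally show ?thesis .
  qed
  have int: "set_integrable lborel {..<0} H" "set_integrable lborel {0..t} H"
    using subst(1)[OF t] by (rule set_integrable_subset; use t in auto)+
  have "{..t} = {..<0} \<union> {0..t}" using t by auto
  then have split: "(LINT v:{..t}|lborel. H v) = (LINT v:{..<0}|lborel. H v) + (LINT v:{0..t}|lborel. H v)"
    by (simp only:) (intro set_integral_Un int, auto)
  have "s = (LINT v:{..0}|lborel. H v)"
    using subst(2)[of 0] by (simp add: F0)
  also have "\<dots> = (LINT v:{..<0}|lborel. H v)"
  proof (rule set_integral_cong_set)
    show "AE v in lborel. v \<in> {..<0} \<longleftrightarrow> v \<in> {..0::real}"
      using AE_lborel_singleton[of "0::real"] by eventually_elim auto
    show "set_borel_measurable lborel {..<0} H" "set_borel_measurable lborel {..0} H"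
      using int(1) subst(1)[of 0]
      unfolding set_integrable_def set_borel_measurable_def by (auto dest: borel_measurable_integrable)
  qed
  finally have zero: "(LINT v:{..<0}|lborel. H v) = s" by simp
  have wH: "H v = w v" if "v \<in> {0..t}" for v
    using that by (simp add: H_def w_def)
  have Hi: "H integrable_on {0..t}"
    by (rule set_borel_integral_eq_integral(1)[OF int(2)])
  then show "w integrable_on {0..t}"
    by (rule integrable_eq) (rule wH)
  have "exp (K * t) *\<^sub>R F t = s + (LINT v:{0..t}|lborel. H v)"
    using subst(2)[OF t] split zero by simp
  also have "(LINT v:{0..t}|lborel. H v) = integral {0..t} H"
    by (rule set_borel_integral_eq_integral(2)[OF int(2)])
  also have "\<dots> = integral {0..t} w"
    by (rule integral_cong) (rule wH)
  finally show "exp (K * t) *\<^sub>R F t = s + integral {0..t} w" .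
qed

text \<open>
  The integral equation shows first that \<open>F\<close> is continuous and then that it is differentiable.  The
  bound on \<open>Re F\<close> follows from it as well, since \<open>h\<close> has modulus at most \<open>1\<close> on the disc.
\<close>

lemma population_kolmogorov:
  assumes s: "cmod s \<le> 1" and t: "t \<in> {0..T}"
  defines "F \<equiv> \<lambda>t. pgf M (population t) s"
  shows "(F has_vector_derivative (K *\<^sub>R (h (F t) - F t))) (at t within {0..T})"
    and "F 0 = s"
    and "Re (F t) \<le> exp (- (K * t)) * Re s + (1 - exp (- (K * t)))"
proof -
  define w where "w v = (K * exp (K * v)) *\<^sub>R h (F v)" for v
  have eq: "w integrable_on {0..v}" "exp (K * v) *\<^sub>R F v = s + integral {0..v} w" if "0 \<le> v" for v
    using population_integral_equation[OF s that] by (simp_all add: F_def w_def[abs_def])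
  have F_le: "cmod (F v) \<le> 1" for v
    unfolding F_def by (intro norm_pgf_le_1 s) auto
  have Feq: "F v = exp (- (K * v)) *\<^sub>R (s + integral {0..v} w)" if "0 \<le> v" for v
    unfolding eq(2)[OF that, symmetric] by (simp add: exp_add[symmetric])
  have T: "0 \<le> T" using t by auto
  have "continuous_on {0..T} (\<lambda>v. exp (- (K * v)) *\<^sub>R (s + integral {0..v} w))"
    by (intro continuous_intros indefinite_integral_continuous_1 eq(1) T)
  then have cF: "continuous_on {0..T} F"
    by (rule continuous_on_eq) (auto simp: Feq)
  have "continuous_on {0..T} (h \<circ> F)"
    by (intro continuous_on_compose cF continuous_on_subset[OF continuous_on_h]) (auto simp: F_le)
  then have cw: "continuous_on {0..T} w"
    unfolding w_def by (intro continuous_intros) (simp add: comp_def)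
  have "((\<lambda>v. exp (- (K * v)) *\<^sub>R (s + integral {0..v} w)) has_vector_derivative
      exp (- (K * t)) *\<^sub>R w t + (exp (- (K * t)) * (- K)) *\<^sub>R (s + integral {0..t} w)) (at t within {0..T})"
    by (rule has_vector_derivative_scaleR)
      (auto intro!: derivative_eq_intros integral_has_vector_derivative[OF cw t])
  also have "exp (- (K * t)) *\<^sub>R w t + (exp (- (K * t)) * (- K)) *\<^sub>R (s + integral {0..t} w) =
      K *\<^sub>R (h (F t) - F t)"
  proof -
    have "exp (- (K * t)) *\<^sub>R w t = K *\<^sub>R h (F t)"
      by (simp add: w_def mult_exp_exp)
    moreover have "(exp (- (K * t)) * (- K)) *\<^sub>R (s + integral {0..t} w) = - (K *\<^sub>R F t)"
      using t by (simp add: Feq mult.commute)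
    ultimately show ?thesis by (simp add: scaleR_diff_right)
  qed
  finally show "(F has_vector_derivative (K *\<^sub>R (h (F t) - F t))) (at t within {0..T})"
    by (rule has_vector_derivative_transform[OF t, rotated]) (auto simp: Feq)
  show "F 0 = s" by (simp add: Feq)
  have "((\<lambda>v. K * exp (K * v)) has_integral (exp (K * t) - exp (K * 0))) {0..t}"
    using t by (intro fundamental_theorem_of_calculus)
      (auto intro!: derivative_eq_intros simp: has_real_derivative_iff_has_vector_derivative[symmetric])
  then have i: "((\<lambda>v. K * exp (K * v)) has_integral (exp (K * t) - 1)) {0..t}" by simp
  have "norm (integral {0..t} w) \<le> integral {0..t} (\<lambda>v. K * exp (K * v))"
  proof (rule integral_norm_bound_integral)
    show "w integrable_on {0..t}" using t by (intro eq(1)) auto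
    show "(\<lambda>v. K * exp (K * v)) integrable_on {0..t}" using i by blast
    show "norm (w v) \<le> K * exp (K * v)" for v
      using K norm_h_le_1[OF F_le[of v]] by (auto simp: w_def intro!: mult_right_le_one_le)
  qed
  then have "Re (integral {0..t} w) \<le> exp (K * t) - 1"
    using integral_unique[OF i] complex_Re_le_cmod[of "integral {0..t} w"] by linarith
  then have "exp (- (K * t)) * (Re s + Re (integral {0..t} w)) \<le> exp (- (K * t)) * (Re s + (exp (K * t) - 1))"
    by (intro mult_left_mono) auto
  also have "\<dots> = exp (- (K * t)) * Re s + (1 - exp (- (K * t)))"
    by (simp add: algebra_simps mult_exp_exp)
  finally show "Re (F t) \<le> exp (- (K * t)) * Re s + (1 - exp (- (K * t)))"
    using t by (simp add: Feq)
qed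

end

section \<open>Its explicit solution\<close>

lemma powr_right_half_plane:
  fixes q :: complex and a :: real
  assumes q: "0 < Re q"
  shows "q powr of_real a = exp (of_real a * Ln q)" "\<bar>Im (Ln q)\<bar> < pi / 2"
  using assms Re_Ln_pos_lt_imp[OF q] by (auto simp: powr_def)

lemma Re_powr_nonneg:
  fixes q :: complex and a :: real
  assumes q: "0 < Re q" and a: "0 < a" "a < 1"
  shows "0 \<le> Re (q powr of_real a)"
proof -
  have "\<bar>a * Im (Ln q)\<bar> = a * \<bar>Im (Ln q)\<bar>" using a by (simp add: abs_mult)
  also have "\<dots> \<le> 1 * \<bar>Im (Ln q)\<bar>" using a by (intro mult_right_mono) auto
  also have "\<dots> < pi / 2" using powr_right_half_plane(2)[OF q] by simp
  finally have "0 \<le> cos (a * Im (Ln q))"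
    by (intro cos_ge_zero) auto
  then show ?thesis
    by (simp add: powr_right_half_plane(1)[OF q] Re_exp)
qed

text \<open>
  As \<open>q = 1 - F\<close> stays in the right half plane, \<open>q powr (- \<beta>)\<close> is differentiable with constant derivative,
  so \<open>q(t) powr (- \<beta>) = q(0) powr (- \<beta>) * b\<close>.  The imaginary parts of \<open>\<beta> Ln q\<close> and \<open>Ln b\<close> are smaller
  than \<open>\<pi>/2\<close>, so logarithms may be taken on both sides.
\<close>

lemma log_solution_of_kolmogorov:
  fixes F :: "real \<Rightarrow> complex" and \<beta> K T :: real
  assumes \<beta>: "0 < \<beta>" "\<beta> < 1" and T: "t \<in> {0..T}"
    and ode: "\<And>t. t \<in> {0..T} \<Longrightarrow> (F has_vector_derivative
        (of_real K * ((1 - F t) powr of_real (1 + \<beta>) / of_real (1 + \<beta>)))) (at t within {0..T})"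
    and Re: "\<And>t. t \<in> {0..T} \<Longrightarrow> Re (F t) < 1"
    and b: "b = 1 + (1 - F 0) powr of_real \<beta> * of_real (K * \<beta> / (1 + \<beta>) * t)" "1 \<le> Re b"
  shows "Ln (1 - F t) = Ln (1 - F 0) - Ln b / of_real \<beta>"
proof -
  define q where "q t = 1 - F t" for t
  have q: "0 < Re (q t)" if "t \<in> {0..T}" for t
    using Re[OF that] by (simp add: q_def)
  define C where "C = K * \<beta> / (1 + \<beta>)"
  have b0: "1 + \<beta> \<noteq> 0" using \<beta> by simp
  define g where "g t = q t powr of_real (- \<beta>) - of_real (C * t)" for t
  have "(g has_vector_derivative 0) (at t within {0..T})" if t: "t \<in> {0..T}" for t
  proof -
    have "q t \<notin> \<real>\<^sub>\<le>\<^sub>0"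
      using q[OF t] by (auto simp: complex_nonpos_Reals_iff)
    then have d: "((\<lambda>z. z powr of_real (- \<beta>)) has_field_derivative
        (of_real (- \<beta>) * q t powr (of_real (- \<beta>) - 1))) (at (q t) within q ` {0..T})"
      by (rule has_field_derivative_at_within[OF has_field_derivative_powr])
    have dq: "(q has_vector_derivative (- (of_real K * (q t powr of_real (1 + \<beta>) / of_real (1 + \<beta>))))) (at t within {0..T})"
      unfolding q_def[abs_def] by (auto intro!: derivative_eq_intros ode t)
    have "((\<lambda>z. z powr of_real (- \<beta>)) \<circ> q has_vector_derivative
        (- (of_real K * (q t powr of_real (1 + \<beta>) / of_real (1 + \<beta>)))) * (of_real (- \<beta>) * q t powr (of_real (- \<beta>) - 1)))
        (at t within {0..T})"
      by (rule field_vector_diff_chain_within[OF dq d])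
    also have "(- (of_real K * (q t powr of_real (1 + \<beta>) / of_real (1 + \<beta>)))) * (of_real (- \<beta>) * q t powr (of_real (- \<beta>) - 1)) =
        of_real C * (q t powr of_real (1 + \<beta>) * q t powr (of_real (- \<beta>) - 1))"
      by (simp add: C_def)
    also have "q t powr of_real (1 + \<beta>) * q t powr (of_real (- \<beta>) - 1) = 1"
    proof -
      have "q t \<noteq> 0" using q[OF t] by auto
      then show ?thesis
        by (subst powr_add[symmetric]) (simp add: powr_def)
    qed
    finally have "((\<lambda>t. q t powr of_real (- \<beta>)) has_vector_derivative of_real C) (at t within {0..T})"
      by (simp add: comp_def)
    then show ?thesis
      unfolding g_def[abs_def] by (auto intro!: derivative_eq_intros)
  qed
  then obtain c where c: "\<And>t. t \<in> {0..T} \<Longrightarrow> g t = c"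
    using has_vector_derivative_zero_constant[of "{0..T}" g] by auto
  have "0 \<in> {0..T}" using T by auto
  then have "g t = g 0" using c T by metis
  then have eq: "q t powr of_real (- \<beta>) = q 0 powr of_real (- \<beta>) + of_real (C * t)"
    by (simp add: g_def algebra_simps)
  have q0: "0 < Re (q 0)" using q \<open>0 \<in> {0..T}\<close> by blast
  have bb: "b = 1 + q 0 powr of_real \<beta> * of_real (C * t)"
    by (simp add: b q_def C_def)
  have "q 0 powr of_real (- \<beta>) * q 0 powr of_real \<beta> = 1"
    using q0 by (subst powr_add[symmetric]) (auto simp: powr_def)
  then have "q t powr of_real (- \<beta>) = q 0 powr of_real (- \<beta>) * b"
    unfolding eq bb by (simp add: algebra_simps)
  moreover have b0: "b \<noteq> 0" using b(2) by auto
  note qt = powr_right_half_plane[OF q[OF T]] and q0' = powr_right_half_plane[OF q0]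
  ultimately have "exp (of_real (- \<beta>) * Ln (q t)) = exp (of_real (- \<beta>) * Ln (q 0)) * exp (Ln b)"
    unfolding qt(1) q0'(1) by (simp only: exp_Ln[OF b0])
  then have "exp (of_real (- \<beta>) * Ln (q t)) = exp (of_real (- \<beta>) * Ln (q 0) + Ln b)"
    by (simp only: exp_add)
  then have "Ln (exp (of_real (- \<beta>) * Ln (q t))) = Ln (exp (of_real (- \<beta>) * Ln (q 0) + Ln b))"
    by simp
  moreover have small: "\<bar>\<beta> * Im (Ln (q r))\<bar> < pi / 2" if "\<bar>Im (Ln (q r))\<bar> < pi / 2" for r
  proof -
    have "\<bar>\<beta> * Im (Ln (q r))\<bar> = \<beta> * \<bar>Im (Ln (q r))\<bar>" using \<beta> by (simp add: abs_mult)
    also have "\<dots> \<le> 1 * \<bar>Im (Ln (q r))\<bar>" using \<beta> by (intro mult_right_mono) auto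
    finally show ?thesis using that by simp
  qed
  moreover have "\<bar>Im (Ln b)\<bar> < pi / 2"
    using b(2) by (intro Re_Ln_pos_lt_imp) simp
  ultimately have "of_real (- \<beta>) * Ln (q t) = of_real (- \<beta>) * Ln (q 0) + Ln b"
    using small[OF qt(2)] small[OF q0'(2)] by (subst (asm) (1 2) Ln_exp) (auto simp: abs_less_iff)
  then have "of_real \<beta> * Ln (q t) = of_real \<beta> * (Ln (q 0) - Ln b / of_real \<beta>)"
    using \<beta> by (simp add: algebra_simps)
  then show ?thesis
    using \<beta> by (simp add: q_def)
qed

abbreviation (input) offspring_pgf :: "real \<Rightarrow> complex \<Rightarrow> complex" where
  "offspring_pgf \<beta> \<equiv> \<lambda>s. s + (1 - s) powr complex_of_real (1 + \<beta>) / complex_of_real (1 + \<beta>)"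

text \<open>
  For \<open>0 < s < 1\<close> the difference quotient \<open>(1 - E[s^V]) / (1 - s) = E[1 + s + \<dots> + s^(V - 1)]\<close> is at most
  \<open>1\<close>, because \<open>E[s^V] \<ge> s\<close>; Fatou's lemma for \<open>s \<longlonglongrightarrow> 1\<close> bounds the mean.
\<close>

lemma (in prob_space) mean_le_1_if_offspring_pgf:
  assumes V: "has_pgf M V (offspring_pgf \<beta>)" and \<beta>: "0 < \<beta>"
  shows "(\<integral>\<^sup>+\<omega>. of_nat (V \<omega>) \<partial>M) \<le> 1"
proof -
  have [measurable]: "V \<in> measurable M (count_space UNIV)"
    using V by (simp add: has_pgf_def)
  \<comment> \<open>the shift by \<open>2\<close> keeps \<open>s n\<close> strictly between \<open>0\<close> and \<open>1\<close>, also for \<open>n = 0\<close>\<close>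
  define s where "s n = 1 - 1 / real (n + 2)" for n
  have s: "0 < s n" "s n < 1" for n by (auto simp: s_def field_simps)
  define f where "f n \<omega> = (\<Sum>j<V \<omega>. s n ^ j)" for n \<omega>
  have fm[measurable]: "f n \<in> borel_measurable M" for n
    unfolding f_def[abs_def]
    by (rule measurable_compose[of V M "count_space UNIV" "\<lambda>v. \<Sum>j<v. s n ^ j"]) auto
  have le1: "(\<integral>\<^sup>+\<omega>. ennreal (f n \<omega>) \<partial>M) \<le> 1" for n
  proof -
    have int: "integrable M (\<lambda>\<omega>. s n ^ V \<omega>)"
    proof (rule integrable_const_bound[where B=1])
      show "AE \<omega> in M. norm (s n ^ V \<omega>) \<le> 1"
        using s[of n] by (auto simp: norm_power intro!: power_le_one)
      show "(\<lambda>\<omega>. s n ^ V \<omega>) \<in> borel_measurable M"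
        by (rule measurable_compose[of V M "count_space UNIV" "\<lambda>v. s n ^ v"]) auto
    qed
    have feq: "f n \<omega> = (1 - s n ^ V \<omega>) / (1 - s n)" for \<omega>
      using s[of n] by (simp add: f_def sum_gp_strict)
    have "complex_of_real (expectation (\<lambda>\<omega>. s n ^ V \<omega>)) = pgf M V (of_real (s n))"
      by (simp add: pgf_def integral_complex_of_real[symmetric])
    also have "\<dots> = of_real (s n) + (1 - of_real (s n)) powr of_real (1 + \<beta>) / of_real (1 + \<beta>)"
      using V s[of n] by (auto simp: has_pgf_def)
    also have "\<dots> = of_real (s n + (1 - s n) powr (1 + \<beta>) / (1 + \<beta>))"
    proof -
      have "(1 - of_real (s n)) powr of_real (1 + \<beta>) = complex_of_real ((1 - s n) powr (1 + \<beta>))"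
        using s[of n] powr_of_real[of "1 - s n" "1 + \<beta>"] by simp
      then show ?thesis by simp
    qed
    finally have "expectation (\<lambda>\<omega>. s n ^ V \<omega>) = s n + (1 - s n) powr (1 + \<beta>) / (1 + \<beta>)"
      by (simp only: of_real_eq_iff)
    then have ge: "s n \<le> expectation (\<lambda>\<omega>. s n ^ V \<omega>)"
      using \<beta> by simp
    have "(\<integral>\<^sup>+\<omega>. ennreal (f n \<omega>) \<partial>M) = ennreal (expectation (f n))"
      unfolding feq[abs_def] using int s[of n]
      by (intro nn_integral_eq_integral) (auto intro!: AE_I2 divide_nonneg_nonneg power_le_one)
    also have "expectation (f n) = (1 - expectation (\<lambda>\<omega>. s n ^ V \<omega>)) / (1 - s n)"
      unfolding feq[abs_def] using int by (simp add: prob_space)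
    also have "ennreal \<dots> \<le> 1"
      using ge s[of n] by (simp add: ennreal_le_1 divide_le_eq)
    finally show ?thesis .
  qed
  have lim: "(\<lambda>n. ennreal (f n \<omega>)) \<longlonglongrightarrow> of_nat (V \<omega>)" for \<omega>
  proof -
    have "s \<longlonglongrightarrow> 1 - 0"
      unfolding s_def[abs_def]
      by (intro tendsto_diff tendsto_const LIMSEQ_ignore_initial_segment[OF lim_1_over_n])
    then have "(\<lambda>n. f n \<omega>) \<longlonglongrightarrow> (\<Sum>j<V \<omega>. 1 ^ j)"
      unfolding f_def by (intro tendsto_intros) simp
    then have "(\<lambda>n. ennreal (f n \<omega>)) \<longlonglongrightarrow> ennreal (real (V \<omega>))"
      by (intro tendsto_ennrealI) simp
    then show ?thesis by (simp add: ennreal_of_nat_eq_real_of_nat)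
  qed
  have "(\<integral>\<^sup>+\<omega>. of_nat (V \<omega>) \<partial>M) = (\<integral>\<^sup>+\<omega>. liminf (\<lambda>n. ennreal (f n \<omega>)) \<partial>M)"
    by (intro nn_integral_cong) (simp add: lim_imp_Liminf[OF _ lim])
  also have "\<dots> \<le> liminf (\<lambda>n. \<integral>\<^sup>+\<omega>. ennreal (f n \<omega>) \<partial>M)"
    by (rule nn_integral_liminf) measurable
  also have "\<dots> \<le> limsup (\<lambda>n. \<integral>\<^sup>+\<omega>. ennreal (f n \<omega>) \<partial>M)"
    by (rule Liminf_le_Limsup) simp
  also have "\<dots> \<le> 1"
    by (rule Limsup_bounded) (simp add: le1)
  finally show ?thesis .
qed

lemma Re_less_1:
  assumes "cmod s \<le> 1" "s \<noteq> 1"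
  shows "Re s < 1"
proof (rule ccontr)
  assume "\<not> Re s < 1"
  then have "Re s = 1" using complex_Re_le_cmod[of s] assms(1) by linarith
  moreover have "(Re s)\<^sup>2 + (Im s)\<^sup>2 \<le> 1"
    using assms(1) by (metis cmod_power2 norm_ge_zero power_le_one)
  ultimately have "Im s = 0" by simp
  with \<open>Re s = 1\<close> assms(2) show False by (simp add: complex_eq_iff)
qed

lemma (in branching_tree) log_pgf_population:
  assumes h: "h = offspring_pgf \<beta>" and \<beta>: "0 < \<beta>" "\<beta> < 1"
    and s: "cmod s \<le> 1" "s \<noteq> 1" and t: "0 \<le> t"
  shows "Re (pgf M (population t) s) < 1"
    and "Ln (1 - pgf M (population t) s) = Ln (1 - s) -
      Ln (1 + (1 - s) powr of_real \<beta> * of_real (K * \<beta> / (1 + \<beta>) * t)) / of_real \<beta>"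
proof -
  define F where "F t = pgf M (population t) s" for t
  have kolm: "(F has_vector_derivative (K *\<^sub>R (h (F v) - F v))) (at v within {0..t})"
    "F 0 = s" "Re (F v) \<le> exp (- (K * v)) * Re s + (1 - exp (- (K * v)))" if "v \<in> {0..t}" for v
    using population_kolmogorov[OF s(1) that] by (simp_all add: F_def[abs_def])
  have lt: "Re (F v) < 1" if "v \<in> {0..t}" for v
  proof -
    have "exp (- (K * v)) * Re s < exp (- (K * v)) * 1"
      using Re_less_1[OF s] by (intro mult_strict_left_mono) auto
    also have "\<dots> = exp (- (K * v))" by (rule mult_1_right)
    finally show ?thesis using kolm(3)[OF that] by linarith
  qed
  then show "Re (pgf M (population t) s) < 1"
    using t by (simp add: F_def)
  have F0: "F 0 = s" using kolm(2)[of 0] t by simp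
  define b where "b = 1 + (1 - F 0) powr of_real \<beta> * of_real (K * \<beta> / (1 + \<beta>) * t)"
  have "0 \<le> Re ((1 - F 0) powr of_real \<beta>)"
    using lt[of 0] t by (intro Re_powr_nonneg \<beta>) auto
  then have "1 \<le> Re b"
    using \<beta> K t by (simp add: b_def)
  have "Ln (1 - F t) = Ln (1 - F 0) - Ln b / of_real \<beta>"
  proof (rule log_solution_of_kolmogorov[where F=F and K=K and T=t and t=t, OF \<beta> _ _ lt b_def \<open>1 \<le> Re b\<close>])
    show "t \<in> {0..t}" using t by simp
    show "(F has_vector_derivative of_real K * ((1 - F v) powr of_real (1 + \<beta>) / of_real (1 + \<beta>))) (at v within {0..t})"
      if "v \<in> {0..t}" for v
      using kolm(1)[OF that] by (simp add: h scaleR_conv_of_real)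
  qed
  then show "Ln (1 - pgf M (population t) s) = Ln (1 - s) -
      Ln (1 + (1 - s) powr of_real \<beta> * of_real (K * \<beta> / (1 + \<beta>) * t)) / of_real \<beta>"
    unfolding b_def F0 by (simp add: F_def)
qed

lemma markov_branching_process_tree:
  assumes "prob_space M" "K > 0" "0 < \<beta>" and X: "markov_branching_process M K (offspring_pgf \<beta>) X"
  obtains L Z where "branching_tree M K (offspring_pgf \<beta>) L Z"
    "\<And>t \<omega>. 0 \<le> t \<Longrightarrow> \<omega> \<in> space M \<Longrightarrow> X t \<omega> = card (alive L Z t \<omega>)"
proof -
  interpret prob_space M by fact
  obtain L Z where LZ: "indep_vars (\<lambda>_. borel) (case_sum L (\<lambda>u \<omega>. real (Z u \<omega>))) (UNIV :: (label + label) set)"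
    "\<And>u. distributed M lborel (L u) (exponential_density K)"
    "\<And>u. has_pgf M (Z u) (offspring_pgf \<beta>)"
    "\<And>t \<omega>. 0 \<le> t \<Longrightarrow> \<omega> \<in> space M \<Longrightarrow> X t \<omega> = card (alive L Z t \<omega>)"
    using X unfolding markov_branching_process_def by blast
  have "branching_tree M K (offspring_pgf \<beta>) L Z"
    by unfold_locales (use LZ(1-3) assms mean_le_1_if_offspring_pgf in auto)
  from that[OF this LZ(4)] show ?thesis .
qed

lemma markov_branching_process_right_continuous:
  assumes "prob_space M" "K > 0" "0 < \<beta>" and X: "markov_branching_process M K (offspring_pgf \<beta>) X"
  shows "AE \<omega> in M. \<forall>t\<ge>0. \<forall>\<^sub>F t' in at_right t. X t' \<omega> = X t \<omega>"
proof -
  obtain L Z where tree: "branching_tree M K (offspring_pgf \<beta>) L Z" and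
    LZ: "\<And>t \<omega>. 0 \<le> t \<Longrightarrow> \<omega> \<in> space M \<Longrightarrow> X t \<omega> = card (alive L Z t \<omega>)"
    using markov_branching_process_tree[OF assms] by blast
  from branching_tree.AE_non_explosive[OF tree] AE_space show ?thesis
  proof eventually_elim
    case (elim \<omega>)
    show ?case
    proof safe
      fix t :: real assume t: "0 \<le> t"
      show "\<forall>\<^sub>F t' in at_right t. X t' \<omega> = X t \<omega>"
        using alive_right_continuous[OF elim(1), of t] eventually_at_right_less[of t]
        by eventually_elim (use t elim in \<open>simp add: LZ\<close>)
    qed
  qed
qed

lemma markov_branching_process_measurable:
  assumes "prob_space M" "K > 0" "0 < \<beta>" and X: "markov_branching_process M K (offspring_pgf \<beta>) X"
    and \<tau>: "\<tau> \<in> borel_measurable M" "\<And>\<omega>. \<omega> \<in> space M \<Longrightarrow> 0 \<le> \<tau> \<omega>"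
  shows "(\<lambda>\<omega>. X (\<tau> \<omega>) \<omega>) \<in> measurable M (count_space UNIV)"
proof -
  obtain L Z where tree: "branching_tree M K (offspring_pgf \<beta>) L Z" and
    LZ: "\<And>t \<omega>. 0 \<le> t \<Longrightarrow> \<omega> \<in> space M \<Longrightarrow> X t \<omega> = card (alive L Z t \<omega>)"
    using markov_branching_process_tree[OF assms(1-4)] by blast
  show ?thesis
    using branching_tree.population_measurable[OF tree \<tau>(1)]
    by (subst measurable_cong[where g="\<lambda>\<omega>. card (alive L Z (\<tau> \<omega>) \<omega>)"]) (auto simp: LZ \<tau>(2))
qed

lemma markov_branching_process_log_pgf:
  assumes "prob_space M" "K > 0" and \<beta>: "0 < \<beta>" "\<beta> < 1"
    and X: "markov_branching_process M K (offspring_pgf \<beta>) X"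
    and s: "cmod s \<le> 1" "s \<noteq> 1" and t: "0 \<le> t"
  shows "Re (pgf M (X t) s) < 1"
    and "Ln (1 - pgf M (X t) s) = Ln (1 - s) -
      Ln (1 + (1 - s) powr of_real \<beta> * of_real (K * \<beta> / (1 + \<beta>) * t)) / of_real \<beta>"
proof -
  obtain L Z where tree: "branching_tree M K (offspring_pgf \<beta>) L Z" and
    LZ: "\<And>t \<omega>. 0 \<le> t \<Longrightarrow> \<omega> \<in> space M \<Longrightarrow> X t \<omega> = card (alive L Z t \<omega>)"
    using markov_branching_process_tree[OF assms(1-3) X] by blast
  have "pgf M (X t) s = pgf M (\<lambda>\<omega>. card (alive L Z t \<omega>)) s"
    unfolding pgf_def using t LZ by (intro Bochner_Integration.integral_cong) auto
  with branching_tree.log_pgf_population[OF tree refl \<beta> s t]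
  show "Re (pgf M (X t) s) < 1"
    "Ln (1 - pgf M (X t) s) = Ln (1 - s) -
      Ln (1 + (1 - s) powr of_real \<beta> * of_real (K * \<beta> / (1 + \<beta>) * t)) / of_real \<beta>"
    by simp_all
qed

section \<open>Immigration along a time grid\<close>

text \<open>
  Right Riemann sums, listed from the right end: uniform continuity of \<open>p\<close> makes the linearisation error
  of \<open>P\<close> on each interval small relative to its length.
\<close>

lemma riemann_sum_tendsto:
  fixes P p :: "real \<Rightarrow> complex" and t :: real
  assumes t: "0 < t"
    and P: "\<And>v. v \<in> {0..t} \<Longrightarrow> (P has_vector_derivative p v) (at v within {0..t})"
    and p: "continuous_on {0..t} p"
  shows "(\<lambda>n. (t / Suc n) *\<^sub>R (\<Sum>k<Suc n. p (t - k * t / Suc n))) \<longlonglongrightarrow> P t - P 0"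
proof (rule LIMSEQ_I)
  fix e :: real assume e: "0 < e"
  have uc: "uniformly_continuous_on {0..t} p"
    by (rule compact_uniformly_continuous[OF p]) simp
  have "0 < e / (2 * t)" using e t by simp
  with uc obtain d where d: "0 < d"
    "\<forall>x\<in>{0..t}. \<forall>y\<in>{0..t}. dist y x < d \<longrightarrow> dist (p y) (p x) < e / (2 * t)"
    unfolding uniformly_continuous_on_def by blast
  obtain n0 where n0: "t / Suc n < d" if "n0 \<le> n" for n
  proof -
    have "(\<lambda>n. t / Suc n) \<longlonglongrightarrow> 0"
      using LIMSEQ_Suc[OF lim_const_over_n[of t]] by simp
    from LIMSEQ_D[OF this d(1)] obtain n0 where "\<forall>n\<ge>n0. norm (t / Suc n - 0) < d" by blast
    then show ?thesis using t by (intro that[of n0]) (auto simp: abs_less_iff)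
  qed
  show "\<exists>no. \<forall>n\<ge>no. norm ((t / Suc n) *\<^sub>R (\<Sum>k<Suc n. p (t - k * t / Suc n)) - (P t - P 0)) < e"
  proof (intro exI[of _ n0] allI impI)
    fix n assume n: "n0 \<le> n"
    define \<Delta> where "\<Delta> = t / Suc n"
    have \<Delta>: "0 < \<Delta>" "\<Delta> < d" "\<Delta> * Suc n = t"
      using t n0[OF n] by (auto simp: \<Delta>_def)
    define v where "v k = t - real k * \<Delta>" for k
    have v: "v k \<in> {0..t}" if "k \<le> Suc n" for k
    proof -
      have "real k * \<Delta> \<le> real (Suc n) * \<Delta>"
        using that \<Delta> by (intro mult_right_mono) auto
      then show ?thesis using \<Delta> t by (auto simp: v_def mult.commute)
    qed
    have vS: "v k - v (Suc k) = \<Delta>" for k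
      by (simp add: v_def algebra_simps)
    have step: "norm (P (v k) - P (v (Suc k)) - \<Delta> *\<^sub>R p (v k)) \<le> \<Delta> * (e / (2 * t))" if k: "k < Suc n" for k
    proof -
      have sub: "closed_segment (v (Suc k)) (v k) \<subseteq> {0..t}"
        using v[of k] v[of "Suc k"] k by (auto simp: closed_segment_eq_real_ivl)
      have le: "v (Suc k) \<le> v k" using vS[of k] \<Delta> by linarith
      have "norm (P (v k) - P (v (Suc k)) - (v k - v (Suc k)) *\<^sub>R p (v k)) \<le> norm (v k - v (Suc k)) * (e / (2 * t))"
      proof (rule vector_differentiable_bound_linearization[where S="closed_segment (v (Suc k)) (v k)"])
        show "(P has_vector_derivative p x) (at x within closed_segment (v (Suc k)) (v k))"
          if "x \<in> closed_segment (v (Suc k)) (v k)" for x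
          using has_vector_derivative_within_subset[OF P sub, of x] that sub by blast
        show "norm (p x - p (v k)) \<le> e / (2 * t)" if "x \<in> closed_segment (v (Suc k)) (v k)" for x
        proof -
          have "dist x (v k) < d"
            using that le vS[of k] \<Delta> by (auto simp: closed_segment_eq_real_ivl dist_real_def)
          then show ?thesis
            using bspec[OF bspec[OF d(2), of "v k"], of x] that sub v[of k] k by (auto simp: dist_norm)
        qed
      qed auto
      then show ?thesis using \<Delta> by (simp add: vS)
    qed
    have "P t - P 0 = (\<Sum>k<Suc n. P (v k) - P (v (Suc k)))"
      using \<Delta> by (subst sum_lessThan_telescope') (auto simp: v_def mult.commute)
    then have "norm ((t / Suc n) *\<^sub>R (\<Sum>k<Suc n. p (t - k * t / Suc n)) - (P t - P 0)) =
        norm (\<Sum>k<Suc n. P (v k) - P (v (Suc k)) - \<Delta> *\<^sub>R p (v k))"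
      by (simp add: sum_subtractf scaleR_sum_right \<Delta>_def v_def norm_minus_commute del: sum.lessThan_Suc)
    also have "\<dots> \<le> (\<Sum>k<Suc n. \<Delta> * (e / (2 * t)))"
      by (rule sum_norm_le) (use step in auto)
    also have "\<dots> = (\<Delta> * Suc n) * (e / (2 * t))"
      by simp
    also have "\<dots> = e / 2"
      unfolding \<Delta>(3) using t by simp
    also have "\<dots> < e" using e by simp
    finally show "norm ((t / Suc n) *\<^sub>R (\<Sum>k<Suc n. p (t - k * t / Suc n)) - (P t - P 0)) < e" .
  qed
qed

lemma poisson_pgf:
  fixes z :: complex
  assumes l: "0 < l" and V: "distr M (count_space UNIV) V = measure_pmf (poisson_pmf l)"
    and meas: "V \<in> measurable M (count_space UNIV)" and z: "cmod z \<le> 1"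
  shows "pgf M V z = exp (of_real l * (z - 1))"
proof -
  have "pgf M V z = (\<integral>n. z ^ n \<partial>distr M (count_space UNIV) V)"
    unfolding pgf_def by (rule integral_distr[OF meas, symmetric]) simp
  also have "\<dots> = (\<integral>n. pmf (poisson_pmf l) n *\<^sub>R z ^ n \<partial>count_space UNIV)"
    unfolding V measure_pmf_eq_density by (subst integral_density) auto
  also have "\<dots> = (\<Sum>n. pmf (poisson_pmf l) n *\<^sub>R z ^ n)"
  proof (rule sums_unique)
    have "integrable (measure_pmf (poisson_pmf l)) (\<lambda>n. z ^ n)"
      using z by (intro measure_pmf.integrable_bounded norm_nat_power_le_1) auto
    then have "integrable (count_space UNIV) (\<lambda>n. pmf (poisson_pmf l) n *\<^sub>R z ^ n)"
      unfolding measure_pmf_eq_density by (subst (asm) integrable_density) auto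
    then show "(\<lambda>n. pmf (poisson_pmf l) n *\<^sub>R z ^ n) sums (\<integral>n. pmf (poisson_pmf l) n *\<^sub>R z ^ n \<partial>count_space UNIV)"
      by (rule sums_integral_count_space_nat)
  qed
  also have "(\<lambda>n. pmf (poisson_pmf l) n *\<^sub>R z ^ n) = (\<lambda>n. exp (- of_real l) * (inverse (fact n) *\<^sub>R (of_real l * z) ^ n))"
    using l by (auto simp: fun_eq_iff scaleR_conv_of_real power_mult_distrib exp_of_real[symmetric] field_simps)
  also have "(\<Sum>n. exp (- of_real l) * (inverse (fact n) *\<^sub>R (of_real l * z) ^ n)) = exp (- of_real l) * exp (of_real l * z)"
    unfolding exp_def by (rule suminf_mult) (rule summable_exp_generic)
  also have "\<dots> = exp (of_real l * (z - 1))"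
    by (simp add: exp_add[symmetric] algebra_simps)
  finally show ?thesis .
qed

lemma measurable_map_list:
  fixes f :: "'b \<Rightarrow> 'a \<Rightarrow> 'c::countable"
  assumes "\<And>k. k \<in> set ks \<Longrightarrow> f k \<in> measurable Q (count_space UNIV)"
  shows "(\<lambda>\<omega>. map (\<lambda>k. f k \<omega>) ks) \<in> measurable Q (count_space UNIV)"
  using assms
proof (induction ks)
  case (Cons k ks)
  then have IH: "(\<lambda>\<omega>. map (\<lambda>k. f k \<omega>) ks) \<in> measurable Q (count_space UNIV)"
    and k: "f k \<in> measurable Q (count_space UNIV)" by auto
  have "(\<lambda>\<omega>. x # map (\<lambda>k. f k \<omega>) ks) \<in> measurable Q (count_space UNIV)" for x
    by (rule measurable_compose[OF IH]) simp
  then have "(\<lambda>\<omega>. f k \<omega> # map (\<lambda>k. f k \<omega>) ks) \<in> measurable Q (count_space UNIV)"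
    by (rule measurable_compose_countable[OF _ k])
  then show ?case by simp
qed simp

lemma sum_over_increments:
  fixes a :: "nat \<Rightarrow> nat"
  assumes "\<And>k. k < m \<Longrightarrow> a k \<le> a (Suc k)" "a 0 = 0"
  shows "(\<Sum>k<m. \<Sum>i\<in>{a k..<a (Suc k)}. f i) = (\<Sum>i<a m. f i)"
  using assms
proof (induction m)
  case (Suc m)
  have "{..<a (Suc m)} = {..<a m} \<union> {a m..<a (Suc m)}"
    using Suc.prems(1)[of m] by auto
  moreover have "sum f ({..<a m} \<union> {a m..<a (Suc m)}) = sum f {..<a m} + sum f {a m..<a (Suc m)}"
    by (rule sum.union_disjoint) auto
  ultimately have "(\<Sum>i<a (Suc m). f i) = (\<Sum>i<a m. f i) + (\<Sum>i\<in>{a m..<a (Suc m)}. f i)"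
    by (rule trans[OF arg_cong])
  moreover have "(\<Sum>k<m. \<Sum>i\<in>{a k..<a (Suc k)}. f i) = (\<Sum>i<a m. f i)"
    using Suc.prems by (intro Suc.IH) auto
  ultimately show ?case by (simp only: sum.lessThan_Suc)
qed simp

text \<open>
  Right-continuity of the families makes the discretised sums converge, and their measurability at random
  times makes the limit a random variable.
\<close>

locale immigration = prob_space M for M :: "'a measure" +
  fixes \<theta> :: real and N :: "real \<Rightarrow> 'a \<Rightarrow> nat" and I :: "nat \<Rightarrow> 'a \<Rightarrow> nat"
    and X :: "nat \<Rightarrow> nat \<Rightarrow> real \<Rightarrow> 'a \<Rightarrow> nat"
    and g :: "complex \<Rightarrow> complex" and F :: "real \<Rightarrow> complex \<Rightarrow> complex"
  assumes rate: "\<theta> > 0"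
    and arrivals: "poisson_process M \<theta> N"
    and groups: "\<And>i. has_pgf M (I i) g"
    and families: "\<And>i j t s. 0 \<le> t \<Longrightarrow> cmod s \<le> 1 \<Longrightarrow> pgf M (X i j t) s = F t s"
    and families_right_continuous:
      "\<And>i j. AE \<omega> in M. \<forall>t\<ge>0. \<forall>\<^sub>F t' in at_right t. X i j t' \<omega> = X i j t \<omega>"
    and families_measurable: "\<And>i j \<tau>. \<tau> \<in> borel_measurable M \<Longrightarrow> (\<And>\<omega>. \<omega> \<in> space M \<Longrightarrow> 0 \<le> \<tau> \<omega>) \<Longrightarrow>
        (\<lambda>\<omega>. X i j (\<tau> \<omega>) \<omega>) \<in> measurable M (count_space UNIV)"
    and independent: "indep_sets (source_events M N I X) UNIV"
begin

lemma N_measurable: "0 \<le> t \<Longrightarrow> N t \<in> measurable M (count_space UNIV)"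
  using arrivals by (simp add: poisson_process_def)

lemma I_measurable [measurable]: "I i \<in> measurable M (count_space UNIV)"
  using groups by (simp add: has_pgf_def)

lemma X_measurable: "0 \<le> t \<Longrightarrow> X i j t \<in> measurable M (count_space UNIV)"
  using families_measurable[of "\<lambda>_. t"] by simp

lemma N_0: "\<omega> \<in> space M \<Longrightarrow> N 0 \<omega> = 0"
  using arrivals by (simp add: poisson_process_def)

lemma N_mono: "\<omega> \<in> space M \<Longrightarrow> 0 \<le> r \<Longrightarrow> r \<le> t \<Longrightarrow> N r \<omega> \<le> N t \<omega>"
  using arrivals by (auto simp: poisson_process_def mono_on_def)

lemma N_right_continuous:
  assumes "\<omega> \<in> space M" "0 \<le> t"
  shows "\<forall>\<^sub>F t' in at_right t. N t' \<omega> = N t \<omega>"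
proof -
  have "continuous (at_right t) (\<lambda>t. N t \<omega>)"
    using arrivals assms by (simp add: poisson_process_def)
  then have "((\<lambda>t. N t \<omega>) \<longlongrightarrow> N t \<omega>) (at_right t)"
    by (simp add: continuous_within)
  then show ?thesis by (simp add: tendsto_discrete)
qed

text \<open>
  Right-continuity of \<open>N\<close> makes the infimum in the arrival time a minimum.
\<close>

lemma arrival_time_le_iff:
  assumes \<omega>: "\<omega> \<in> space M" and i: "i < N t \<omega>" and t: "0 \<le> t"
  shows "0 \<le> arrival_time N i \<omega>" and "0 \<le> a \<Longrightarrow> arrival_time N i \<omega> \<le> a \<longleftrightarrow> i < N a \<omega>"
proof -
  define S where "S = {t. 0 \<le> t \<and> i < N t \<omega>}"
  define \<tau> where "\<tau> = arrival_time N i \<omega>"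
  have \<tau>S: "\<tau> = Inf S" by (simp add: \<tau>_def S_def arrival_time_def)
  have ne: "S \<noteq> {}" using i t by (auto simp: S_def)
  have bdd: "bdd_below S" by (rule bdd_belowI[of _ 0]) (simp add: S_def)
  show \<tau>0: "0 \<le> arrival_time N i \<omega>"
    unfolding \<tau>_def[symmetric] \<tau>S using ne by (intro cInf_greatest) (auto simp: S_def)
  have at: "i < N \<tau> \<omega>"
  proof -
    have "\<forall>\<^sub>F t' in at_right \<tau>. N t' \<omega> = N \<tau> \<omega>"
      using N_right_continuous[OF \<omega>] \<tau>0 by (simp add: \<tau>_def)
    then obtain d where d: "\<tau> < d" "\<And>t'. \<tau> < t' \<Longrightarrow> t' < d \<Longrightarrow> N t' \<omega> = N \<tau> \<omega>"
      unfolding eventually_at_right_field by blast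
    obtain t' where "t' \<in> S" "t' < d"
      using d(1) ne bdd unfolding \<tau>S by (auto simp: cInf_less_iff)
    moreover have "\<tau> \<le> t'" unfolding \<tau>S by (rule cInf_lower[OF \<open>t' \<in> S\<close> bdd])
    ultimately show ?thesis
      using d(2)[of t'] by (cases "t' = \<tau>") (auto simp: S_def)
  qed
  show "arrival_time N i \<omega> \<le> a \<longleftrightarrow> i < N a \<omega>" if a: "0 \<le> a"
  proof
    assume "arrival_time N i \<omega> \<le> a"
    then have "N \<tau> \<omega> \<le> N a \<omega>" using \<tau>0 by (intro N_mono \<omega>) (auto simp: \<tau>_def)
    with at show "i < N a \<omega>" by simp
  next
    assume "i < N a \<omega>"
    then have "a \<in> S" using a by (simp add: S_def)
    then show "arrival_time N i \<omega> \<le> a"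
      unfolding \<tau>_def[symmetric] \<tau>S by (rule cInf_lower[OF _ bdd])
  qed
qed

text \<open>
  On the event that group \<open>i\<close> has not arrived by \<open>t\<close>, its arrival time may be replaced by \<open>t\<close>, which makes
  it a random variable.
\<close>

lemma immigration_process_measurable:
  assumes t: "0 \<le> t"
  shows "immigration_process N I X t \<in> measurable M (count_space UNIV)"
proof -
  define \<tau> where "\<tau> i \<omega> = (if i < N t \<omega> then arrival_time N i \<omega> else t)" for i \<omega>
  have \<tau>_range: "0 \<le> \<tau> i \<omega>" "\<tau> i \<omega> \<le> t" if "\<omega> \<in> space M" for i \<omega>
    using arrival_time_le_iff[OF that _ t, of i] t by (auto simp: \<tau>_def)
  have \<tau>m: "\<tau> i \<in> borel_measurable M" for i
    unfolding borel_measurable_iff_le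
  proof
    fix a
    consider "a < 0" | "0 \<le> a" "a < t" | "t \<le> a" by linarith
    then show "{\<omega> \<in> space M. \<tau> i \<omega> \<le> a} \<in> sets M"
    proof cases
      case 1
      have "\<not> \<tau> i \<omega> \<le> a" if "\<omega> \<in> space M" for \<omega>
        using \<tau>_range(1)[OF that, of i] 1 by linarith
      then have "{\<omega> \<in> space M. \<tau> i \<omega> \<le> a} = {}" by auto
      then show ?thesis by (simp only: sets.empty_sets)
    next
      case 2
      have "{\<omega> \<in> space M. \<tau> i \<omega> \<le> a} = {\<omega> \<in> space M. i < N a \<omega>}"
      proof (intro Collect_cong conj_cong refl)
        fix \<omega> assume \<omega>: "\<omega> \<in> space M"
        show "\<tau> i \<omega> \<le> a \<longleftrightarrow> i < N a \<omega>"
        proof (cases "i < N t \<omega>")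
          case True
          then show ?thesis using arrival_time_le_iff(2)[OF \<omega> True t 2(1)] by (simp add: \<tau>_def)
        next
          case False
          then show ?thesis using N_mono[OF \<omega> 2(1), of t] 2(2) by (simp add: \<tau>_def)
        qed
      qed
      also have "\<dots> \<in> sets M"
        using N_measurable[OF 2(1)] by measurable
      finally show ?thesis .
    next
      case 3
      have "\<tau> i \<omega> \<le> a" if "\<omega> \<in> space M" for \<omega>
        using \<tau>_range(2)[OF that, of i] 3 by linarith
      then have "{\<omega> \<in> space M. \<tau> i \<omega> \<le> a} = space M" by auto
      then show ?thesis by simp
    qed
  qed
  have Xm: "(\<lambda>\<omega>. X i j (t - \<tau> i \<omega>) \<omega>) \<in> measurable M (count_space UNIV)" for i j
    using \<tau>m[of i] \<tau>_range by (intro families_measurable) auto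
  have Gm: "(\<lambda>\<omega>. \<Sum>j<I i \<omega>. X i j (t - \<tau> i \<omega>) \<omega>) \<in> measurable M (count_space UNIV)" for i
    by (rule measurable_compose_countable[where f="\<lambda>n \<omega>. \<Sum>j<n. X i j (t - \<tau> i \<omega>) \<omega>"]) (use Xm in measurable)
  have "(\<lambda>\<omega>. \<Sum>i<N t \<omega>. \<Sum>j<I i \<omega>. X i j (t - \<tau> i \<omega>) \<omega>) \<in> measurable M (count_space UNIV)"
    by (rule measurable_compose_countable[where f="\<lambda>n \<omega>. \<Sum>i<n. \<Sum>j<I i \<omega>. X i j (t - \<tau> i \<omega>) \<omega>"])
      (use Gm N_measurable[OF t] in measurable)
  also have "(\<lambda>\<omega>. \<Sum>i<N t \<omega>. \<Sum>j<I i \<omega>. X i j (t - \<tau> i \<omega>) \<omega>) = immigration_process N I X t"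
    by (auto simp: fun_eq_iff immigration_process_def \<tau>_def intro!: sum.cong)
  finally show ?thesis .
qed

definition grid :: "real \<Rightarrow> nat \<Rightarrow> nat \<Rightarrow> real" where
  "grid t m k = real k * t / real m"

text \<open>
  Everything the discretised process uses, source by source.  All values are lists of natural numbers, so
  that the sources form one independent family with a countable common range; the Poisson counts are
  taken at the \<open>m + 1\<close> grid points, the families only at times elapsed since the \<open>m\<close> left end points.
\<close>

definition observed :: "real \<Rightarrow> nat \<Rightarrow> source \<Rightarrow> 'a \<Rightarrow> nat list" where
  "observed t m x \<omega> = (case x of
      Arrivals \<Rightarrow> map (\<lambda>k. N (grid t m k) \<omega>) [0..<Suc m]
    | Group i \<Rightarrow> [I i \<omega>]
    | Family i j \<Rightarrow> map (\<lambda>k. X i j (t - grid t m k) \<omega>) [0..<m])"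

lemma grid_range:
  assumes "0 \<le> t" "k \<le> m"
  shows "0 \<le> grid t m k" "grid t m k \<le> t"
proof -
  show "0 \<le> grid t m k" using assms by (simp add: grid_def)
  show "grid t m k \<le> t"
  proof (cases "m = 0")
    case False
    have "real k * t \<le> real m * t" using assms by (intro mult_right_mono) auto
    then show ?thesis using False by (simp add: grid_def divide_le_eq mult.commute)
  qed (use assms in \<open>simp add: grid_def\<close>)
qed

lemma process_map_events:
  assumes V: "\<And>k. k \<in> set ks \<Longrightarrow> 0 \<le> r k"
  shows "{(\<lambda>\<omega>. map (\<lambda>k. V (r k) \<omega>) ks) -` A \<inter> space M | A. A \<in> sets (count_space UNIV)} \<subseteq> process_events M V"
proof safe
  fix A :: "nat list set"
  define Q where "Q = sigma (space M) {V t -` S \<inter> space M | t S. 0 \<le> t}"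
  have Q: "space Q = space M" "sets Q = process_events M V"
    by (auto simp: Q_def process_events_def space_measure_of_conv intro!: sets_measure_of)
  have "V (r k) \<in> measurable Q (count_space UNIV)" if "k \<in> set ks" for k
  proof (rule measurableI)
    fix S :: "nat set"
    show "V (r k) -` S \<inter> space Q \<in> sets Q"
      unfolding Q process_events_def using V[OF that] by (intro sigma_sets.Basic) auto
  qed simp
  then have "(\<lambda>\<omega>. map (\<lambda>k. V (r k) \<omega>) ks) \<in> measurable Q (count_space UNIV)"
    by (rule measurable_map_list)
  from measurable_sets[OF this, of A]
  show "(\<lambda>\<omega>. map (\<lambda>k. V (r k) \<omega>) ks) -` A \<inter> space M \<in> process_events M V"
    by (simp add: Q)
qed

lemma indep_vars_observed:
  assumes t: "0 \<le> t"
  shows "indep_vars (\<lambda>_. count_space UNIV) (observed t m) UNIV"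
  unfolding indep_vars_def2
proof (intro conjI ballI)
  fix x
  show "observed t m x \<in> measurable M (count_space UNIV)"
    unfolding observed_def[abs_def]
    by (cases x) (auto intro!: measurable_map_list N_measurable X_measurable grid_range t simp: less_Suc_eq_le
        simp del: upt_Suc intro: measurable_compose[OF I_measurable])
next
  show "indep_sets (\<lambda>x. {observed t m x -` A \<inter> space M | A. A \<in> sets (count_space UNIV)}) UNIV"
  proof (rule indep_sets_mono_sets[OF independent])
    fix x
    show "{observed t m x -` A \<inter> space M | A. A \<in> sets (count_space UNIV)} \<subseteq> source_events M N I X x"
    proof (cases x)
      case Arrivals
      have obs: "observed t m x = (\<lambda>\<omega>. map (\<lambda>k. N (grid t m k) \<omega>) [0..<Suc m])"
        by (simp only: Arrivals observed_def[abs_def] source.case)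
      show ?thesis
        unfolding obs unfolding Arrivals source_events.simps
        by (rule process_map_events) (auto intro: grid_range(1)[OF t] simp: less_Suc_eq_le simp del: upt_Suc)
    next
      case (Group i)
      have eq: "observed t m (Group i) -` A \<inter> space M = I i -` {n. [n] \<in> A} \<inter> space M" for A
        by (auto simp: observed_def)
      show ?thesis
        unfolding Group source_events.simps eq by blast
    next
      case (Family i j)
      have obs: "observed t m x = (\<lambda>\<omega>. map (\<lambda>k. X i j (t - grid t m k) \<omega>) [0..<m])"
        by (simp only: Family observed_def[abs_def] source.case)
      show ?thesis
        unfolding obs unfolding Family source_events.simps
        by (rule process_map_events[where r="\<lambda>k. t - grid t m k"]) (auto simp: grid_range(2)[OF t])
    qed
  qed
qed

lemma observed_nth:
  "k \<le> m \<Longrightarrow> observed t m Arrivals \<omega> ! k = N (grid t m k) \<omega>"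
  "hd (observed t m (Group i) \<omega>) = I i \<omega>"
  "k < m \<Longrightarrow> observed t m (Family i j) \<omega> ! k = X i j (t - grid t m k) \<omega>"
  by (simp_all add: observed_def less_Suc_eq_le del: upt_Suc)

text \<open>
  Group \<open>i\<close> is treated as if it had arrived at grid point \<open>k\<close>.
\<close>

definition group_descendants :: "real \<Rightarrow> nat \<Rightarrow> nat \<Rightarrow> nat \<Rightarrow> 'a \<Rightarrow> nat" where
  "group_descendants t m k i \<omega> = (\<Sum>j<I i \<omega>. X i j (t - grid t m k) \<omega>)"

lemma norm_F_le_1: "0 \<le> v \<Longrightarrow> cmod s \<le> 1 \<Longrightarrow> cmod (F v s) \<le> 1"
  using norm_pgf_le_1[OF X_measurable, of v s 0 0] by (simp add: families)

lemma pgf_I: "cmod s \<le> 1 \<Longrightarrow> pgf M (I i) s = g s"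
  using groups by (simp add: has_pgf_def)

lemma norm_g_le_1: "cmod s \<le> 1 \<Longrightarrow> cmod (g s) \<le> 1"
  using norm_pgf_le_1[OF I_measurable, of s 0] by (simp add: pgf_I)

lemma pgf_group_descendants:
  assumes t: "0 \<le> t" and s: "cmod s \<le> 1" and k: "k < m"
  shows "pgf M (group_descendants t m k i) s = g (F (t - grid t m k) s)"
proof -
  have v: "0 \<le> t - grid t m k" using grid_range(2)[OF t, of k m] k by simp
  define f where "f = case_nat (Group i) (Family i)"
  define Y :: "nat \<Rightarrow> nat list \<Rightarrow> nat" where "Y = case_nat hd (\<lambda>_ l. l ! k)"
  have "inj f" by (auto simp: inj_def f_def split: nat.splits)
  from indep_vars_reindex[OF indep_vars_observed[OF t] this]
  have "indep_vars (\<lambda>_. count_space UNIV) (\<lambda>n. observed t m (f n)) UNIV" .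
  then have "indep_vars (\<lambda>_. count_space UNIV) (\<lambda>n \<omega>. Y n (observed t m (f n) \<omega>)) UNIV"
    by (rule indep_vars_compose2) simp
  also have "(\<lambda>n \<omega>. Y n (observed t m (f n) \<omega>)) = case_nat (I i) (\<lambda>j. X i j (t - grid t m k))"
    using k by (auto simp: fun_eq_iff Y_def f_def observed_nth split: nat.split)
  finally have "pgf M (\<lambda>\<omega>. \<Sum>j<I i \<omega>. X i j (t - grid t m k) \<omega>) s = pgf M (I i) (F (t - grid t m k) s)"
    by (rule pgf_random_sum) (auto intro: families v s)
  then show ?thesis
    using norm_F_le_1[OF v s] by (simp add: pgf_I group_descendants_def[abs_def])
qed

lemma pgf_arrivals:
  assumes r: "0 \<le> r" "r < t" and z: "cmod z \<le> 1"
  shows "pgf M (\<lambda>\<omega>. N t \<omega> - N r \<omega>) z = exp (of_real (\<theta> * (t - r)) * (z - 1))"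
proof (rule poisson_pgf)
  show "0 < \<theta> * (t - r)" using rate r by simp
  show "distr M (count_space UNIV) (\<lambda>\<omega>. N t \<omega> - N r \<omega>) = measure_pmf (poisson_pmf (\<theta> * (t - r)))"
    using arrivals r by (auto simp: poisson_process_def)
  show "(\<lambda>\<omega>. N t \<omega> - N r \<omega>) \<in> measurable M (count_space UNIV)"
  proof -
    have [measurable]: "N t \<in> measurable M (count_space UNIV)" "N r \<in> measurable M (count_space UNIV)"
      using r by (auto intro: N_measurable)
    show ?thesis by measurable
  qed
qed fact

text \<open>
  The grid with a single interval already contains the count \<open>N t\<close> and the group sizes.
\<close>

lemma pgf_compound_poisson:
  assumes t: "0 \<le> t" and s: "cmod s \<le> 1"
  shows "pgf M (\<lambda>\<omega>. \<Sum>i<N t \<omega>. I i \<omega>) s = exp (of_real (\<theta> * t) * (g s - 1))"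
proof -
  define f where "f = case_nat Arrivals Group"
  define Y :: "nat \<Rightarrow> nat list \<Rightarrow> nat" where "Y = case_nat (\<lambda>l. l ! 1) (\<lambda>_. hd)"
  have "inj f" by (auto simp: inj_def f_def split: nat.splits)
  from indep_vars_reindex[OF indep_vars_observed[OF t] this]
  have "indep_vars (\<lambda>_. count_space UNIV) (\<lambda>n. observed t 1 (f n)) UNIV" .
  then have "indep_vars (\<lambda>_. count_space UNIV) (\<lambda>n \<omega>. Y n (observed t 1 (f n) \<omega>)) UNIV"
    by (rule indep_vars_compose2) simp
  also have "(\<lambda>n \<omega>. Y n (observed t 1 (f n) \<omega>)) = case_nat (N t) I"
    by (auto simp: fun_eq_iff Y_def f_def observed_nth(2) observed_nth(1)[of 1 1, simplified] grid_def split: nat.split)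
  finally have "pgf M (\<lambda>\<omega>. \<Sum>i<N t \<omega>. I i \<omega>) s = pgf M (N t) (g s)"
    by (rule pgf_random_sum) (auto intro: pgf_I s)
  also have "\<dots> = exp (of_real (\<theta> * t) * (g s - 1))"
  proof (cases "t = 0")
    case True
    have "pgf M (N 0) (g s) = (LINT \<omega>|M. 1)"
      unfolding pgf_def by (intro Bochner_Integration.integral_cong) (auto simp: N_0)
    then show ?thesis using True by (simp add: prob_space)
  next
    case False
    have "pgf M (N t) (g s) = pgf M (\<lambda>\<omega>. N t \<omega> - N 0 \<omega>) (g s)"
      unfolding pgf_def by (intro Bochner_Integration.integral_cong) (auto simp: N_0)
    also have "\<dots> = exp (of_real (\<theta> * (t - 0)) * (g s - 1))"
      using False t by (intro pgf_arrivals norm_g_le_1 s) auto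
    finally show ?thesis by simp
  qed
  finally show ?thesis .
qed

text \<open>
  Here \<open>a k\<close> is a fixed number of groups arrived by grid point \<open>k\<close>.  By monotonicity the intervals
  \<open>[a k, a (k + 1))\<close> are disjoint, so different summands involve different groups and are independent.
\<close>

lemma pgf_fixed_arrivals:
  assumes t: "0 \<le> t" and s: "cmod s \<le> 1" and a: "\<And>k l. k \<le> l \<Longrightarrow> l \<le> m \<Longrightarrow> a k \<le> a l"
  shows "pgf M (\<lambda>\<omega>. \<Sum>k<m. \<Sum>i\<in>{a k..<a (Suc k)}. group_descendants t m k i \<omega>) s =
    (\<Prod>k<m. g (F (t - grid t m k) s) ^ (a (Suc k) - a k))"
proof -
  define P where "P = Sigma {..<m} (\<lambda>k. {a k..<a (Suc k)})"
  have fin: "finite P" by (simp add: P_def)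
  have inj: "k = k'" if "(k, i) \<in> P" "(k', i) \<in> P" for k k' i
  proof (rule ccontr)
    assume "k \<noteq> k'"
    then consider "k < k'" | "k' < k" by linarith
    then show False
      using that a[of "Suc k" k'] a[of "Suc k'" k] by cases (auto simp: P_def)
  qed
  define G where "G = (\<lambda>(k :: nat, i). insert (Group i) (range (Family i)))"
  define Y :: "nat \<times> nat \<Rightarrow> (source \<Rightarrow> nat list) \<Rightarrow> complex" where
    "Y = (\<lambda>(k, i) w. s ^ (\<Sum>j<hd (w (Group i)). w (Family i j) ! k))"
  have "indep_vars (\<lambda>p. PiM (G p) (\<lambda>_. count_space UNIV)) (\<lambda>p \<omega>. restrict (\<lambda>x. observed t m x \<omega>) (G p)) P"
  proof (rule indep_vars_restrict[OF indep_vars_observed[OF t]])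
    show "disjoint_family_on G P"
      unfolding disjoint_family_on_def
    proof (intro ballI impI)
      fix p q assume pq: "p \<in> P" "q \<in> P" "p \<noteq> q"
      then have "snd p \<noteq> snd q" using inj by (metis prod.collapse)
      then show "G p \<inter> G q = {}" by (auto simp: G_def split: prod.splits)
    qed
  qed simp
  then have "indep_vars (\<lambda>_. borel) (\<lambda>p \<omega>. Y p (restrict (\<lambda>x. observed t m x \<omega>) (G p))) P"
  proof (rule indep_vars_compose2)
    fix p :: "nat \<times> nat"
    obtain k i where p: "p = (k, i)" by (cases p)
    let ?Q = "PiM (G p) (\<lambda>_. count_space UNIV) :: (source \<Rightarrow> nat list) measure"
    have c: "(\<lambda>w. w x) \<in> measurable ?Q (count_space UNIV)" if "x \<in> G p" for x
      using that by (rule measurable_component_singleton)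
    have 1: "(\<lambda>w. hd (w (Group i))) \<in> measurable ?Q (count_space UNIV)"
      by (rule measurable_compose[OF c]) (simp_all add: p G_def)
    have 2: "(\<lambda>w. w (Family i j) ! k) \<in> measurable ?Q (count_space UNIV)" for j
      by (rule measurable_compose[OF c]) (simp_all add: p G_def)
    have "(\<lambda>w. \<Sum>j<hd (w (Group i)). w (Family i j) ! k) \<in> measurable ?Q (count_space UNIV)"
      by (rule measurable_compose_countable[OF _ 1]) (use 2 in measurable)
    then show "Y p \<in> borel_measurable ?Q"
      unfolding Y_def p by simp
  qed
  then have ind: "indep_vars (\<lambda>_. borel) (\<lambda>p \<omega>. s ^ group_descendants t m (fst p) (snd p) \<omega>) P"
    by (rule iffD1[OF indep_vars_cong[OF refl _ refl], rotated])
      (auto simp: Y_def G_def P_def observed_nth group_descendants_def fun_eq_iff)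
  have meas: "(\<lambda>\<omega>. s ^ group_descendants t m (fst p) (snd p) \<omega>) \<in> borel_measurable M" if "p \<in> P" for p
    using ind that by (auto simp: indep_vars_def)
  have "pgf M (\<lambda>\<omega>. \<Sum>k<m. \<Sum>i\<in>{a k..<a (Suc k)}. group_descendants t m k i \<omega>) s =
      expectation (\<lambda>\<omega>. \<Prod>p\<in>P. s ^ group_descendants t m (fst p) (snd p) \<omega>)"
    unfolding pgf_def P_def by (simp add: sum.Sigma power_sum case_prod_unfold)
  also have "\<dots> = (\<Prod>p\<in>P. expectation (\<lambda>\<omega>. s ^ group_descendants t m (fst p) (snd p) \<omega>))"
    by (rule indep_vars_lebesgue_integral[OF fin ind]) (intro integrable_bounded meas norm_nat_power_le_1 s)
  also have "\<dots> = (\<Prod>p\<in>P. g (F (t - grid t m (fst p)) s))"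
    by (intro prod.cong refl) (auto simp: P_def pgf_group_descendants[OF t s] pgf_def[symmetric])
  also have "\<dots> = (\<Prod>k<m. \<Prod>i\<in>{a k..<a (Suc k)}. g (F (t - grid t m k) s))"
    unfolding P_def by (subst prod.Sigma) (auto simp: case_prod_unfold)
  also have "\<dots> = (\<Prod>k<m. g (F (t - grid t m k) s) ^ (a (Suc k) - a k))"
    by simp
  finally show ?thesis .
qed

definition discretised :: "real \<Rightarrow> nat \<Rightarrow> 'a \<Rightarrow> nat" where
  "discretised t m \<omega> =
     (\<Sum>k<m. \<Sum>i\<in>{N (grid t m k) \<omega>..<N (grid t m (Suc k)) \<omega>}. group_descendants t m k i \<omega>)"

lemma grid_mono: "0 \<le> t \<Longrightarrow> k \<le> l \<Longrightarrow> grid t m k \<le> grid t m l"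
  by (simp add: grid_def divide_right_mono mult_right_mono)

text \<open>
  Freezing the Poisson counts leaves a product over the intervals of \<open>g(F) ^ (N\<^sub>k\<^sub>+\<^sub>1 - N\<^sub>k)\<close>, and the
  increments are independent Poisson variables.
\<close>

lemma pgf_discretised:
  assumes t: "0 < t" and m: "0 < m" and s: "cmod s \<le> 1"
  shows "pgf M (discretised t m) s =
    exp (of_real (\<theta> * (t / m)) * (\<Sum>k<m. g (F (t - grid t m k) s) - 1))"
proof -
  have t0: "0 \<le> t" using t by simp
  define W where "W = observed t m"
  define B where "B = - {Arrivals}"
  define \<phi> :: "nat list \<Rightarrow> (source \<Rightarrow> nat list) \<Rightarrow> complex" where
    "\<phi> l w = s ^ (\<Sum>k<m. \<Sum>i\<in>{l ! k..<l ! Suc k}. \<Sum>j<hd (w (Group i)). w (Family i j) ! k)" for l w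
  define y where "y k = g (F (t - grid t m k) s)" for k
  have y: "cmod (y k) \<le> 1" if "k < m" for k
    unfolding y_def using grid_range(2)[OF t0, of k m] that by (intro norm_g_le_1 norm_F_le_1 s) auto
  let ?A = "\<lambda>\<omega>. restrict (\<lambda>x. W x \<omega>) {Arrivals}" and ?B = "\<lambda>\<omega>. restrict (\<lambda>x. W x \<omega>) B"
  have ind: "indep_var (PiM {Arrivals} (\<lambda>_. count_space UNIV)) ?A (PiM B (\<lambda>_. count_space UNIV)) ?B"
    unfolding W_def by (rule indep_var_restrict[OF indep_vars_observed[OF t0]]) (auto simp: B_def)
  have \<phi>m: "\<phi> l \<in> borel_measurable (PiM B (\<lambda>_. count_space UNIV))" for l
  proof -
    let ?Q = "PiM B (\<lambda>_. count_space UNIV) :: (source \<Rightarrow> nat list) measure"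
    have c: "(\<lambda>w. w x) \<in> measurable ?Q (count_space UNIV)" if "x \<in> B" for x
      using that by (rule measurable_component_singleton)
    have 1: "(\<lambda>w. hd (w (Group i))) \<in> measurable ?Q (count_space UNIV)" for i
      by (rule measurable_compose[OF c]) (simp_all add: B_def)
    have 2: "(\<lambda>w. w (Family i j) ! k) \<in> measurable ?Q (count_space UNIV)" for i j k
      by (rule measurable_compose[OF c]) (simp_all add: B_def)
    have "(\<lambda>w. \<Sum>j<hd (w (Group i)). w (Family i j) ! k) \<in> measurable ?Q (count_space UNIV)" for i k
      by (rule measurable_compose_countable[OF _ 1]) (use 2 in measurable)
    then have "(\<lambda>w. \<Sum>k<m. \<Sum>i\<in>{l ! k..<l ! Suc k}. \<Sum>j<hd (w (Group i)). w (Family i j) ! k) \<in> measurable ?Q (count_space UNIV)"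
      by measurable
    then show ?thesis unfolding \<phi>_def[abs_def] by (rule measurable_nat_power)
  qed
  have \<phi>W: "\<phi> l (?B \<omega>) = s ^ (\<Sum>k<m. \<Sum>i\<in>{l ! k..<l ! Suc k}. group_descendants t m k i \<omega>)" for l \<omega>
    unfolding \<phi>_def by (intro arg_cong[where f="\<lambda>n. s ^ n"] sum.cong refl)
      (auto simp: B_def W_def observed_nth group_descendants_def)
  have Wk: "W Arrivals \<omega> ! k = N (grid t m k) \<omega>" if "k \<le> m" for k \<omega>
    using that by (simp add: W_def observed_nth)
  have "pgf M (discretised t m) s = expectation (\<lambda>\<omega>. \<phi> (?A \<omega> Arrivals) (?B \<omega>))"
    unfolding pgf_def \<phi>W discretised_def
    by (intro Bochner_Integration.integral_cong refl arg_cong[where f="\<lambda>n. s ^ n"] sum.cong) (auto simp: Wk)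
  also have "\<dots> = expectation (\<lambda>\<omega>. expectation (\<lambda>\<omega>'. \<phi> (?A \<omega> Arrivals) (?B \<omega>')))"
  proof (rule expectation_random_index[OF ind _ \<phi>m])
    show "(\<lambda>w. w Arrivals) \<in> measurable (PiM {Arrivals} (\<lambda>_. count_space UNIV)) (count_space UNIV)"
      by (rule measurable_component_singleton) simp
    show "norm (\<phi> l w) \<le> 1" for l w
      unfolding \<phi>_def by (intro norm_nat_power_le_1 s)
  qed
  also have "\<dots> = expectation (\<lambda>\<omega>. \<Prod>k<m. y k ^ (N (grid t m (Suc k)) \<omega> - N (grid t m k) \<omega>))"
  proof (intro Bochner_Integration.integral_cong refl)
    fix \<omega> assume \<omega>: "\<omega> \<in> space M"
    have "expectation (\<lambda>\<omega>'. \<phi> (?A \<omega> Arrivals) (?B \<omega>')) =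
        pgf M (\<lambda>\<omega>'. \<Sum>k<m. \<Sum>i\<in>{W Arrivals \<omega> ! k..<W Arrivals \<omega> ! Suc k}. group_descendants t m k i \<omega>') s"
      unfolding pgf_def \<phi>W by simp
    also have "\<dots> = (\<Prod>k<m. y k ^ (W Arrivals \<omega> ! Suc k - W Arrivals \<omega> ! k))"
      unfolding y_def
    proof (rule pgf_fixed_arrivals[OF t0 s])
      fix k l assume "k \<le> l" "l \<le> m"
      then show "W Arrivals \<omega> ! k \<le> W Arrivals \<omega> ! l"
        using grid_mono[OF t0, of k l m] grid_range(1)[OF t0, of k m] by (auto simp: Wk intro!: N_mono \<omega>)
    qed
    also have "\<dots> = (\<Prod>k<m. y k ^ (N (grid t m (Suc k)) \<omega> - N (grid t m k) \<omega>))"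
      by (intro prod.cong refl) (auto simp: Wk)
    finally show "expectation (\<lambda>\<omega>'. \<phi> (?A \<omega> Arrivals) (?B \<omega>')) =
      (\<Prod>k<m. y k ^ (N (grid t m (Suc k)) \<omega> - N (grid t m k) \<omega>))" .
  qed
  also have "\<dots> = (\<Prod>k<m. expectation (\<lambda>\<omega>. y k ^ (N (grid t m (Suc k)) \<omega> - N (grid t m k) \<omega>)))"
  proof (rule indep_vars_lebesgue_integral)
    have inc: "indep_vars (\<lambda>_. count_space UNIV) (\<lambda>k \<omega>. N (grid t m (Suc k)) \<omega> - N (grid t m k) \<omega>) {..<m}"
    proof -
      have "mono (grid t m)" by (intro monoI grid_mono t0)
      moreover have "0 \<le> grid t m 0" by (simp add: grid_def)
      ultimately show ?thesis
        using arrivals unfolding poisson_process_def by blast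
    qed
    then show "indep_vars (\<lambda>_. borel) (\<lambda>k \<omega>. y k ^ (N (grid t m (Suc k)) \<omega> - N (grid t m k) \<omega>)) {..<m}"
      by (rule indep_vars_compose2[where Y="\<lambda>k n. y k ^ n"]) simp
    show "integrable M (\<lambda>\<omega>. y k ^ (N (grid t m (Suc k)) \<omega> - N (grid t m k) \<omega>))" if "k \<in> {..<m}" for k
      using inc that y by (intro integrable_bounded measurable_nat_power norm_nat_power_le_1) (auto simp: indep_vars_def)
  qed simp
  also have "\<dots> = (\<Prod>k<m. exp (of_real (\<theta> * (t / m)) * (y k - 1)))"
  proof (intro prod.cong refl)
    fix k assume k: "k \<in> {..<m}"
    have d: "grid t m (Suc k) - grid t m k = t / m"
      by (simp add: grid_def add_divide_distrib distrib_right)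
    have "0 < t / m" using t m by simp
    with d have lt: "grid t m k < grid t m (Suc k)" by linarith
    have ge: "0 \<le> grid t m k"
      using k by (intro grid_range t0) auto
    show "expectation (\<lambda>\<omega>. y k ^ (N (grid t m (Suc k)) \<omega> - N (grid t m k) \<omega>)) = exp (of_real (\<theta> * (t / m)) * (y k - 1))"
      using pgf_arrivals[OF ge lt y, of k] k by (simp add: pgf_def d)
  qed
  also have "\<dots> = exp (\<Sum>k<m. of_real (\<theta> * (t / m)) * (y k - 1))"
    by (rule exp_sum[symmetric]) simp
  also have "\<dots> = exp (of_real (\<theta> * (t / m)) * (\<Sum>k<m. y k - 1))"
    by (simp add: sum_distrib_left)
  finally show ?thesis by (simp add: y_def)
qed

text \<open>
  The discretisation starts every group at most \<open>t/m\<close> too early.  For large \<open>m\<close> this advance is too short for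
  any of the finitely many families present to change, by their right-continuity.
\<close>

lemma discretised_eventually_eq:
  assumes t: "0 \<le> t" and \<omega>: "\<omega> \<in> space M"
    and rc: "\<And>i j v. 0 \<le> v \<Longrightarrow> \<forall>\<^sub>F v' in at_right v. X i j v' \<omega> = X i j v \<omega>"
  shows "\<forall>\<^sub>F n in sequentially. discretised t (Suc n) \<omega> = immigration_process N I X t \<omega>"
proof -
  define \<tau> where "\<tau> i = arrival_time N i \<omega>" for i
  have \<tau>: "0 \<le> \<tau> i" "\<tau> i \<le> t" if "i < N t \<omega>" for i
    using arrival_time_le_iff(1)[OF \<omega> that t] arrival_time_le_iff(2)[OF \<omega> that t t] that by (auto simp: \<tau>_def)
  have "\<forall>\<^sub>F e in at_right 0. \<forall>i\<in>{..<N t \<omega>}. \<forall>j\<in>{..<I i \<omega>}. X i j (t - \<tau> i + e) \<omega> = X i j (t - \<tau> i) \<omega>"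
  proof (intro eventually_ball_finite finite_lessThan ballI)
    fix i j assume "i \<in> {..<N t \<omega>}"
    then have "\<forall>\<^sub>F v' in at_right (t - \<tau> i). X i j v' \<omega> = X i j (t - \<tau> i) \<omega>"
      using \<tau>[of i] by (intro rc) auto
    then show "\<forall>\<^sub>F e in at_right 0. X i j (t - \<tau> i + e) \<omega> = X i j (t - \<tau> i) \<omega>"
      by (subst (asm) eventually_at_right_to_0) (simp add: add.commute)
  qed
  then obtain d where d: "0 < d"
    "\<And>e i j. 0 < e \<Longrightarrow> e < d \<Longrightarrow> i < N t \<omega> \<Longrightarrow> j < I i \<omega> \<Longrightarrow> X i j (t - \<tau> i + e) \<omega> = X i j (t - \<tau> i) \<omega>"
    unfolding eventually_at_right_field by auto
  have "(\<lambda>n. t / Suc n) \<longlonglongrightarrow> 0"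
    using LIMSEQ_Suc[OF lim_const_over_n[of t]] by simp
  then have "\<forall>\<^sub>F n in sequentially. t / Suc n < d"
    using d(1) by (rule order_tendstoD)
  then show ?thesis
  proof eventually_elim
    case (elim n)
    define m where "m = Suc n"
    define a where "a k = N (grid t m k) \<omega>" for k
    have a_mono: "a k \<le> a l" if "k \<le> l" "l \<le> m" for k l
      unfolding a_def using that grid_range(1)[OF t, of k m] by (intro N_mono \<omega> grid_mono t) auto
    have a0: "a 0 = 0" by (simp add: a_def grid_def N_0 \<omega>)
    have am: "a m = N t \<omega>" by (simp add: a_def grid_def m_def)
    have "discretised t m \<omega> = (\<Sum>k<m. \<Sum>i\<in>{a k..<a (Suc k)}. \<Sum>j<I i \<omega>. X i j (t - \<tau> i) \<omega>)"
      unfolding discretised_def a_def[symmetric] group_descendants_def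
    proof (intro sum.cong refl)
      fix k i j assume k: "k \<in> {..<m}" and i: "i \<in> {a k..<a (Suc k)}" and j: "j \<in> {..<I i \<omega>}"
      have "a (Suc k) \<le> N t \<omega>" using k by (subst am[symmetric]) (intro a_mono, auto)
      then have iN: "i < N t \<omega>" using i by simp
      have g0: "0 \<le> grid t m k" "0 \<le> grid t m (Suc k)"
        using k by (auto intro!: grid_range(1) t)
      have 1: "\<tau> i \<le> grid t m (Suc k)"
        using arrival_time_le_iff(2)[OF \<omega> iN t g0(2)] i by (simp add: \<tau>_def a_def)
      have 2: "grid t m k < \<tau> i"
        using arrival_time_le_iff(2)[OF \<omega> iN t g0(1)] i by (simp add: \<tau>_def a_def not_le[symmetric])
      have "grid t m (Suc k) - grid t m k = t / m"
        by (simp add: grid_def add_divide_distrib distrib_right)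
      then have "\<tau> i - grid t m k < d"
        using 1 elim by (simp add: m_def)
      from d(2)[OF _ this iN, of j] 2 j
      show "X i j (t - grid t m k) \<omega> = X i j (t - \<tau> i) \<omega>" by simp
    qed
    also have "\<dots> = (\<Sum>i<a m. \<Sum>j<I i \<omega>. X i j (t - \<tau> i) \<omega>)"
      by (rule sum_over_increments) (auto intro: a_mono a0)
    also have "\<dots> = immigration_process N I X t \<omega>"
      by (simp add: am immigration_process_def \<tau>_def)
    finally show ?case by (simp add: m_def)
  qed
qed

lemma discretised_measurable:
  assumes t: "0 \<le> t"
  shows "discretised t m \<in> measurable M (count_space UNIV)"
proof -
  have Xm: "X i j (t - grid t m k) \<in> measurable M (count_space UNIV)" if "k < m" for i j k
    using grid_range(2)[OF t, of k m] that by (intro X_measurable) auto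
  have gm: "group_descendants t m k i \<in> measurable M (count_space UNIV)" if "k < m" for k i
    unfolding group_descendants_def[abs_def]
    by (rule measurable_compose_countable[where f="\<lambda>n \<omega>. \<Sum>j<n. X i j (t - grid t m k) \<omega>"])
      (use Xm[OF that] in measurable)
  have Nm: "N (grid t m k) \<in> measurable M (count_space UNIV)" if "k \<le> m" for k
    using that by (intro N_measurable grid_range t)
  have "(\<lambda>\<omega>. \<Sum>i\<in>{N (grid t m k) \<omega>..<N (grid t m (Suc k)) \<omega>}. group_descendants t m k i \<omega>)
      \<in> measurable M (count_space UNIV)" if k: "k < m" for k
  proof (rule measurable_compose_countable[where f="\<lambda>x \<omega>. \<Sum>i\<in>{x..<N (grid t m (Suc k)) \<omega>}. group_descendants t m k i \<omega>"])
    have N1: "N (grid t m (Suc k)) \<in> measurable M (count_space UNIV)"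
      using k by (intro Nm) auto
    show "(\<lambda>\<omega>. \<Sum>i\<in>{x..<N (grid t m (Suc k)) \<omega>}. group_descendants t m k i \<omega>) \<in> measurable M (count_space UNIV)" for x
      by (rule measurable_compose_countable[OF _ N1, where f="\<lambda>y \<omega>. \<Sum>i\<in>{x..<y}. group_descendants t m k i \<omega>"])
        (use gm[OF k] in measurable)
  qed (use Nm k in simp)
  then show ?thesis
    unfolding discretised_def[abs_def] by measurable
qed

lemma pgf_immigration:
  assumes t: "0 < t" and s: "cmod s \<le> 1"
    and P: "\<And>v. v \<in> {0..t} \<Longrightarrow> (P has_vector_derivative (1 - g (F v s))) (at v within {0..t})"
    and cont: "continuous_on {0..t} (\<lambda>v. 1 - g (F v s))"
  shows "pgf M (immigration_process N I X t) s = exp (- of_real \<theta> * (P t - P 0))"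
proof (rule LIMSEQ_unique)
  have [measurable]: "immigration_process N I X t \<in> measurable M (count_space UNIV)"
    "discretised t n \<in> measurable M (count_space UNIV)" for n
    using t by (auto intro: immigration_process_measurable discretised_measurable)
  show "(\<lambda>n. pgf M (discretised t (Suc n)) s) \<longlonglongrightarrow> pgf M (immigration_process N I X t) s"
    unfolding pgf_def
  proof (rule integral_dominated_convergence[where w="\<lambda>_. 1"])
    have "AE \<omega> in M. \<forall>i j. \<forall>v\<ge>0. \<forall>\<^sub>F v' in at_right v. X i j v' \<omega> = X i j v \<omega>"
      unfolding AE_all_countable using families_right_continuous by blast
    then show "AE \<omega> in M. (\<lambda>n. s ^ discretised t (Suc n) \<omega>) \<longlonglongrightarrow> s ^ immigration_process N I X t \<omega>"
      using AE_space
    proof eventually_elim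
      case (elim \<omega>)
      have "\<forall>\<^sub>F n in sequentially. discretised t (Suc n) \<omega> = immigration_process N I X t \<omega>"
        using elim t by (intro discretised_eventually_eq) auto
      then show ?case
        by (intro tendsto_eventually) (auto elim: eventually_mono)
    qed
    show "AE \<omega> in M. norm (s ^ discretised t (Suc n) \<omega>) \<le> 1" for n
      by (intro AE_I2 norm_nat_power_le_1 s)
  qed auto
  have "(\<lambda>n. (t / Suc n) *\<^sub>R (\<Sum>k<Suc n. 1 - g (F (t - k * t / Suc n) s))) \<longlonglongrightarrow> P t - P 0"
    by (rule riemann_sum_tendsto[OF t P cont])
  then have "(\<lambda>n. exp (- of_real \<theta> * ((t / Suc n) *\<^sub>R (\<Sum>k<Suc n. 1 - g (F (t - k * t / Suc n) s)))))
      \<longlonglongrightarrow> exp (- of_real \<theta> * (P t - P 0))"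
    by (intro tendsto_intros)
  also have "(\<lambda>n. exp (- of_real \<theta> * ((t / Suc n) *\<^sub>R (\<Sum>k<Suc n. 1 - g (F (t - k * t / Suc n) s))))) =
      (\<lambda>n. pgf M (discretised t (Suc n)) s)"
  proof
    fix n
    have "(\<Sum>k<Suc n. 1 - g (F (t - k * t / Suc n) s)) = - (\<Sum>k<Suc n. g (F (t - grid t (Suc n) k) s) - 1)"
      by (subst sum_negf[symmetric]) (simp add: grid_def del: sum.lessThan_Suc)
    moreover have "- of_real \<theta> * ((t / Suc n) *\<^sub>R (- S)) = of_real (\<theta> * (t / Suc n)) * S" for S :: complex
      by (simp add: scaleR_conv_of_real)
    ultimately show "exp (- of_real \<theta> * ((t / Suc n) *\<^sub>R (\<Sum>k<Suc n. 1 - g (F (t - k * t / Suc n) s)))) =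
        pgf M (discretised t (Suc n)) s"
      by (simp only: pgf_discretised[OF t zero_less_Suc s])
  qed
  finally show "(\<lambda>n. pgf M (discretised t (Suc n)) s) \<longlonglongrightarrow> exp (- of_real \<theta> * (P t - P 0))" .
qed

lemma pgf_immigration_tendsto_1:
  assumes t: "0 \<le> t"
  shows "(pgf M (immigration_process N I X t) \<longlongrightarrow> 1) (at 1 within cball 0 1)"
  using continuous_on_pgf[OF immigration_process_measurable[OF t]]
  unfolding continuous_on_def by (auto simp: pgf_1 dest!: bspec[of _ _ 1])

end

section \<open>The binomial series on its circle of convergence\<close>

text \<open>
  Summation by parts writes the difference of \<open>\<Sum> a\<^sub>n r\<^sup>n\<close> and its limit as \<open>(1 - r) \<Sum> d\<^sub>n r\<^sup>n\<close>, where the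
  errors \<open>d\<^sub>n\<close> of the partial sums tend to \<open>0\<close>.
\<close>

lemma abel_limit_theorem:
  fixes a :: "nat \<Rightarrow> complex"
  assumes "summable a"
  shows "((\<lambda>r. \<Sum>n. a n * of_real r ^ n) \<longlongrightarrow> suminf a) (at_left (1::real))"
proof -
  define S where "S = suminf a"
  define d where "d n = (\<Sum>k\<le>n. a k) - S" for n
  have d: "d \<longlonglongrightarrow> 0"
    unfolding d_def S_def using summable_LIMSEQ'[OF assms] by (simp add: LIM_zero)
  obtain C where C: "norm (d n) \<le> C" for n
    using convergent_imp_Bseq[OF convergentI[OF d]] by (auto simp: Bseq_def)
  have geo: "(\<lambda>n. of_real r ^ n :: complex) sums (1 / (1 - of_real r))" if "0 \<le> r" "r < 1" for r :: real
    using that by (intro geometric_sums) simp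
  have sumd: "summable (\<lambda>n. norm (d n * of_real r ^ n))" if r: "0 \<le> r" "r < 1" for r :: real
  proof (rule summable_comparison_test')
    show "summable (\<lambda>n. C * r ^ n)"
      using r by (intro summable_mult summable_geometric) simp
    show "norm (norm (d n * of_real r ^ n)) \<le> C * r ^ n" for n
      using C[of n] r by (simp add: norm_mult norm_power mult_right_mono)
  qed
  have eq: "(\<Sum>n. a n * of_real r ^ n) - S = (1 - of_real r) * (\<Sum>n. d n * of_real r ^ n)"
    if r: "0 \<le> r" "r < 1" for r :: real
  proof -
    let ?r = "of_real r :: complex"
    have sd: "summable (\<lambda>n. d n * ?r ^ n)"
      using sumd[OF r] by (rule summable_norm_cancel)
    define T where "T = (\<Sum>n. d n * ?r ^ n)"
    have T: "(\<lambda>n. d n * ?r ^ n) sums T"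
      using sd by (simp add: T_def summable_sums)
    have "(\<lambda>n. ?r * (d n * ?r ^ n)) sums (?r * T)"
      using T by (rule sums_mult)
    then have "(\<lambda>n. case n of 0 \<Rightarrow> - S | Suc m \<Rightarrow> ?r * (d m * ?r ^ m)) sums (?r * T + - S)"
      using sums_Suc[of "\<lambda>n. case n of 0 \<Rightarrow> - S | Suc m \<Rightarrow> ?r * (d m * ?r ^ m)" "?r * T"] by simp
    from sums_diff[OF T this]
    have "(\<lambda>n. d n * ?r ^ n - (case n of 0 \<Rightarrow> - S | Suc m \<Rightarrow> ?r * (d m * ?r ^ m))) sums (T - (?r * T + - S))" .
    also have "(\<lambda>n. d n * ?r ^ n - (case n of 0 \<Rightarrow> - S | Suc m \<Rightarrow> ?r * (d m * ?r ^ m))) = (\<lambda>n. a n * ?r ^ n)"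
      by (rule ext) (auto split: nat.split simp: d_def algebra_simps)
    finally have "(\<Sum>n. a n * ?r ^ n) = T - (?r * T + - S)"
      by (simp add: sums_iff)
    then show ?thesis by (simp add: T_def algebra_simps)
  qed
  have "((\<lambda>r. (\<Sum>n. a n * of_real r ^ n) - S) \<longlongrightarrow> 0) (at_left (1::real))"
  proof (rule tendstoI)
    fix e :: real assume e: "e > 0"
    obtain m where m: "norm (d n) < e / 2" if "n \<ge> m" for n
      using d[THEN LIMSEQ_D, of "e / 2"] e by auto
    \<comment> \<open>the finitely many large errors are damped by \<open>1 - r\<close>, all others are below \<open>e / 2\<close>\<close>
    define D where "D = (\<Sum>n<m. norm (d n))"
    have "((\<lambda>r. (1 - r) * D) \<longlongrightarrow> (1 - 1) * D) (at_left (1::real))"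
      by (intro tendsto_intros)
    then have "\<forall>\<^sub>F r in at_left (1::real). (1 - r) * D < e / 2"
      using e by (intro order_tendstoD) auto
    moreover have "\<forall>\<^sub>F r in at_left (1::real). r \<in> {0<..<1}"
      by (rule eventually_at_left_real) simp
    ultimately show "\<forall>\<^sub>F r in at_left (1::real). dist ((\<Sum>n. a n * of_real r ^ n) - S) 0 < e"
    proof eventually_elim
      case (elim r)
      then have r: "0 \<le> r" "r < 1" by auto
      have sn: "summable (\<lambda>n. norm (d n) * r ^ n)"
        using sumd[OF r] r by (simp add: norm_mult norm_power)
      have "norm (\<Sum>n. d n * of_real r ^ n) \<le> (\<Sum>n. norm (d n * of_real r ^ n))"
        by (rule summable_norm[OF sumd[OF r]])
      also have "\<dots> = (\<Sum>n. norm (d n) * r ^ n)"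
        using r by (simp add: norm_mult norm_power)
      also have "\<dots> \<le> (\<Sum>n. (if n < m then norm (d n) else 0) + e / 2 * r ^ n)"
      proof (rule suminf_le[OF _ sn])
        show "norm (d n) * r ^ n \<le> (if n < m then norm (d n) else 0) + e / 2 * r ^ n" for n
        proof (cases "n < m")
          case True
          have "norm (d n) * r ^ n \<le> norm (d n) * 1"
            using r by (intro mult_left_mono power_le_one) auto
          moreover have "0 \<le> e / 2 * r ^ n" using e r by simp
          ultimately show ?thesis using True by simp
        next
          case False
          then show ?thesis using mult_right_mono[of "norm (d n)" "e / 2" "r ^ n"] m[of n] r by auto
        qed
        show "summable (\<lambda>n. (if n < m then norm (d n) else 0) + e / 2 * r ^ n)"
          using r by (intro summable_add summable_mult summable_geometric summable_finite[of "{..<m}"]) auto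
      qed
      also have "\<dots> = (\<Sum>n. if n < m then norm (d n) else 0) + (\<Sum>n. e / 2 * r ^ n)"
        using r by (intro suminf_add[symmetric] summable_mult summable_geometric summable_finite[of "{..<m}"]) auto
      also have "(\<Sum>n. if n < m then norm (d n) else 0) = D"
        unfolding D_def by (subst suminf_finite[of "{..<m}"]) auto
      also have "(\<Sum>n. e / 2 * r ^ n) = e / 2 * (1 / (1 - r))"
        using r by (subst suminf_mult) (auto simp: suminf_geometric)
      finally have "(1 - r) * norm (\<Sum>n. d n * of_real r ^ n) \<le> (1 - r) * (D + e / 2 * (1 / (1 - r)))"
        using r by (intro mult_left_mono) auto
      also have "\<dots> = (1 - r) * D + e / 2"
        using r by (simp add: field_simps)
      also have "\<dots> < e" using elim by simp
      finally have *: "(1 - r) * norm (\<Sum>n. d n * of_real r ^ n) < e" .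
      have "norm (1 - of_real r :: complex) = 1 - r"
        using r by (metis abs_of_nonneg diff_ge_0_iff_ge less_imp_le norm_of_real of_real_1 of_real_diff)
      then show ?case
        using * by (simp add: eq[OF r] norm_mult)
    qed
  qed
  then show ?thesis
    by (simp add: S_def LIM_zero_iff)
qed

lemma falling_factorial_gbinomial:
  fixes a :: "'a :: field_char_0"
  shows "a gchoose k = falling_factorial a k / fact k"
  by (simp add: falling_factorial_def gbinomial_prod_rev atLeast0LessThan)

lemma falling_factorial_Suc:
  fixes a :: "'a :: comm_ring_1"
  shows "falling_factorial (1 + a) (Suc k) = (1 + a) * falling_factorial a k"
  by (simp add: falling_factorial_def prod.lessThan_Suc_shift del: prod.lessThan_Suc)

lemma falling_factorial_uminus:
  fixes a :: "'a :: comm_ring_1"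
  shows "falling_factorial (- a) k = (-1) ^ k * pochhammer a k"
proof -
  have "falling_factorial (- a) k = (\<Prod>i<k. (-1) * (a + of_nat i))"
    by (simp add: falling_factorial_def)
  then show ?thesis
    by (simp only: prod.distrib prod_constant) (simp add: pochhammer_prod atLeast0LessThan)
qed

text \<open>
  Convergence forces \<open>|x| \<le> 1\<close>, as the radius of convergence is \<open>1\<close>.  On the unit circle the sum is
  found by Abel's theorem, as \<open>1 + x\<close> avoids the branch cut and the power is continuous there.
\<close>

lemma binomial_series_right_half_plane:
  fixes x :: complex and a :: real
  assumes a: "complex_of_real a \<notin> \<nat>" and x: "0 \<le> Re x"
    and sm: "summable (\<lambda>j. (complex_of_real a gchoose j) * x ^ j)"
  shows "(\<lambda>j. (complex_of_real a gchoose j) * x ^ j) sums ((1 + x) powr complex_of_real a)"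
proof -
  let ?a = "complex_of_real a"
  have cr: "conv_radius (\<lambda>j. ?a gchoose j) = 1"
    using a by (simp add: conv_radius_gchoose)
  have x1: "norm x \<le> 1"
  proof (rule ccontr)
    assume "\<not> norm x \<le> 1"
    then have "ereal (norm x) > conv_radius (\<lambda>j. ?a gchoose j)"
      by (simp add: cr)
    then have "\<not> summable (\<lambda>j. (?a gchoose j) * x ^ j)"
      by (rule not_summable_outside_conv_radius)
    with sm show False by simp
  qed
  let ?f = "\<lambda>j. (?a gchoose j) * x ^ j"
  have lim1: "((\<lambda>r. \<Sum>n. ?f n * of_real r ^ n) \<longlongrightarrow> suminf ?f) (at_left (1::real))"
    by (rule abel_limit_theorem[OF sm])
  have "\<forall>\<^sub>F r in at_left (1::real). r \<in> {0<..<1}"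
    by (rule eventually_at_left_real) simp
  then have ev: "\<forall>\<^sub>F r in at_left (1::real). (1 + of_real r * x) powr ?a = (\<Sum>n. ?f n * of_real r ^ n)"
  proof eventually_elim
    case (elim r)
    then have "r * norm x \<le> r * 1" and "r < 1" using x1 by (auto intro!: mult_left_mono simp del: mult_1_right)
    then have "r * norm x < 1" by linarith
    then have "norm (of_real r * x) < 1"
      using elim by (simp add: norm_mult abs_of_pos)
    from gen_binomial_complex[OF this, of ?a] show ?case
      by (simp add: sums_iff power_mult_distrib mult_ac)
  qed
  have "1 + x \<notin> \<real>\<^sub>\<le>\<^sub>0"
    using x by (auto simp: complex_nonpos_Reals_iff)
  then have "((\<lambda>r. (1 + of_real r * x) powr ?a) \<longlongrightarrow> (1 + of_real 1 * x) powr ?a) (at_left (1::real))"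
    by (intro tendsto_powr_complex tendsto_intros) auto
  then have "((\<lambda>r. \<Sum>n. ?f n * of_real r ^ n) \<longlongrightarrow> (1 + x) powr ?a) (at_left (1::real))"
    using Lim_transform_eventually[OF _ ev] by simp
  with lim1 have "suminf ?f = (1 + x) powr ?a"
    by (intro tendsto_unique[OF _ lim1]) simp_all
  with sm show ?thesis
    by (metis summable_sums)
qed

text \<open>
  Up to the factor \<open>(1 - \<delta>) x\<close> the terms are those of the binomial series of \<open>(1 + x) powr (1 - \<delta>)\<close> from
  index \<open>2\<close> on.  As \<open>1 - \<delta>\<close> is less than \<open>1\<close> and not \<open>0\<close>, it is not a natural number.
\<close>

lemma power_series_of_closed_form:
  fixes x :: complex and \<delta> :: real
  assumes \<delta>: "\<delta> > 0" "\<delta> \<noteq> 1" and x: "0 \<le> Re x" "x \<noteq> 0"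
  defines "c \<equiv> \<lambda>j. x ^ (j - 1) * complex_of_real (falling_factorial (- \<delta>) (j - 1)) / fact j"
  shows "cmod x < 1 \<Longrightarrow> summable (\<lambda>j. c (j + 2))"
    and "summable (\<lambda>j. c (j + 2)) \<Longrightarrow>
      1 + (\<Sum>j. c (j + 2)) = ((1 + x) powr complex_of_real (1 - \<delta>) - 1) / (complex_of_real (1 - \<delta>) * x)"
proof -
  let ?a = "complex_of_real (1 - \<delta>)"
  let ?f = "\<lambda>j. (?a gchoose j) * x ^ j"
  have a0: "?a \<noteq> 0" using \<delta> by (metis eq_iff_diff_eq_0 of_real_eq_0_iff)
  have aN: "?a \<notin> \<nat>"
  proof
    assume "?a \<in> \<nat>"
    then obtain n where "?a = of_nat n" by (auto elim: Nats_cases)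
    then have "1 - \<delta> = real n" by (metis of_real_of_nat_eq of_real_eq_iff)
    with \<delta> show False by (cases n) auto
  qed
  have c: "?f (j + 2) = (?a * x) * c (j + 2)" for j
  proof -
    have ff: "falling_factorial (1 - \<delta>) (j + 2) = (1 - \<delta>) * falling_factorial (- \<delta>) (j + 1)"
      using falling_factorial_Suc[of "-\<delta>" "j+1"] by simp
    have "?a gchoose (j + 2) = complex_of_real ((1 - \<delta>) gchoose (j + 2))"
      by (simp add: gbinomial_prod_rev)
    also have "\<dots> = ?a * complex_of_real (falling_factorial (- \<delta>) (j + 1)) / fact (j + 2)"
      unfolding falling_factorial_gbinomial ff by simp
    finally have "?a gchoose (j + 2) = ?a * complex_of_real (falling_factorial (- \<delta>) (j + 1)) / fact (j + 2)" .
    then show ?thesis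
      unfolding c_def by (simp del: fact_Suc)
  qed
  have iff: "summable ?f \<longleftrightarrow> summable (\<lambda>j. c (j + 2))"
  proof -
    have "summable ?f \<longleftrightarrow> summable (\<lambda>j. ?f (j + 2))" by (rule summable_iff_shift[symmetric])
    also have "\<dots> \<longleftrightarrow> summable (\<lambda>j. c (j + 2))"
      unfolding c using a0 x by (subst summable_cmult_iff) auto
    finally show ?thesis .
  qed
  show "summable (\<lambda>j. c (j + 2))" if "cmod x < 1"
    using gen_binomial_complex[OF that, of ?a] iff by (auto simp: sums_iff)
  show "1 + (\<Sum>j. c (j + 2)) = ((1 + x) powr ?a - 1) / (?a * x)" if sm: "summable (\<lambda>j. c (j + 2))"
  proof -
    have "?f sums ((1 + x) powr ?a)"
      using binomial_series_right_half_plane[OF aN x(1)] sm iff by blast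
    then have "(\<lambda>j. ?f (j + 2)) sums ((1 + x) powr ?a - (\<Sum>j<2. ?f j))"
      by (rule sums_split_initial_segment)
    then have "(\<Sum>j. (?a * x) * c (j + 2)) = (1 + x) powr ?a - (1 + ?a * x)"
      unfolding c by (simp add: sums_iff numeral_2_eq_2)
    then have "(?a * x) * (\<Sum>j. c (j + 2)) = (1 + x) powr ?a - (1 + ?a * x)"
      by (simp only: suminf_mult[OF sm])
    then have "(?a * x) * (1 + (\<Sum>j. c (j + 2))) = (1 + x) powr ?a - 1"
      by (simp only: distrib_left) simp
    then show ?thesis
      using a0 x by (simp only: eq_divide_eq) (simp add: mult_ac)
  qed
qed

section \<open>Closed forms\<close>

lemma Re_one_plus:
  fixes \<kappa> :: complex
  assumes "0 \<le> Re \<kappa>" "0 \<le> v"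
  shows "1 \<le> Re (1 + of_real v * \<kappa>)" "1 + of_real v * \<kappa> \<notin> \<real>\<^sub>\<le>\<^sub>0" "1 + of_real v * \<kappa> \<noteq> 0"
proof -
  show *: "1 \<le> Re (1 + of_real v * \<kappa>)" using assms by simp
  then show "1 + of_real v * \<kappa> \<notin> \<real>\<^sub>\<le>\<^sub>0" by (auto simp: complex_nonpos_Reals_iff)
  then show "1 + of_real v * \<kappa> \<noteq> 0" by auto
qed

lemma antiderivative_linear_powr:
  fixes \<kappa> a :: complex
  assumes \<kappa>: "0 \<le> Re \<kappa>" "\<kappa> \<noteq> 0" and a: "a \<noteq> 0" and v: "0 \<le> v"
  shows "((\<lambda>v. (1 + of_real v * \<kappa>) powr a / (a * \<kappa>)) has_vector_derivative
    (1 + of_real v * \<kappa>) powr (a - 1)) (at v within S)"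
proof -
  have "((\<lambda>z. (1 + z * \<kappa>) powr a / (a * \<kappa>)) has_field_derivative
      (a * (1 + of_real v * \<kappa>) powr (a - 1) * \<kappa>) / (a * \<kappa>)) (at (of_real v))"
    using Re_one_plus[OF \<kappa>(1) v] by (auto intro!: derivative_eq_intros)
  then show ?thesis
    using a \<kappa> by (intro has_vector_derivative_real_field) simp
qed

lemma antiderivative_linear_inverse:
  fixes \<kappa> :: complex
  assumes \<kappa>: "0 \<le> Re \<kappa>" "\<kappa> \<noteq> 0" and v: "0 \<le> v"
  shows "((\<lambda>v. Ln (1 + of_real v * \<kappa>) / \<kappa>) has_vector_derivative
    (1 + of_real v * \<kappa>) powr (-1)) (at v within S)"
proof -
  have "((\<lambda>z. Ln (1 + z * \<kappa>)) has_field_derivative inverse (1 + of_real v * \<kappa>) * \<kappa>) (at (of_real v))"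
    using Re_one_plus[OF \<kappa>(1) v] by (auto intro!: derivative_eq_intros simp: divide_inverse)
  then have "((\<lambda>z. Ln (1 + z * \<kappa>) / \<kappa>) has_field_derivative
      (inverse (1 + of_real v * \<kappa>) * \<kappa>) / \<kappa>) (at (of_real v))"
    by (rule DERIV_cdivide)
  also have "(inverse (1 + of_real v * \<kappa>) * \<kappa>) / \<kappa> = (1 + of_real v * \<kappa>) powr (-1)"
    using \<kappa> Re_one_plus(3)[OF \<kappa>(1) v] by (simp add: powr_minus)
  finally show ?thesis
    by (rule has_vector_derivative_real_field)
qed

theorem theorem1:
  fixes M :: "'a measure" and K \<theta> \<beta> \<gamma> A \<delta> :: real
    and N :: "real \<Rightarrow> 'a \<Rightarrow> nat" and I :: "nat \<Rightarrow> 'a \<Rightarrow> nat"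
    and X :: "nat \<Rightarrow> nat \<Rightarrow> real \<Rightarrow> 'a \<Rightarrow> nat"
    and B x \<Phi> :: "real \<Rightarrow> complex \<Rightarrow> complex"
    and c :: "real \<Rightarrow> complex \<Rightarrow> nat \<Rightarrow> complex"
  assumes "prob_space M"
    and "K > 0" and "\<theta> > 0" and "0 < \<beta>" and "\<beta> < 1" and "0 < \<gamma>" and "\<gamma> < 1"
    and "\<And>i j. markov_branching_process M K
           (\<lambda>s. s + (1 - s) powr complex_of_real (1 + \<beta>) / complex_of_real (1 + \<beta>)) (X i j)"
    and "poisson_process M \<theta> N"
    and "\<And>i. has_pgf M (I i) (\<lambda>s. 1 - (1 - s) powr complex_of_real \<gamma>)"
    and "prob_space.indep_sets M (source_events M N I X) UNIV"
  defines "\<Phi> \<equiv> \<lambda>t s. pgf M (immigration_process N I X t) s"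
    and "A \<equiv> (1 + \<beta>) / (K * \<beta>)"
    and "B \<equiv> \<lambda>t s. 1 + complex_of_real t * (1 - s) powr complex_of_real \<beta> / complex_of_real A"
    and "\<delta> \<equiv> \<gamma> / \<beta>"
    and "x \<equiv> \<lambda>t s. (1 - s) powr complex_of_real \<beta> * complex_of_real t / complex_of_real A"
    and "c \<equiv> \<lambda>t s j. x t s ^ (j - 1) * complex_of_real (falling_factorial (- \<delta>) (j - 1)) / fact j"
  shows
    "(\<forall>i j t s. 0 \<le> t \<and> cmod s \<le> 1 \<longrightarrow>
        1 - pgf M (X i j t) s =
          (1 - s) * (1 + complex_of_real (K * \<beta>) * (1 - s) powr complex_of_real \<beta>
                           * complex_of_real t / complex_of_real (1 + \<beta>))
                    powr complex_of_real (- 1 / \<beta>)) \<and>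
     (\<forall>t s. 0 \<le> t \<and> cmod s \<le> 1 \<longrightarrow>
        pgf M (\<lambda>\<omega>. \<Sum>i<N t \<omega>. I i \<omega>) s =
          exp (- complex_of_real (\<theta> * t) * (1 - s) powr complex_of_real \<gamma>)) \<and>
     (\<beta> = \<gamma> \<longrightarrow> (\<forall>t s. 0 < t \<and> cmod s \<le> 1 \<longrightarrow>
        \<Phi> t s = (1 / B t s) powr complex_of_real (\<theta> * A))) \<and>
     (\<beta> \<noteq> \<gamma> \<longrightarrow> \<delta> > 0 \<and>
        (\<forall>t s. 0 < t \<and> cmod s \<le> 1 \<longrightarrow>
          \<Phi> t s = exp (- complex_of_real (\<theta> * A) * (1 - s) powr complex_of_real \<gamma>
                          / (1 - s) powr complex_of_real \<beta>
                        * ((B t s powr complex_of_real (1 - \<delta>) - 1) / complex_of_real (1 - \<delta>))) \<and>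
          (cmod (x t s) < 1 \<longrightarrow> summable (\<lambda>j. c t s (j + 2))) \<and>
          (summable (\<lambda>j. c t s (j + 2)) \<longrightarrow>
            \<Phi> t s = exp (- complex_of_real (\<theta> * t) * (1 - s) powr complex_of_real \<gamma>
                            * (1 + (\<Sum>j. c t s (j + 2)))))) \<and>
        (\<forall>j\<ge>1. falling_factorial (1 - \<delta>) j = (1 - \<delta>) * falling_factorial (- \<delta>) (j - 1) \<and>
           (1 - \<delta>) * falling_factorial (- \<delta>) (j - 1)
             = - (\<delta> - 1) * (- 1) ^ (j - 1) * pochhammer \<delta> (j - 1))) \<and>
     (\<forall>t\<ge>0. (\<Phi> t \<longlongrightarrow> 1) (at 1 within cball 0 1))"
proof -
  interpret prob_space M by fact
  define F :: "real \<Rightarrow> complex \<Rightarrow> complex" where "F v s = pgf M (X 0 0 v) s" for v s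
  \<comment> \<open>\<open>B(t,s) = 1 + t \<kappa>(s)\<close>, so that all integrands are powers of a function that is affine in time\<close>
  define \<kappa> :: "complex \<Rightarrow> complex" where "\<kappa> s = (1 - s) powr of_real \<beta> / of_real A" for s
  have A: "A > 0" using \<open>K > 0\<close> \<open>0 < \<beta>\<close> by (simp add: A_def)
  have rateA: "of_real (K * \<beta> / (1 + \<beta>) * v) * z = of_real v * (z / of_real A :: complex)" for v z
    using \<open>K > 0\<close> \<open>0 < \<beta>\<close> by (simp add: A_def field_simps)
  have B: "B t s = 1 + of_real t * \<kappa> s" and x: "x t s = of_real t * \<kappa> s" for t s
    by (simp_all add: B_def x_def \<kappa>_def)
  have \<kappa>: "0 \<le> Re (\<kappa> s)" "\<kappa> s \<noteq> 0" if "cmod s \<le> 1" "s \<noteq> 1" for s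
  proof -
    have "0 \<le> Re ((1 - s) powr of_real \<beta>)"
      using Re_less_1[OF that] assms by (intro Re_powr_nonneg) auto
    then show "0 \<le> Re (\<kappa> s)" using A by (simp add: \<kappa>_def)
    show "\<kappa> s \<noteq> 0" using A that by (simp add: \<kappa>_def)
  qed
  have logF: "Ln (1 - pgf M (X i j v) s) = Ln (1 - s) - Ln (1 + of_real v * \<kappa> s) / of_real \<beta>"
    "pgf M (X i j v) s \<noteq> 1" if "0 \<le> v" "cmod s \<le> 1" "s \<noteq> 1" for i j v s
  proof -
    note log = markov_branching_process_log_pgf[OF \<open>prob_space M\<close> \<open>K > 0\<close> \<open>0 < \<beta>\<close> \<open>\<beta> < 1\<close> assms(8) that(2,3,1), of i j]
    show "pgf M (X i j v) s \<noteq> 1" using log(1) by auto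
    show "Ln (1 - pgf M (X i j v) s) = Ln (1 - s) - Ln (1 + of_real v * \<kappa> s) / of_real \<beta>"
      unfolding log(2) \<kappa>_def rateA[symmetric] by (simp add: mult.commute)
  qed
  have expF: "1 - pgf M (X i j v) s = (1 - s) * (1 + of_real v * \<kappa> s) powr of_real (- 1 / \<beta>)"
    if v: "0 \<le> v" and s: "cmod s \<le> 1" for i j v s
  proof (cases "s = 1")
    case True
    then show ?thesis by (simp add: pgf_1)
  next
    case False
    have "1 - pgf M (X i j v) s = exp (Ln (1 - pgf M (X i j v) s))"
      using logF(2)[OF v s False, of i j] by simp
    also have "\<dots> = (1 - s) * exp (- Ln (1 + of_real v * \<kappa> s) / of_real \<beta>)"
      unfolding logF(1)[OF v s False] using False by (simp add: exp_diff exp_minus field_simps)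
    finally show ?thesis
      using Re_one_plus(3)[OF \<kappa>(1)[OF s False] v] by (simp add: powr_def)
  qed
  interpret immigration M \<theta> N I X "\<lambda>s. 1 - (1 - s) powr complex_of_real \<gamma>" F
  proof unfold_locales
    show "pgf M (X i j v) s = F v s" if "0 \<le> v" "cmod s \<le> 1" for i j v s
    proof -
      have "1 - pgf M (X i j v) s = 1 - pgf M (X 0 0 v) s"
        by (rule trans[OF expF[OF that] expF[OF that, symmetric]])
      then show ?thesis by (simp add: F_def)
    qed
    show "AE \<omega> in M. \<forall>t\<ge>0. \<forall>\<^sub>F t' in at_right t. X i j t' \<omega> = X i j t \<omega>" for i j
      by (rule markov_branching_process_right_continuous[OF assms(1,2,4,8)])
    show "(\<lambda>\<omega>. X i j (\<tau> \<omega>) \<omega>) \<in> measurable M (count_space UNIV)"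
      if "\<tau> \<in> borel_measurable M" "\<And>\<omega>. \<omega> \<in> space M \<Longrightarrow> 0 \<le> \<tau> \<omega>" for i j \<tau>
      by (rule markov_branching_process_measurable[OF assms(1,2,4,8) that])
  qed (use assms in auto)
  have intensity: "1 - (1 - (1 - F v s) powr of_real \<gamma>) =
      (1 - s) powr of_real \<gamma> * (1 + of_real v * \<kappa> s) powr (- of_real \<delta>)"
    if v: "0 \<le> v" and s: "cmod s \<le> 1" "s \<noteq> 1" for v s
  proof -
    have "(1 - F v s) powr of_real \<gamma> = exp (of_real \<gamma> * Ln (1 - F v s))"
      using logF(2)[OF v s, of 0 0] by (simp add: powr_def F_def)
    also have "of_real \<gamma> * Ln (1 - F v s) = of_real \<gamma> * Ln (1 - s) + (- of_real \<delta>) * Ln (1 + of_real v * \<kappa> s)"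
      unfolding F_def logF(1)[OF v s] by (simp add: \<delta>_def right_diff_distrib)
    also have "exp \<dots> = (1 - s) powr of_real \<gamma> * (1 + of_real v * \<kappa> s) powr (- of_real \<delta>)"
      using Re_one_plus(3)[OF \<kappa>(1)[OF s] v] s by (simp only: exp_add) (simp add: powr_def)
    finally show ?thesis by simp
  qed
  have \<Phi>P: "\<Phi> t s = exp (- of_real \<theta> * ((1 - s) powr of_real \<gamma> * (P t - P 0)))"
    if t: "0 < t" and s: "cmod s \<le> 1" "s \<noteq> 1"
      and P: "\<And>v. 0 \<le> v \<Longrightarrow> (P has_vector_derivative (1 + of_real v * \<kappa> s) powr (- of_real \<delta>)) (at v within {0..t})"
    for t s P
  proof -
    have "\<Phi> t s = exp (- of_real \<theta> * ((1 - s) powr of_real \<gamma> * P t - (1 - s) powr of_real \<gamma> * P 0))"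
      unfolding \<Phi>_def
    proof (rule pgf_immigration[OF t s(1), where P="\<lambda>v. (1 - s) powr of_real \<gamma> * P v"])
      fix v assume v: "v \<in> {0..t}"
      then show "((\<lambda>v. (1 - s) powr of_real \<gamma> * P v) has_vector_derivative
          1 - (1 - (1 - F v s) powr of_real \<gamma>)) (at v within {0..t})"
        using P[of v] by (subst intensity) (auto intro!: has_vector_derivative_mult_right s)
    next
      have "continuous_on {0..t} (\<lambda>v. (1 - s) powr of_real \<gamma> * (1 + of_real v * \<kappa> s) powr (- of_real \<delta>))"
      proof (intro continuous_on_mult continuous_on_const continuous_on_powr_complex)
        show "{0..t} \<subseteq> {v. 0 \<le> Re (1 + of_real v * \<kappa> s) \<or> Im (1 + of_real v * \<kappa> s) \<noteq> 0}"
        proof (intro subsetI CollectI disjI1)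
          fix v assume "v \<in> {0..t}"
          then show "0 \<le> Re (1 + of_real v * \<kappa> s)"
            using Re_one_plus(1)[OF \<kappa>(1)[OF s], of v] by simp
        qed
        show "0 < Re (- complex_of_real \<delta>)" if "v \<in> {0..t}" "1 + of_real v * \<kappa> s = 0" for v
          using Re_one_plus(3)[OF \<kappa>(1)[OF s], of v] that by simp
        show "continuous_on {0..t} (\<lambda>v. 1 + of_real v * \<kappa> s)"
          by (intro continuous_intros)
      qed
      then show "continuous_on {0..t} (\<lambda>v. 1 - (1 - (1 - F v s) powr of_real \<gamma>))"
        by (rule continuous_on_eq) (auto simp: intensity s)
    qed
    then show ?thesis by (simp add: right_diff_distrib)
  qed
  \<comment> \<open>at \<open>s = 1\<close> there are no logarithms; the closed forms are \<open>1\<close> there because \<open>0 powr a = 0\<close>\<close>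
  have \<Phi>1: "\<Phi> t 1 = 1" for t by (simp add: \<Phi>_def pgf_1)

  have 1: "1 - pgf M (X i j t) s =
      (1 - s) * (1 + complex_of_real (K * \<beta>) * (1 - s) powr complex_of_real \<beta>
                     * complex_of_real t / complex_of_real (1 + \<beta>)) powr complex_of_real (- 1 / \<beta>)"
    if "0 \<le> t" "cmod s \<le> 1" for i j t s
  proof -
    have "complex_of_real (K * \<beta>) * (1 - s) powr complex_of_real \<beta> * complex_of_real t / complex_of_real (1 + \<beta>) =
        of_real t * \<kappa> s"
      unfolding \<kappa>_def rateA[symmetric] by simp
    then show ?thesis using expF[OF that] by simp
  qed
  have 2: "pgf M (\<lambda>\<omega>. \<Sum>i<N t \<omega>. I i \<omega>) s =
      exp (- complex_of_real (\<theta> * t) * (1 - s) powr complex_of_real \<gamma>)"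
    if "0 \<le> t" "cmod s \<le> 1" for t s
    using pgf_compound_poisson[OF that] by simp
  have 3: "\<Phi> t s = (1 / B t s) powr complex_of_real (\<theta> * A)"
    if "\<beta> = \<gamma>" "0 < t" "cmod s \<le> 1" for t s
  proof (cases "s = 1")
    case True
    then show ?thesis by (simp add: \<Phi>1 B_def)
  next
    case False
    note \<kappa>s = \<kappa>[OF that(3) False]
    have \<delta>1: "\<delta> = 1" using \<open>0 < \<beta>\<close> that(1) by (simp add: \<delta>_def)
    have "\<Phi> t s = exp (- of_real \<theta> * ((1 - s) powr of_real \<gamma> * (Ln (1 + of_real t * \<kappa> s) / \<kappa> s - Ln (1 + of_real 0 * \<kappa> s) / \<kappa> s)))"
      using antiderivative_linear_inverse[OF \<kappa>s] by (intro \<Phi>P that(2,3) False) (simp add: \<delta>1)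
    also have "(1 - s) powr of_real \<gamma> * (Ln (1 + of_real t * \<kappa> s) / \<kappa> s - Ln (1 + of_real 0 * \<kappa> s) / \<kappa> s) =
        of_real A * Ln (B t s)"
      using \<kappa>s(2) A False by (simp add: \<kappa>_def that(1) B)
    also have "exp (- of_real \<theta> * (of_real A * Ln (B t s))) = (1 / B t s) powr of_real (\<theta> * A)"
      using Re_one_plus(2,3)[OF \<kappa>s(1), of t] that(2)
      by (simp add: powr_def B[symmetric] Ln_inverse divide_inverse mult.assoc)
    finally show ?thesis .
  qed
  have \<delta>0: "\<delta> > 0" using assms by (simp add: \<delta>_def)
  have 4: "\<Phi> t s = exp (- complex_of_real (\<theta> * A) * (1 - s) powr complex_of_real \<gamma>
                          / (1 - s) powr complex_of_real \<beta>
                        * ((B t s powr complex_of_real (1 - \<delta>) - 1) / complex_of_real (1 - \<delta>)))"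
    if ne: "\<beta> \<noteq> \<gamma>" and ts: "0 < t" "cmod s \<le> 1" for t s
  proof (cases "s = 1")
    case True
    then show ?thesis by (simp add: \<Phi>1)
  next
    case False
    note \<kappa>s = \<kappa>[OF ts(2) False]
    define a where "a = complex_of_real (1 - \<delta>)"
    have "1 - \<delta> \<noteq> 0" using ne \<open>0 < \<beta>\<close> by (simp add: \<delta>_def)
    then have a: "a \<noteq> 0" unfolding a_def by (simp only: of_real_eq_0_iff not_False_eq_True)
    have a1: "a - 1 = - of_real \<delta>" by (simp add: a_def)
    have "\<Phi> t s = exp (- of_real \<theta> * ((1 - s) powr of_real \<gamma> *
        ((1 + of_real t * \<kappa> s) powr a / (a * \<kappa> s) - (1 + of_real 0 * \<kappa> s) powr a / (a * \<kappa> s))))"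
      using antiderivative_linear_powr[OF \<kappa>s a] unfolding a1 by (intro \<Phi>P ts False)
    also have "- of_real \<theta> * ((1 - s) powr of_real \<gamma> *
        ((1 + of_real t * \<kappa> s) powr a / (a * \<kappa> s) - (1 + of_real 0 * \<kappa> s) powr a / (a * \<kappa> s))) =
        - of_real \<theta> * ((1 - s) powr of_real \<gamma> * ((B t s powr a - 1) / (a * \<kappa> s)))"
      by (simp add: B diff_divide_distrib)
    also have "\<dots> = - complex_of_real (\<theta> * A) * (1 - s) powr complex_of_real \<gamma>
        / (1 - s) powr complex_of_real \<beta> * ((B t s powr a - 1) / a)"
      using a A by (simp add: \<kappa>_def mult_ac)
    finally show ?thesis unfolding a_def .
  qed
  have 5: "(cmod (x t s) < 1 \<longrightarrow> summable (\<lambda>j. c t s (j + 2))) \<and>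
          (summable (\<lambda>j. c t s (j + 2)) \<longrightarrow>
            \<Phi> t s = exp (- complex_of_real (\<theta> * t) * (1 - s) powr complex_of_real \<gamma>
                            * (1 + (\<Sum>j. c t s (j + 2)))))"
    if ne: "\<beta> \<noteq> \<gamma>" and ts: "0 < t" "cmod s \<le> 1" for t s
  proof (cases "s = 1")
    case True
    then show ?thesis by (simp add: \<Phi>1 c_def x_def)
  next
    case False
    note \<kappa>s = \<kappa>[OF ts(2) False]
    have \<delta>1: "\<delta> \<noteq> 1" using ne \<open>0 < \<beta>\<close> by (simp add: \<delta>_def)
    then have a: "complex_of_real (1 - \<delta>) \<noteq> 0" by (simp only: of_real_eq_0_iff)
    have x0: "0 \<le> Re (x t s)" "x t s \<noteq> 0" using \<kappa>s ts by (simp_all add: x)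
    note series = power_series_of_closed_form[OF \<delta>0 \<delta>1 x0]
    have sm: "summable (\<lambda>j. c t s (j + 2))" if "cmod (x t s) < 1"
      unfolding c_def by (rule series(1)[OF that])
    have "\<Phi> t s = exp (- complex_of_real (\<theta> * t) * (1 - s) powr complex_of_real \<gamma> * (1 + (\<Sum>j. c t s (j + 2))))"
      if "summable (\<lambda>j. c t s (j + 2))"
    proof -
      have "1 + x t s = B t s" by (simp add: x B)
      then have sum: "1 + (\<Sum>j. c t s (j + 2)) =
          (B t s powr complex_of_real (1 - \<delta>) - 1) / (complex_of_real (1 - \<delta>) * x t s)"
        using series(2)[OF that[unfolded c_def]] by (simp only: c_def)
      have "- complex_of_real (\<theta> * t) * (1 - s) powr complex_of_real \<gamma> *
          ((B t s powr complex_of_real (1 - \<delta>) - 1) / (complex_of_real (1 - \<delta>) * x t s)) =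
          - complex_of_real (\<theta> * A) * (1 - s) powr complex_of_real \<gamma> / (1 - s) powr complex_of_real \<beta>
            * ((B t s powr complex_of_real (1 - \<delta>) - 1) / complex_of_real (1 - \<delta>))"
        using ts A False a by (simp add: x \<kappa>_def mult_ac)
      then show ?thesis
        unfolding sum by (simp only: 4[OF ne ts])
    qed
    with sm show ?thesis by blast
  qed
  have 6: "falling_factorial (1 - \<delta>) j = (1 - \<delta>) * falling_factorial (- \<delta>) (j - 1) \<and>
           (1 - \<delta>) * falling_factorial (- \<delta>) (j - 1)
             = - (\<delta> - 1) * (- 1) ^ (j - 1) * pochhammer \<delta> (j - 1)" if "1 \<le> j" for j
    using falling_factorial_Suc[of "- \<delta>" "j - 1"] falling_factorial_uminus[of \<delta> "j - 1"] that by simp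
  have 7: "(\<Phi> t \<longlongrightarrow> 1) (at 1 within cball 0 1)" if "0 \<le> t" for t
    using pgf_immigration_tendsto_1[OF that] by (simp add: \<Phi>_def)
  show ?thesis
    by (intro conjI allI impI; (elim conjE)?;
        (rule 1 2 3 4 \<delta>0 5[THEN conjunct1, rule_format] 5[THEN conjunct2, rule_format]
          6[THEN conjunct1] 6[THEN conjunct2] 7; assumption))
qed

end
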